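(* Let $n\ge 1$ and let $\alpha_1,\ldots,\alpha_n$ be pairwise distinct algebraic numbers, and let $d=[\mathbb{Q}(\alpha_1,\dots,\alpha_n):\mathbb{Q}]$. Then there is a positive constant $C=C(n,\alpha_1,\ldots,\alpha_n)$ such that for every algebraic integer $t$ whose degree over $\mathbb{Q}$ is at most $\overline{|t|}^{1/(nd+1)}$ and which satisfies $\overline{|t|}\ge C$, the $n$ algebraic numbers $\alpha_1+t,\ldots,\alpha_n+t$ are multiplicatively independent.
   Context: For an algebraic number $\alpha$ with conjugates $\alpha_1,\dots,\alpha_m$ over $\mathbb{Q}$, the house of $\alpha$ is $\overline{|\alpha|}=\max\{|\alpha_1|,\ldots,|\alpha_m|\}$. Non-zero complex numbers $z_1,\dots,z_n$ are multiplicatively dependent if there is a non-zero integer vector $(k_1,\dots,k_n)\in\mathbb{Z}^n$ with $z_1^{k_1}\cdots z_n^{k_n}=1$, and multiplicatively independent otherwise; a tuple of complex numbers is called multiplicatively dependent (resp. independent) only if all its coordinates are non-zero and they are multiplicatively dependent (resp. independent). *)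

theory Defs
  imports Complex_Main "HOL-Computational_Algebra.Polynomial"
begin

subsection \<open>Minimal polynomials over the rationals, conjugates, house\<close>

text \<open>Meaningful for algebraic \<open>z\<close> only; existence and uniqueness are shown in
  \<open>ex1_min_poly\<close> below.\<close>

definition min_poly :: "complex \<Rightarrow> rat poly" where
  "min_poly z = (THE p. lead_coeff p = 1 \<and> irreducible p \<and> poly (map_poly of_rat p) z = 0)"

definition deg_over_rat :: "complex \<Rightarrow> nat" where
  "deg_over_rat z = degree (min_poly z)"

definition conjugates :: "complex \<Rightarrow> complex set" where
  "conjugates z = {w. poly (map_poly of_rat (min_poly z)) w = 0}"

definition house :: "complex \<Rightarrow> real" where
  "house z = Max (norm ` conjugates z)"

lemma poly_of_rat_add:
  "poly (map_poly of_rat (p + q)) (z::complex) = poly (map_poly of_rat p) z + poly (map_poly of_rat q) z"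
proof -
  have "map_poly of_rat (p + q) = (map_poly of_rat p + map_poly of_rat q :: complex poly)"
    by (intro poly_eqI) (simp add: coeff_map_poly of_rat_add)
  thus ?thesis by simp
qed

lemma poly_of_rat_mult:
  "poly (map_poly of_rat (p * q)) (z::complex) = poly (map_poly of_rat p) z * poly (map_poly of_rat q) z"
proof -
  have "map_poly of_rat (p * q) = (map_poly of_rat p * map_poly of_rat q :: complex poly)"
    by (intro poly_eqI) (simp add: coeff_map_poly coeff_mult of_rat_sum of_rat_mult)
  thus ?thesis by simp
qed

lemma ex1_min_poly:
  assumes "algebraic (z :: complex)"
  shows "\<exists>!p :: rat poly. lead_coeff p = 1 \<and> irreducible p \<and> poly (map_poly of_rat p) z = 0"
proof -
  define R where "R = (\<lambda>p :: rat poly. poly (map_poly of_rat p) z = 0)"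
  have R_mult: "R (p * q) \<longleftrightarrow> R p \<or> R q" for p q
    by (simp add: R_def poly_of_rat_mult)
  have R_smult: "R (smult c p)" if "R p" for c p
    using R_mult[of "[:c:]" p] that by simp
  obtain P :: "int poly" where P: "P \<noteq> 0" "poly (map_poly of_int P) z = 0"
    using assms by (elim algebraicE')
  have "\<exists>p. p \<noteq> 0 \<and> R p"
  proof (intro exI[of _ "map_poly of_int P"] conjI)
    show "map_poly of_int P \<noteq> (0 :: rat poly)"
      using P(1) by (simp add: map_poly_eq_0_iff)
    have "map_poly of_rat (map_poly of_int P :: rat poly) = (map_poly of_int P :: complex poly)"
      by (intro poly_eqI) (simp add: coeff_map_poly)
    thus "R (map_poly of_int P)" using P(2) by (simp add: R_def)
  qed
  then obtain p0 where p0: "p0 \<noteq> 0" "R p0" "\<And>q. q \<noteq> 0 \<Longrightarrow> R q \<Longrightarrow> degree p0 \<le> degree q"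
    using ex_has_least_nat[of "\<lambda>p. p \<noteq> 0 \<and> R p" _ degree] by blast
  define p where "p = smult (inverse (lead_coeff p0)) p0"
  have p: "lead_coeff p = 1" "R p" "\<And>q. q \<noteq> 0 \<Longrightarrow> R q \<Longrightarrow> degree p \<le> degree q"
    using p0 R_smult by (auto simp: p_def)
  have p_nz: "p \<noteq> 0" using p(1) by auto
  have const: "\<not> R [:c:]" if "c \<noteq> 0" for c
    using that by (simp add: R_def map_poly_pCons)
  have nunit: "\<not> is_unit q" if "R q" for q
  proof
    assume "is_unit q"
    then obtain c where "q = [:c:]" "c dvd 1" by (auto simp: is_unit_poly_iff)
    moreover from this have "c \<noteq> 0" by auto
    ultimately show False using const that by blast
  qed
  have irr: "irreducible p"
  proof (rule irreducibleI)
    fix a b assume ab: "p = a * b"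
    have nz: "a \<noteq> 0" "b \<noteq> 0" using ab p_nz by auto
    have deg: "degree p = degree a + degree b" using ab nz by (simp add: degree_mult_eq)
    have "R a \<or> R b" using p(2) ab R_mult by simp
    thus "is_unit a \<or> is_unit b"
      using p(3)[of a] p(3)[of b] nz deg by (auto simp: is_unit_iff_degree)
  qed (use p_nz nunit p(2) in auto)
  have uniq: "q = p" if q: "lead_coeff q = 1" "irreducible q" "R q" for q
  proof -
    have "R (q mod p)"
    proof -
      have "poly (map_poly of_rat q) z = poly (map_poly of_rat (q div p * p + q mod p)) z" by simp
      thus ?thesis using p(2) q(3)
        unfolding R_def by (simp only: poly_of_rat_add poly_of_rat_mult) simp
    qed
    hence "q mod p = 0"
      using p(3)[of "q mod p"] degree_mod_less[OF p_nz, of q] by linarith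
    hence "p dvd q" by (simp add: mod_eq_0_iff_dvd)
    then obtain r where r: "q = p * r" by (rule dvdE)
    have "is_unit r" using irreducibleD[OF q(2) r] nunit p(2) by auto
    then obtain c where c: "r = [:c:]" by (auto simp: is_unit_poly_iff)
    have "c = 1" using q(1) p(1) r c by (simp split: if_splits)
    thus ?thesis using r c by simp
  qed
  show ?thesis
    using p(1,2) irr uniq unfolding R_def by blast
qed

subsection \<open>Degree of a number field\<close>

definition is_subfield :: "complex set \<Rightarrow> bool" where
  "is_subfield K \<longleftrightarrow> 0 \<in> K \<and> 1 \<in> K \<and>
     (\<forall>x\<in>K. \<forall>y\<in>K. x + y \<in> K \<and> x * y \<in> K) \<and>
     (\<forall>x\<in>K. - x \<in> K \<and> inverse x \<in> K)"

text \<open>Every subfield of \<open>\<complex>\<close> contains \<open>\<rat>\<close>, so this is \<open>\<rat>(S)\<close>.\<close>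

definition rat_adjoin :: "complex set \<Rightarrow> complex set" where
  "rat_adjoin S = \<Inter> {K. is_subfield K \<and> S \<subseteq> K}"

interpretation rat_vs: vector_space "\<lambda>(q::rat) (z::complex). of_rat q * z"
  by unfold_locales (simp_all add: algebra_simps of_rat_add of_rat_mult)

text \<open>Vector space dimension over \<open>\<rat>\<close>; it is \<open>0\<close> if \<open>K\<close> is infinite-dimensional.\<close>

definition ext_degree :: "complex set \<Rightarrow> nat" where
  "ext_degree K = rat_vs.dim K"

subsection \<open>Multiplicative dependence\<close>

definition mult_dependent :: "nat \<Rightarrow> (nat \<Rightarrow> complex) \<Rightarrow> bool" where
  "mult_dependent n z \<longleftrightarrow> (\<forall>i\<in>{1..n}. z i \<noteq> 0) \<and>
     (\<exists>k :: nat \<Rightarrow> int. (\<exists>i\<in>{1..n}. k i \<noteq> 0) \<and> (\<Prod>i\<in>{1..n}. z i powi k i) = 1)"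

definition mult_independent :: "nat \<Rightarrow> (nat \<Rightarrow> complex) \<Rightarrow> bool" where
  "mult_independent n z \<longleftrightarrow> (\<forall>i\<in>{1..n}. z i \<noteq> 0) \<and> \<not> mult_dependent n z"

end

theory Submission
  imports Defs
    "HOL-Complex_Analysis.Complex_Analysis"
    "HOL-Number_Theory.Number_Theory"
    "HOL-Computational_Algebra.Computational_Algebra"
    "HOL-Computational_Algebra.Field_as_Ring"
    "HOL-Real_Asymp.Real_Asymp"
    "Jordan_Normal_Form.Char_Poly"
begin

text \<open>
  Suppose that \<open>\<Prod>(\<alpha>\<^sub>i + t)^{k\<^sub>i} = 1\<close> and let \<open>T\<close> be the house of \<open>t\<close>. Dirichlet's theorem
  replaces the direction of \<open>k\<close> by a short integer vector \<open>l\<close>, and \<open>\<beta> = \<Prod>(\<alpha>\<^sub>i + t)^{l\<^sub>i}\<close> then has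
  very small height. A weak form of Dobrowolski's theorem (\<open>log M(\<beta>) \<ge> c / D^\<epsilon>\<close> unless \<open>\<beta>\<close> is a root of
  unity) forces \<open>\<beta>\<close> to be a root of unity. At a place where \<open>|t| = T\<close> this gives \<open>\<Sum> l\<^sub>i = 0\<close> and,
  the order of \<open>\<beta>\<close> being bounded in terms of its degree, \<open>\<Sum> l\<^sub>i log (1 + \<alpha>\<^sub>i / t) = 0\<close>. Expanding in powers
  of \<open>1 / t\<close>, the power sums \<open>\<Sum> l\<^sub>i \<alpha>\<^sub>i^j\<close> are one after the other too small to be nonzero, by Liouville's
  inequality over \<open>\<rat>(\<alpha>)\<close>; with \<open>n\<close> of them zero, a Vandermonde argument gives \<open>l = 0\<close>.

  Dobrowolski's bound comes from the Vandermonde product of the conjugates of \<open>\<beta>\<close>, taken with multiplicity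
  \<open>k\<close>, and their \<open>p\<close>-th powers for several primes \<open>p\<close>: the norm of \<open>f(\<beta>^p)\<close> is divisible by \<open>p^D\<close> for the
  minimal polynomial \<open>f\<close> of degree \<open>D\<close>, so the product is large, while it is bounded above by the Mahler measure.
\<close>

text \<open>The exponent \<open>n * d + 1\<close> is a budget. Let \<open>D\<close> bound the degree
  of \<open>\<rat>(\<alpha>, t)\<close>; it is of order at most \<open>T^(1/(nd+1))\<close>. With
  approximation quality \<open>Q\<close>, the logarithmic Mahler measure of \<open>\<beta>\<close>
  is at most of order \<open>D log T / Q\<close>. Dobrowolski's bound \<open>D^(-\<epsilon>)\<close>
  therefore lets \<open>Q\<close> exceed \<open>D\<close> only slightly, and \<open>l\<close> has
  entries of size about \<open>\<Lambda> = D^(n-1)\<close>; a bound like \<open>1/D\<close> would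
  double this exponent. The power sums do not involve \<open>t\<close>, so Liouville's inequality
  needs only \<open>\<Lambda>^d < T\<close>, and \<open>(n-1)d < nd+1\<close> leaves room for
  \<open>\<epsilon>\<close>. The tighter condition is \<open>w \<Lambda> < T\<close> for the order
  \<open>w\<close> of \<open>\<beta>\<close>: it keeps the logarithmic form inside one period of
  \<open>exp\<close>. With \<open>w\<close> of size \<open>D^(3/2)\<close> the exponent is
  \<open>n + 1/2\<close>, which fits even for \<open>d = 1\<close>; a bound
  \<open>w = O(D^2)\<close> would not fit. A second obstacle is that the numbers \<alpha>_i + t are
  neither integral nor units, so \<open>\<beta>\<close> is not integral in advance. Primitive
  polynomials repair this: a Mahler measure below 2 that includes the leading coefficient forces
  that coefficient to be 1 or -1.\<close>

hide_const (open) Determinants.det Finite_Cartesian_Product.mat Finite_Cartesian_Product.vec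
  Finite_Cartesian_Product.row up_ring.coeff up_ring.monom Henstock_Kurzweil_Integration.content
  module.smult

section \<open>Algebraic integers\<close>

text \<open>The characteristic polynomial of an integer matrix is monic with integer coefficients,
  so its eigenvalues are integral. All closure properties of algebraic integers below reduce to
  this.\<close>

lemma algebraic_int_eigenvalue:
  fixes v :: "nat \<Rightarrow> complex" and a :: "nat \<Rightarrow> nat \<Rightarrow> int"
  assumes eig: "\<And>i. i < n \<Longrightarrow> z * v i = (\<Sum>j<n. of_int (a i j) * v j)"
    and nz: "i0 < n" "v i0 \<noteq> 0"
  shows "algebraic_int z"
proof -
  define M :: "int mat" where "M = mat n n (\<lambda>(i,j). a i j)"
  define MC :: "complex mat" where "MC = map_mat of_int M"
  have M: "M \<in> carrier_mat n n" and MC: "MC \<in> carrier_mat n n"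
    by (auto simp: M_def MC_def)
  have "eigenvector MC (vec n v) z"
    unfolding eigenvector_def
  proof (intro conjI)
    show "vec n v \<in> carrier_vec (dim_row MC)" using MC by auto
    show "vec n v \<noteq> 0\<^sub>v (dim_row MC)"
    proof
      assume "vec n v = 0\<^sub>v (dim_row MC)"
      hence "vec_index (vec n v) i0 = vec_index (0\<^sub>v (dim_row MC)) i0" by simp
      thus False using nz MC by simp
    qed
    show "MC *\<^sub>v vec n v = z \<cdot>\<^sub>v vec n v"
      using MC eig by (intro eq_vecI)
        (auto simp: scalar_prod_def MC_def M_def lessThan_atLeast0)
  qed
  hence "eigenvalue MC z" unfolding eigenvalue_def by blast
  hence "poly (char_poly MC) z = 0" using eigenvalue_root_char_poly[OF MC] by simp
  also have "char_poly MC = map_poly of_int (char_poly M)"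
    unfolding MC_def by (rule of_int_hom.char_poly_hom[OF M])
  finally have "poly (map_poly of_int (char_poly M)) z = 0" .
  moreover have "monic (char_poly M)" using degree_monic_char_poly[OF M] by simp
  ultimately show ?thesis unfolding algebraic_int_altdef_ipoly by blast
qed

text \<open>The index set is arbitrary, so that the products \<open>x ^ i * y ^ j\<close> can be
  indexed directly by pairs.\<close>

definition int_span :: "'b set \<Rightarrow> ('b \<Rightarrow> complex) \<Rightarrow> complex set" where
  "int_span I v = range (\<lambda>a :: 'b \<Rightarrow> int. \<Sum>i\<in>I. of_int (a i) * v i)"

lemma int_span_add: "x \<in> int_span I v \<Longrightarrow> y \<in> int_span I v \<Longrightarrow> x + y \<in> int_span I v"
  unfolding int_span_def
proof safe
  fix a b :: "'a \<Rightarrow> int"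
  show "(\<Sum>i\<in>I. of_int (a i) * v i) + (\<Sum>i\<in>I. of_int (b i) * v i)
          \<in> range (\<lambda>a. \<Sum>i\<in>I. of_int (a i) * v i)"
    by (rule range_eqI[of _ _ "\<lambda>i. a i + b i"]) (simp add: sum.distrib algebra_simps)
qed

lemma int_span_scale: "x \<in> int_span I v \<Longrightarrow> of_int c * x \<in> int_span I v"
  unfolding int_span_def
proof safe
  fix a :: "'a \<Rightarrow> int"
  show "of_int c * (\<Sum>i\<in>I. of_int (a i) * v i) \<in> range (\<lambda>a. \<Sum>i\<in>I. of_int (a i) * v i)"
    by (rule range_eqI[of _ _ "\<lambda>i. c * a i"]) (simp add: sum_distrib_left mult.assoc)
qed

lemma int_span_0: "0 \<in> int_span I v"
  unfolding int_span_def by (rule range_eqI[of _ _ "\<lambda>_. 0"]) simp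

lemma int_span_sum: "(\<And>j. j \<in> J \<Longrightarrow> f j \<in> int_span I v) \<Longrightarrow> (\<Sum>j\<in>J. f j) \<in> int_span I v"
  by (induction J rule: infinite_finite_induct) (auto intro: int_span_0 int_span_add)

lemma int_span_base:
  assumes "finite I" "i \<in> I"
  shows "v i \<in> int_span I v"
  unfolding int_span_def
proof (rule range_eqI[of _ _ "\<lambda>j. if j = i then 1 else 0"])
  have "(\<Sum>j\<in>I. of_int (if j = i then 1 else 0) * v j) = (\<Sum>j\<in>I. if j = i then v j else 0)"
    by (intro sum.cong) auto
  also have "\<dots> = v i" using assms by simp
  finally show "v i = (\<Sum>j\<in>I. of_int (if j = i then 1 else 0) * v j)" by simp
qed

lemma int_span_stableI:
  assumes "\<And>i. i \<in> I \<Longrightarrow> z * v i \<in> int_span I v" "x \<in> int_span I v"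
  shows "z * x \<in> int_span I v"
proof -
  obtain a where x: "x = (\<Sum>i\<in>I. of_int (a i) * v i)"
    using assms(2) by (auto simp: int_span_def)
  have "z * x = (\<Sum>i\<in>I. of_int (a i) * (z * v i))"
    unfolding x sum_distrib_left by (intro sum.cong) (auto simp: algebra_simps)
  also have "\<dots> \<in> int_span I v"
    using assms(1) by (intro int_span_sum int_span_scale)
  finally show ?thesis .
qed

text \<open>The generators may be linearly dependent: any choice of integer coordinates for the
  products \<open>z * v i\<close> gives a matrix with eigenvector \<open>v\<close>, and one nonzero
  entry of \<open>v\<close> is enough.\<close>

lemma algebraic_int_int_span:
  assumes fin: "finite I" and st: "\<And>i. i \<in> I \<Longrightarrow> z * v i \<in> int_span I v"
    and nz: "i0 \<in> I" "v i0 \<noteq> 0"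
  shows "algebraic_int z"
proof -
  obtain h where h: "bij_betw h {..<card I} I"
    using ex_bij_betw_nat_finite[OF fin] by (auto simp: lessThan_atLeast0)
  have "\<forall>i\<in>I. \<exists>a. z * v i = (\<Sum>j\<in>I. of_int (a j) * v j)"
    using st by (auto simp: int_span_def)
  then obtain a where a: "\<And>i. i \<in> I \<Longrightarrow> z * v i = (\<Sum>j\<in>I. of_int (a i j) * v j)"
    by metis
  obtain k where k: "k < card I" "h k = i0"
    using h nz(1) unfolding bij_betw_def by (metis imageE lessThan_iff)
  show ?thesis
  proof (rule algebraic_int_eigenvalue[of "card I" z "v \<circ> h" "\<lambda>i j. a (h i) (h j)" k])
    fix i assume "i < card I"
    hence "h i \<in> I" using h by (auto simp: bij_betw_def)
    hence "z * v (h i) = (\<Sum>j\<in>I. of_int (a (h i) j) * v j)" by (rule a)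
    also have "\<dots> = (\<Sum>j<card I. of_int (a (h i) (h j)) * v (h j))"
      by (rule sum.reindex_bij_betw[OF h, symmetric])
    finally show "z * (v \<circ> h) i = (\<Sum>j<card I. of_int (a (h i) (h j)) * (v \<circ> h) j)" by simp
  qed (use k nz in auto)
qed

section \<open>Ring operations on algebraic integers\<close>

lemma algebraic_int_power_relation:
  assumes "algebraic_int (x :: complex)"
  obtains m and c :: "nat \<Rightarrow> int" where "m > 0" "x ^ m = (\<Sum>i<m. of_int (c i) * x ^ i)"
proof -
  obtain p :: "int poly" where p: "poly (of_int_poly p) x = 0" "monic p"
    using assms unfolding algebraic_int_altdef_ipoly by blast
  define m where "m = degree p"
  have "m > 0"
  proof (rule ccontr)
    assume "\<not> m > 0"
    hence "p = 1" using p(2) by (simp add: m_def monic_degree_0)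
    thus False using p(1) by simp
  qed
  have "0 = (\<Sum>i\<le>m. of_int (coeff p i) * x ^ i)"
    using p(1) by (simp add: poly_altdef m_def)
  also have "\<dots> = (\<Sum>i<m. of_int (coeff p i) * x ^ i) + x ^ m"
    using p(2) by (simp add: lessThan_Suc_atMost[symmetric] m_def)
  finally have "x ^ m = (\<Sum>i<m. of_int (- coeff p i) * x ^ i)"
    by (simp add: sum_negf eq_neg_iff_add_eq_0 add.commute)
  with \<open>m > 0\<close> show ?thesis by (rule that)
qed

text \<open>The monomials \<open>x ^ i * y ^ j\<close> below the degrees of two monic relations span
  a module that is stable under both \<open>x\<close> and \<open>y\<close>, hence under the sum and
  the product.\<close>

lemma algebraic_int_add_mult:
  assumes "algebraic_int (x :: complex)" "algebraic_int y"
  shows "algebraic_int (x + y) \<and> algebraic_int (x * y)"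
proof -
  obtain m c where mc: "m > 0" "x ^ m = (\<Sum>i<m. of_int (c i) * x ^ i)"
    using algebraic_int_power_relation[OF assms(1)] by blast
  obtain n e where ne: "n > 0" "y ^ n = (\<Sum>i<n. of_int (e i) * y ^ i)"
    using algebraic_int_power_relation[OF assms(2)] by blast
  define I where "I = {..<m} \<times> {..<n}"
  define v where "v = (\<lambda>(i, j). x ^ i * y ^ j)"
  have fin: "finite I" by (simp add: I_def)
  have vI: "x ^ i * y ^ j \<in> int_span I v" if "i < m" "j < n" for i j
    using int_span_base[OF fin, of "(i, j)" v] that by (auto simp: I_def v_def)
  have sx: "x * v k \<in> int_span I v" if kI: "k \<in> I" for k
  proof -
    obtain i j where k: "k = (i, j)" "i < m" "j < n"
      using kI unfolding I_def by (cases k) auto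
    show ?thesis
    proof (cases "Suc i < m")
      case True
      thus ?thesis using vI[of "Suc i" j] k by (simp add: v_def mult.assoc)
    next
      case False
      hence m: "m = Suc i" using k by simp
      have "x * v k = x ^ m * y ^ j" using k m by (simp add: v_def mult.assoc)
      also have "\<dots> = (\<Sum>l<m. of_int (c l) * (x ^ l * y ^ j))"
        unfolding mc(2) sum_distrib_right by (simp add: mult.assoc)
      also have "\<dots> \<in> int_span I v"
        using k by (intro int_span_sum int_span_scale vI) auto
      finally show ?thesis .
    qed
  qed
  have sy: "y * v k \<in> int_span I v" if kI: "k \<in> I" for k
  proof -
    obtain i j where k: "k = (i, j)" "i < m" "j < n"
      using kI unfolding I_def by (cases k) auto
    show ?thesis
    proof (cases "Suc j < n")
      case True
      thus ?thesis using vI[of i "Suc j"] k by (simp add: v_def mult_ac)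
    next
      case False
      hence n: "n = Suc j" using k by simp
      have "y * v k = x ^ i * y ^ n" using k n by (simp add: v_def mult_ac)
      also have "\<dots> = (\<Sum>l<n. of_int (e l) * (x ^ i * y ^ l))"
        unfolding ne(2) sum_distrib_left by (simp add: mult_ac)
      also have "\<dots> \<in> int_span I v"
        using k by (intro int_span_sum int_span_scale vI) auto
      finally show ?thesis .
    qed
  qed
  have i0: "(0, 0) \<in> I" "v (0, 0) \<noteq> 0" using mc(1) ne(1) by (auto simp: I_def v_def)
  have "algebraic_int (x + y)"
    by (rule algebraic_int_int_span[where v = v, OF fin _ i0]) (auto simp: distrib_right intro: int_span_add sx sy)
  moreover have "algebraic_int (x * y)"
    by (rule algebraic_int_int_span[where v = v, OF fin _ i0])
      (auto simp: mult.assoc intro: int_span_stableI sx sy)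
  ultimately show ?thesis ..
qed

lemma algebraic_int_add: "algebraic_int x \<Longrightarrow> algebraic_int y \<Longrightarrow> algebraic_int (x + y :: complex)"
  and algebraic_int_mult: "algebraic_int x \<Longrightarrow> algebraic_int y \<Longrightarrow> algebraic_int (x * y :: complex)"
  using algebraic_int_add_mult by blast+

lemma algebraic_int_diff: "algebraic_int x \<Longrightarrow> algebraic_int y \<Longrightarrow> algebraic_int (x - y :: complex)"
  using algebraic_int_add[of x "- y"] by simp

lemma algebraic_int_sum: "(\<And>i. i \<in> I \<Longrightarrow> algebraic_int (f i)) \<Longrightarrow> algebraic_int (\<Sum>i\<in>I. f i :: complex)"
  by (induction I rule: infinite_finite_induct) (auto intro: algebraic_int_add)

lemma algebraic_int_prod: "(\<And>i. i \<in> I \<Longrightarrow> algebraic_int (f i)) \<Longrightarrow> algebraic_int (\<Prod>i\<in>I. f i :: complex)"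
  by (induction I rule: infinite_finite_induct) (auto intro: algebraic_int_mult algebraic_int_1)

lemma algebraic_int_power: "algebraic_int x \<Longrightarrow> algebraic_int (x ^ n :: complex)"
  by (induction n) (auto intro: algebraic_int_mult algebraic_int_1)

lemma algebraic_int_poly:
  "(\<And>i. algebraic_int (coeff p i)) \<Longrightarrow> algebraic_int x \<Longrightarrow> algebraic_int (poly p x :: complex)"
  unfolding poly_altdef by (intro algebraic_int_sum algebraic_int_mult algebraic_int_power)

lemma algebraic_int_coeff_mult:
  fixes p q :: "complex poly"
  assumes "\<And>i. algebraic_int (coeff p i)" "\<And>i. algebraic_int (coeff q i)"
  shows "algebraic_int (coeff (p * q) i)"
  unfolding coeff_mult by (intro algebraic_int_sum algebraic_int_mult assms)

lemma algebraic_int_coeff_prod: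
  fixes p :: "'b \<Rightarrow> complex poly"
  assumes "\<And>j i. j \<in> J \<Longrightarrow> algebraic_int (coeff (p j) i)"
  shows "algebraic_int (coeff (\<Prod>j\<in>J. p j) i)"
  using assms
proof (induction J arbitrary: i rule: infinite_finite_induct)
  case (insert j J)
  thus ?case by (simp add: algebraic_int_coeff_mult)
qed (auto simp: one_pCons coeff_pCons algebraic_int_1 split: nat.splits)

lemma norm_ge_1_if_rational_algebraic_int:
  assumes "algebraic_int (x :: complex)" "x \<in> \<rat>" "x \<noteq> 0"
  shows "norm x \<ge> 1"
proof -
  obtain k where "x = of_int k"
    using rational_algebraic_int_is_int[OF assms(1,2)] by (auto elim: Ints_cases)
  thus ?thesis using assms(3) by (auto simp: norm_of_int)
qed

text \<open>Multiplied by the power \<open>n - 1\<close> of the leading coefficient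
  \<open>c\<close>, the equation of \<open>x\<close> becomes monic in \<open>c * x\<close>. The sign
  of \<open>c\<close> is absorbed at the end to reach a natural multiplier.\<close>

lemma algebraic_int_denominator:
  assumes "algebraic (x :: complex)"
  shows "\<exists>a::nat. a > 0 \<and> algebraic_int (of_nat a * x)"
proof -
  obtain p :: "int poly" where p: "poly (map_poly of_int p) x = 0" "p \<noteq> 0"
    using assms by (elim algebraicE') auto
  define n where "n = degree p"
  define c where "c = lead_coeff p"
  define y where "y = of_int c * x"
  have c: "c \<noteq> 0" using p by (simp add: c_def)
  have "n > 0"
  proof (rule ccontr)
    assume "\<not> n > 0"
    then obtain e where "p = [:e:]" by (auto simp: n_def elim: degree_eq_zeroE)
    thus False using p by simp
  qed
  have y: "algebraic_int y"
  proof (rule algebraic_int_int_span[of "{..<n}" y "\<lambda>i. of_int c ^ i * x ^ i" 0])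
    let ?v = "\<lambda>i. of_int c ^ i * x ^ i :: complex"
    have base: "?v i \<in> int_span {..<n} ?v" if "i < n" for i
      using int_span_base[of "{..<n}" i ?v] that by simp
    fix i assume "i \<in> {..<n}"
    hence i: "i < n" by simp
    show "y * ?v i \<in> int_span {..<n} ?v"
    proof (cases "Suc i < n")
      case True
      thus ?thesis using base[of "Suc i"] by (simp add: y_def algebra_simps)
    next
      case False
      hence n: "n = Suc i" using i by simp
      have "0 = (\<Sum>j\<le>n. of_int (coeff p j) * x ^ j)"
        using p(1) by (simp add: poly_altdef n_def)
      also have "\<dots> = (\<Sum>j<n. of_int (coeff p j) * x ^ j) + of_int c * x ^ n"
        by (simp add: lessThan_Suc_atMost[symmetric] n_def c_def)
      finally have rel: "of_int c * x ^ n = - (\<Sum>j<n. of_int (coeff p j) * x ^ j)"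
        by (simp add: eq_neg_iff_add_eq_0 add.commute)
      have "y * ?v i = of_int c ^ i * (of_int c * x ^ n)"
        using n by (simp add: y_def algebra_simps)
      also have "\<dots> = (\<Sum>j<n. of_int (- coeff p j * c ^ (i - j)) * ?v j)"
        unfolding rel sum_distrib_left sum_negf[symmetric] using n
        by (intro sum.cong) (auto simp: power_add[symmetric] simp flip: mult.assoc)
      also have "\<dots> \<in> int_span {..<n} ?v"
        by (intro int_span_sum int_span_scale base) auto
      finally show ?thesis .
    qed
  qed (use \<open>n > 0\<close> in auto)
  have "algebraic_int (of_int (sgn c) * y)"
    by (intro algebraic_int_mult algebraic_int_of_int y)
  also have "of_int (sgn c) * y = of_nat (nat \<bar>c\<bar>) * x"
    by (auto simp: y_def sgn_if)
  finally show ?thesis using c by (intro exI[of _ "nat \<bar>c\<bar>"]) auto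
qed

section \<open>Vandermonde determinants\<close>

definition vandermonde_mat :: "nat \<Rightarrow> (nat \<Rightarrow> 'a :: comm_ring_1) \<Rightarrow> 'a mat" where
  "vandermonde_mat n z = mat n n (\<lambda>(i, j). z i ^ j)"

lemma vandermonde_mat_carrier: "vandermonde_mat n z \<in> carrier_mat n n"
  by (simp add: vandermonde_mat_def)

lemma poly_eq_if_agree_on_roots:
  fixes p q :: "'a :: field poly"
  assumes "finite A" "\<And>x. x \<in> A \<Longrightarrow> poly p x = poly q x" "p - q = 0 \<or> degree (p - q) < card A"
  shows "p = q"
proof (rule ccontr)
  assume "p \<noteq> q"
  hence nz: "p - q \<noteq> 0" by simp
  have "A \<subseteq> {x. poly (p - q) x = 0}" using assms(2) by auto
  hence "card A \<le> card {x. poly (p - q) x = 0}"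
    by (intro card_mono poly_roots_finite nz)
  also have "\<dots> \<le> degree (p - q)" by (rule card_poly_roots_bound[OF nz])
  finally show False using assms(3) nz by simp
qed

text \<open>As a function of the last node the determinant is a polynomial vanishing at the other
  nodes, with the smaller determinant as coefficient of degree \<open>n\<close>. Subtracting the
  expected product cancels that coefficient, so agreement at \<open>n\<close> points
  suffices.\<close>

lemma det_vandermonde:
  fixes z :: "nat \<Rightarrow> 'a :: field"
  assumes "inj_on z {..<n}"
  shows "det (vandermonde_mat n z) = (\<Prod>j<n. \<Prod>i<j. z j - z i)"
  using assms
proof (induction n)
  case 0
  show ?case by (simp add: vandermonde_mat_def)
next
  case (Suc n)
  have inj: "inj_on z {..<n}" by (rule inj_on_subset[OF Suc.prems]) auto
  define W where "W = (\<lambda>x. vandermonde_mat (Suc n) (z(n := x)))"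
  define c where "c = (\<lambda>j. cofactor (W (z n)) n j)"
  have W: "W x \<in> carrier_mat (Suc n) (Suc n)" for x
    by (simp add: W_def vandermonde_mat_def)
  have del: "mat_delete (W x) n j = mat_delete (W (z n)) n j" for x j
    by (auto simp: W_def vandermonde_mat_def mat_delete_def intro!: cong_mat)
  have deln: "mat_delete (W (z n)) n n = vandermonde_mat n z"
    by (auto simp: W_def vandermonde_mat_def mat_delete_def intro!: eq_matI)
  define p where "p = (\<Sum>j<Suc n. monom (c j) j)"
  have poly_p: "poly p x = det (W x)" for x
  proof -
    have "det (W x) = (\<Sum>j<Suc n. W x $$ (n, j) * cofactor (W x) n j)"
      by (rule laplace_expansion_row[OF W]) simp
    also have "\<dots> = (\<Sum>j<Suc n. x ^ j * c j)"
      by (intro sum.cong) (auto simp: c_def cofactor_def del[of x], simp_all add: W_def vandermonde_mat_def)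
    finally show ?thesis by (simp add: p_def poly_sum poly_monom mult.commute)
  qed
  define q where "q = smult (c n) (\<Prod>i<n. [:- z i, 1:])"
  have deg_prod: "degree (\<Prod>i<m. [:- z i, 1:]) = m" for m
    by (subst degree_prod_eq_sum_degree) auto
  have monic: "coeff (\<Prod>i<n. [:- z i, 1:]) n = 1"
    using monic_prod[of "{..<n}" "\<lambda>i. [:- z i, 1:]"] deg_prod[of n] by simp
  have "p = q"
  proof (rule poly_eq_if_agree_on_roots[of "z ` {..<n}"])
    fix x assume "x \<in> z ` {..<n}"
    then obtain i where i: "i < n" "x = z i" by auto
    have "det (W x) = 0"
    proof (rule Determinant.det_identical_rows[OF W])
      show "row (W x) i = row (W x) n"
        using i by (auto simp: W_def vandermonde_mat_def intro!: eq_vecI)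
    qed (use i in auto)
    moreover have "poly q x = 0" using i by (auto simp: q_def poly_prod)
    ultimately show "poly p x = poly q x" by (simp add: poly_p)
  next
    have cp: "coeff p j = (if j \<le> n then c j else 0)" for j
      by (simp add: p_def coeff_sum coeff_monom)
    have "degree (p - q) \<le> n"
      using deg_prod[of n] by (intro degree_diff_le) (auto simp: cp q_def intro!: degree_le)
    moreover have "coeff (p - q) n = 0" using monic by (simp add: cp q_def)
    ultimately have "p - q = 0 \<or> degree (p - q) < n"
      by (metis eq_zero_or_degree_less)
    moreover have "card (z ` {..<n}) = n" using inj by (simp add: card_image)
    ultimately show "p - q = 0 \<or> degree (p - q) < card (z ` {..<n})" by simp
  qed simp
  have "det (vandermonde_mat (Suc n) z) = poly q (z n)"
    using poly_p[of "z n"] \<open>p = q\<close> by (simp add: W_def)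
  also have "\<dots> = c n * (\<Prod>i<n. z n - z i)" by (simp add: q_def poly_prod)
  also have "c n = det (vandermonde_mat n z)"
    by (simp add: c_def cofactor_def deln)
  finally show ?case using Suc.IH[OF inj] by simp
qed

text \<open>The Leibniz expansion bounds each of the \<open>fact n\<close> terms. Hadamard's
  inequality would be sharper, but the factor enters only through its logarithm, which the weak
  Dobrowolski bound can afford.\<close>

lemma norm_det_vandermonde_le:
  fixes z :: "nat \<Rightarrow> complex"
  shows "norm (det (vandermonde_mat n z)) \<le> fact n * (\<Prod>i<n. max 1 (norm (z i))) ^ (n - 1)"
proof -
  let ?P = "{p. p permutes {0..<n}}"
  have "norm (det (vandermonde_mat n z))
          \<le> (\<Sum>p\<in>?P. norm (of_int (sign p) * (\<Prod>i = 0..<n. vandermonde_mat n z $$ (i, p i))))"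
    unfolding det_def'[OF vandermonde_mat_carrier] by (rule norm_sum)
  also have "\<dots> \<le> (\<Sum>p\<in>?P. (\<Prod>i<n. max 1 (norm (z i))) ^ (n - 1))"
  proof (rule sum_mono)
    fix p assume "p \<in> ?P"
    hence p: "p permutes {0..<n}" by simp
    have "norm (of_int (sign p) * (\<Prod>i = 0..<n. vandermonde_mat n z $$ (i, p i)))
            = (\<Prod>i<n. norm (vandermonde_mat n z $$ (i, p i)))"
      by (simp add: norm_mult norm_of_int sign_def prod_norm lessThan_atLeast0)
    also have "\<dots> \<le> (\<Prod>i<n. max 1 (norm (z i)) ^ (n - 1))"
    proof (rule prod_mono, safe)
      fix i assume i: "i < n"
      have pi: "p i < n" using permutes_in_image[OF p, of i] i by simp
      have "norm (vandermonde_mat n z $$ (i, p i)) = norm (z i) ^ p i"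
        using i pi by (simp add: vandermonde_mat_def norm_power)
      also have "\<dots> \<le> max 1 (norm (z i)) ^ p i" by (intro power_mono) auto
      also have "\<dots> \<le> max 1 (norm (z i)) ^ (n - 1)"
        using pi by (intro power_increasing) auto
      finally show "norm (vandermonde_mat n z $$ (i, p i)) \<le> max 1 (norm (z i)) ^ (n - 1)" .
    qed auto
    also have "\<dots> = (\<Prod>i<n. max 1 (norm (z i))) ^ (n - 1)" by (rule prod_power_distrib[symmetric])
    finally show "norm (of_int (sign p) * (\<Prod>i = 0..<n. vandermonde_mat n z $$ (i, p i)))
                    \<le> (\<Prod>i<n. max 1 (norm (z i))) ^ (n - 1)" .
  qed
  also have "\<dots> = fact n * (\<Prod>i<n. max 1 (norm (z i))) ^ (n - 1)"
    by (simp add: card_permutations[of "{0..<n}" n])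
  finally show ?thesis .
qed

lemma prod_offdiag_lessThan:
  fixes f :: "nat \<Rightarrow> nat \<Rightarrow> 'a :: comm_monoid_mult"
  assumes "\<And>i j. f i j = f j i"
  shows "(\<Prod>j<n. \<Prod>i\<in>{..<n} - {j}. f i j) = (\<Prod>j<n. \<Prod>i<j. f i j) ^ 2"
proof (induction n)
  case (Suc n)
  have "(\<Prod>j<Suc n. \<Prod>i\<in>{..<Suc n} - {j}. f i j)
          = (\<Prod>j<n. \<Prod>i\<in>{..<Suc n} - {j}. f i j) * (\<Prod>i<n. f i n)"
    by (simp add: lessThan_Suc mult.commute)
  also have "(\<Prod>j<n. \<Prod>i\<in>{..<Suc n} - {j}. f i j) = (\<Prod>j<n. f n j * (\<Prod>i\<in>{..<n} - {j}. f i j))"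
  proof (rule prod.cong)
    fix j assume "j \<in> {..<n}"
    hence "{..<Suc n} - {j} = insert n ({..<n} - {j})" by auto
    thus "(\<Prod>i\<in>{..<Suc n} - {j}. f i j) = f n j * (\<Prod>i\<in>{..<n} - {j}. f i j)" by simp
  qed simp
  also have "\<dots> = (\<Prod>j<n. f j n) * (\<Prod>j<n. \<Prod>i<j. f i j) ^ 2"
    unfolding prod.distrib Suc.IH using assms by simp
  finally show ?case by (simp add: power2_eq_square mult_ac)
qed simp

text \<open>For distinct points the left side is the squared modulus of the Vandermonde determinant,
  each unordered pair occurring twice; for coinciding points it is zero.\<close>

lemma prod_norm_differences_le:
  fixes z :: "'b \<Rightarrow> complex"
  assumes "finite I"
  shows "(\<Prod>j\<in>I. \<Prod>i\<in>I - {j}. norm (z i - z j))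
           \<le> (fact (card I) * (\<Prod>i\<in>I. max 1 (norm (z i))) ^ (card I - 1)) ^ 2"
proof (cases "inj_on z I")
  case False
  then obtain i j where ij: "i \<in> I" "j \<in> I" "i \<noteq> j" "z i = z j" by (auto simp: inj_on_def)
  hence "(\<Prod>i\<in>I - {j}. norm (z i - z j)) = 0" using assms by (intro prod_zero) auto
  hence "(\<Prod>j\<in>I. \<Prod>i\<in>I - {j}. norm (z i - z j)) = 0" using assms ij(2) by (intro prod_zero) auto
  thus ?thesis by simp
next
  case True
  define n where "n = card I"
  obtain h where h: "bij_betw h {..<n} I"
    using ex_bij_betw_nat_finite[OF assms] by (auto simp: n_def lessThan_atLeast0)
  define y where "y = z \<circ> h"
  have inj: "inj_on y {..<n}"
    unfolding y_def using h True by (auto simp: bij_betw_def intro!: comp_inj_on)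
  have "(\<Prod>j\<in>I. \<Prod>i\<in>I - {j}. norm (z i - z j))
          = (\<Prod>j<n. \<Prod>i\<in>I - {h j}. norm (z i - z (h j)))"
    by (rule prod.reindex_bij_betw[OF h, symmetric])
  also have "\<dots> = (\<Prod>j<n. \<Prod>i\<in>{..<n} - {j}. norm (y i - y j))"
  proof (rule prod.cong)
    fix j assume j: "j \<in> {..<n}"
    have "bij_betw h ({..<n} - {j}) (I - {h j})"
      using h j by (auto simp: bij_betw_def inj_on_def)
    thus "(\<Prod>i\<in>I - {h j}. norm (z i - z (h j))) = (\<Prod>i\<in>{..<n} - {j}. norm (y i - y j))"
      unfolding y_def o_def by (rule prod.reindex_bij_betw[symmetric])
  qed simp
  also have "\<dots> = (\<Prod>j<n. \<Prod>i<j. norm (y i - y j)) ^ 2"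
    by (rule prod_offdiag_lessThan) (simp add: norm_minus_commute)
  also have "(\<Prod>j<n. \<Prod>i<j. norm (y i - y j)) = norm (det (vandermonde_mat n y))"
    unfolding det_vandermonde[OF inj] by (simp add: prod_norm norm_minus_commute)
  also have "norm (det (vandermonde_mat n y)) ^ 2
               \<le> (fact n * (\<Prod>i<n. max 1 (norm (y i))) ^ (n - 1)) ^ 2"
    by (intro power_mono norm_det_vandermonde_le) auto
  also have "(\<Prod>i<n. max 1 (norm (y i))) = (\<Prod>i\<in>I. max 1 (norm (z i)))"
    unfolding y_def o_def by (rule prod.reindex_bij_betw[OF h])
  finally show ?thesis by (simp add: n_def)
qed

section \<open>Minimal polynomials and conjugates\<close>

lemma poly_of_rat_const: "poly (map_poly of_rat [:a:]) (z::complex) = of_rat a"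
  by (simp add: of_rat_hom.map_poly_pCons_hom)

lemma
  assumes "algebraic z"
  shows monic_min_poly: "lead_coeff (min_poly z) = 1"
    and irreducible_min_poly: "irreducible (min_poly z)"
    and poly_min_poly: "poly (map_poly of_rat (min_poly z)) z = 0"
  using theI'[OF ex1_min_poly[OF assms]] unfolding min_poly_def by auto

lemma min_poly_eqI:
  assumes "lead_coeff p = 1" "irreducible p" "poly (map_poly of_rat p) z = 0"
  shows "min_poly z = p"
proof -
  have "algebraic z"
  proof (rule algebraicI')
    show "coeff (map_poly of_rat p) i \<in> (\<rat> :: complex set)" for i by (simp add: coeff_map_poly)
    show "map_poly of_rat p \<noteq> (0 :: complex poly)" using assms(1) by auto
  qed (rule assms(3))
  thus ?thesis
    unfolding min_poly_def using assms by (intro the1_equality ex1_min_poly) auto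
qed

lemma bezout_min_poly:
  assumes "algebraic z" "\<not> min_poly z dvd q"
  obtains r s where "r * min_poly z + s * q = 1"
proof -
  have "coprime (min_poly z) q"
    using assms irreducible_min_poly[OF assms(1)]
    by (intro prime_elem_imp_coprime irreducible_imp_prime_elem)
  hence "gcd (min_poly z) q = 1" by simp
  thus ?thesis using that bezout_coefficients_fst_snd[of "min_poly z" q] by metis
qed

lemma min_poly_dvd_iff:
  assumes "algebraic z"
  shows "poly (map_poly of_rat q) z = 0 \<longleftrightarrow> min_poly z dvd q"
proof
  assume "min_poly z dvd q"
  then obtain r where "q = min_poly z * r" by (elim dvdE)
  thus "poly (map_poly of_rat q) z = 0"
    using poly_min_poly[OF assms] by (simp add: poly_of_rat_mult)
next
  assume q: "poly (map_poly of_rat q) z = 0"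
  show "min_poly z dvd q"
  proof (rule ccontr)
    assume "\<not> min_poly z dvd q"
    then obtain r s where rs: "r * min_poly z + s * q = 1" by (rule bezout_min_poly[OF assms])
    have "poly (map_poly of_rat (r * min_poly z + s * q)) z = 0"
      unfolding poly_of_rat_add poly_of_rat_mult using q poly_min_poly[OF assms] by simp
    thus False unfolding rs by simp
  qed
qed

lemma conjugatesD:
  assumes "algebraic z" "w \<in> conjugates z" "poly (map_poly of_rat q) z = 0"
  shows "poly (map_poly of_rat q) w = 0"
proof -
  obtain r where "q = min_poly z * r" using assms(3) min_poly_dvd_iff[OF assms(1)] by (auto elim: dvdE)
  thus ?thesis using assms(2) by (simp add: conjugates_def poly_of_rat_mult)
qed

lemma min_poly_conjugate: "algebraic z \<Longrightarrow> w \<in> conjugates z \<Longrightarrow> min_poly w = min_poly z"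
  by (intro min_poly_eqI monic_min_poly irreducible_min_poly) (auto simp: conjugates_def)

lemma conjugates_conjugate: "algebraic z \<Longrightarrow> w \<in> conjugates z \<Longrightarrow> conjugates w = conjugates z"
  using min_poly_conjugate[of z w] unfolding conjugates_def[of z] conjugates_def[of w] by simp

lemma self_in_conjugates: "algebraic z \<Longrightarrow> z \<in> conjugates z"
  by (simp add: conjugates_def poly_min_poly)

lemma min_poly_nonzero: "algebraic z \<Longrightarrow> min_poly z \<noteq> 0"
  using irreducible_min_poly[of z] by (auto simp: irreducible_def)

lemma algebraic_conjugate: "algebraic z \<Longrightarrow> w \<in> conjugates z \<Longrightarrow> algebraic w"
  using min_poly_nonzero[of z]
  by (intro algebraicI'[of "map_poly of_rat (min_poly z)"]) (simp_all add: coeff_map_poly conjugates_def)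

lemma finite_conjugates: "algebraic z \<Longrightarrow> finite (conjugates z)"
  unfolding conjugates_def by (intro poly_roots_finite) (simp add: min_poly_nonzero)

lemma algebraic_int_poly_of_rat:
  assumes "algebraic_int (z :: complex)"
  obtains q :: "int poly" where "monic q" "poly (map_poly of_int q) z = 0"
    "poly (map_poly of_rat (map_poly of_int q)) z = 0"
proof -
  obtain q :: "int poly" where q: "monic q" "poly (map_poly of_int q) z = 0"
    using assms unfolding algebraic_int_altdef_ipoly by blast
  moreover have "map_poly of_rat (map_poly of_int q :: rat poly) = (map_poly of_int q :: complex poly)"
    by (intro poly_eqI) (simp add: coeff_map_poly)
  ultimately show ?thesis using that by simp
qed

lemma algebraic_int_conjugate:
  assumes "algebraic_int z" "w \<in> conjugates z"
  shows "algebraic_int w"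
proof -
  obtain q :: "int poly" where q: "monic q" "poly (map_poly of_rat (map_poly of_int q)) z = 0"
    using algebraic_int_poly_of_rat[OF assms(1)] by blast
  have "poly (map_poly of_rat (map_poly of_int q)) w = 0"
    using conjugatesD[OF _ assms(2) q(2)] assms(1) by auto
  also have "map_poly of_rat (map_poly of_int q :: rat poly) = (map_poly of_int q :: complex poly)"
    by (intro poly_eqI) (simp add: coeff_map_poly)
  finally show ?thesis using q(1) unfolding algebraic_int_altdef_ipoly by blast
qed

text \<open>Separability in characteristic zero: the derivative is nonzero of smaller degree, hence
  coprime to the irreducible polynomial, and a Bezout identity excludes a common complex
  root.\<close>

lemma rsquarefree_min_poly:
  assumes "algebraic z"
  shows "rsquarefree (map_poly of_rat (min_poly z) :: complex poly)"
  unfolding rsquarefree_roots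
proof (intro allI notI, elim conjE)
  fix w :: complex
  let ?f = "min_poly z"
  assume w: "poly (map_poly of_rat ?f) w = 0" "poly (pderiv (map_poly of_rat ?f)) w = 0"
  have deg: "degree ?f \<noteq> 0"
    using irreducible_min_poly[OF assms] min_poly_nonzero[OF assms]
    by (metis irreducible_not_unit is_unit_iff_degree)
  have "\<not> ?f dvd pderiv ?f"
  proof
    assume "?f dvd pderiv ?f"
    moreover have "pderiv ?f \<noteq> 0" using deg by (simp add: pderiv_eq_0_iff)
    ultimately have "degree ?f \<le> degree (pderiv ?f)" by (intro dvd_imp_degree_le)
    thus False using deg by (simp add: degree_pderiv)
  qed
  then obtain r s where rs: "r * ?f + s * pderiv ?f = 1" by (rule bezout_min_poly[OF assms])
  have "poly (map_poly of_rat (r * ?f + s * pderiv ?f)) w = 0"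
    unfolding poly_of_rat_add poly_of_rat_mult of_rat_hom.map_poly_pderiv using w by simp
  thus False unfolding rs by simp
qed

lemma card_conjugates: "algebraic z \<Longrightarrow> card (conjugates z) = deg_over_rat z"
  using rsquarefree_min_poly[of z] min_poly_nonzero[of z]
  by (simp add: conjugates_def deg_over_rat_def rsquarefree_card_degree)

lemma min_poly_eq_prod_conjugates:
  assumes "algebraic z"
  shows "map_poly of_rat (min_poly z) = (\<Prod>w\<in>conjugates z. [:- w, 1:])"
  using complex_poly_decompose_rsquarefree[OF rsquarefree_min_poly[OF assms]] monic_min_poly[OF assms]
  by (simp add: conjugates_def)

text \<open>The coefficients are rational, as those of the minimal polynomial, and integral, as
  polynomials in the conjugates, hence integers. Frobenius congruences need this integer
  form.\<close>

lemma int_poly_conjugates: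
  assumes "algebraic_int z"
  obtains f :: "int poly" where "\<And>x. poly (map_poly of_int f) x = (\<Prod>w\<in>conjugates z. x - w)"
proof -
  have alg: "algebraic z" using assms by auto
  have "coeff (\<Prod>w\<in>conjugates z. [:- w, 1:]) i \<in> \<int>" for i
  proof (rule rational_algebraic_int_is_int)
    show "coeff (\<Prod>w\<in>conjugates z. [:- w, 1:]) i \<in> \<rat>"
      unfolding min_poly_eq_prod_conjugates[OF alg, symmetric] by (simp add: coeff_map_poly)
    show "algebraic_int (coeff (\<Prod>w\<in>conjugates z. [:- w, 1:]) i)"
      by (intro algebraic_int_coeff_prod)
        (auto simp: coeff_pCons algebraic_int_conjugate[OF assms] split: nat.splits)
  qed
  then obtain f where f: "(\<Prod>w\<in>conjugates z. [:- w, 1:]) = map_poly of_int f" using intpolyE by blast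
  show ?thesis by (rule that[of f]) (simp add: poly_prod flip: f)
qed

lemma card_conjugates_pos: "algebraic z \<Longrightarrow> card (conjugates z) \<ge> 1"
  using self_in_conjugates[of z] finite_conjugates[of z] by (auto simp: Suc_le_eq card_gt_0_iff)

text \<open>Multiplication by \<open>R(x)\<close> on \<open>\<rat>[x]/(f)\<close> is a rational matrix whose eigenvectors are the columns
  of a Vandermonde matrix.\<close>

lemma prod_conjugates_rational:
  assumes "algebraic z"
  shows "(\<Prod>w\<in>conjugates z. poly (map_poly of_rat R) w) \<in> \<rat>"
proof -
  define f where "f = min_poly z"
  define n where "n = card (conjugates z)"
  have n: "n = degree f" by (simp add: n_def card_conjugates[OF assms] deg_over_rat_def f_def)
  obtain h where h: "bij_betw h {..<n} (conjugates z)"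
    using ex_bij_betw_nat_finite[OF finite_conjugates[OF assms]] by (auto simp: n_def lessThan_atLeast0)
  define A :: "rat mat" where "A = mat n n (\<lambda>(i, j). coeff ((monom 1 i * R) mod f) j)"
  define V where "V = transpose_mat (vandermonde_mat n h)"
  define r where "r = (\<lambda>i. poly (map_poly of_rat R) (h i))"
  have carr: "A \<in> carrier_mat n n" "map_mat of_rat A \<in> carrier_mat n n" "V \<in> carrier_mat n n"
    by (auto simp: A_def V_def vandermonde_mat_def)
  have f0: "f \<noteq> 0" using min_poly_nonzero[OF assms] by (simp add: f_def)
  have ev: "(\<Sum>j<n. of_rat (coeff ((monom 1 i * R) mod f) j) * w ^ j) = w ^ i * poly (map_poly of_rat R) w"
    if w: "w \<in> conjugates z" for i w
  proof -
    let ?p = "(monom 1 i * R) mod f"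
    have "poly (map_poly of_rat ?p) w = (\<Sum>j\<le>degree ?p. of_rat (coeff ?p j) * w ^ j)"
      by (simp add: poly_altdef coeff_map_poly)
    also have "\<dots> = (\<Sum>j<n. of_rat (coeff ?p j) * w ^ j)"
    proof (cases "n = 0")
      case True
      hence "?p = 0" using f0 n
        by (metis mod_eq_0_iff_dvd is_unit_iff_degree unit_imp_dvd)
      thus ?thesis using True by simp
    next
      case False
      have "?p = 0 \<or> degree ?p < n" using degree_mod_less[OF f0, of "monom 1 i * R"] n by simp
      thus ?thesis using False
        by (intro sum.mono_neutral_left) (auto simp: coeff_eq_0)
    qed
    also have "poly (map_poly of_rat ?p) w = poly (map_poly of_rat (monom 1 i * R)) w"
    proof -
      have "poly (map_poly of_rat (monom 1 i * R)) w
              = poly (map_poly of_rat ((monom 1 i * R) div f * f + ?p)) w" by simp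
      also have "\<dots> = poly (map_poly of_rat ?p) w"
        using w unfolding poly_of_rat_add poly_of_rat_mult by (simp add: conjugates_def f_def)
      finally show ?thesis by simp
    qed
    also have "\<dots> = w ^ i * poly (map_poly of_rat R) w"
      by (simp add: poly_of_rat_mult of_rat_hom.map_poly_hom_monom poly_monom)
    finally show ?thesis by simp
  qed
  have "map_mat of_rat A * V = V * mat_diag n r"
  proof (rule eq_matI)
    fix i j assume "i < dim_row (V * mat_diag n r)" "j < dim_col (V * mat_diag n r)"
    hence ij: "i < n" "j < n" using carr by (auto simp: mat_diag_def)
    have hj: "h j \<in> conjugates z" using h ij by (auto simp: bij_betw_def)
    have "(map_mat of_rat A * V) $$ (i, j)
            = (\<Sum>k<n. of_rat (coeff ((monom 1 i * R) mod f) k) * h j ^ k)"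
      using ij carr by (simp add: scalar_prod_def A_def V_def vandermonde_mat_def lessThan_atLeast0)
    also have "\<dots> = h j ^ i * r j" unfolding r_def by (rule ev[OF hj])
    also have "\<dots> = (V * mat_diag n r) $$ (i, j)"
      using ij carr by (simp add: mat_diag_mult_right[OF carr(3)])
        (simp add: V_def vandermonde_mat_def)
    finally show "(map_mat of_rat A * V) $$ (i, j) = (V * mat_diag n r) $$ (i, j)" .
  qed (use carr in \<open>auto simp: mat_diag_def\<close>)
  hence "det (map_mat of_rat A * V) = det (V * mat_diag n r)" by simp
  hence "det (map_mat of_rat A) * det V = det V * det (mat_diag n r)"
    unfolding det_mult[OF carr(2,3)] det_mult[OF carr(3) mat_diag_dim] .
  \<comment> \<open>The conjugates are distinct, so the Vandermonde determinant cancels from both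
    sides and the product of the values is the determinant of a rational matrix.\<close>
  moreover have "det V \<noteq> 0"
  proof -
    have "inj_on h {..<n}" using h by (simp add: bij_betw_def)
    hence "det (vandermonde_mat n h) \<noteq> 0"
      unfolding det_vandermonde[OF \<open>inj_on h {..<n}\<close>] by (auto dest: inj_onD)
    thus ?thesis by (simp add: V_def Determinant.det_transpose[OF vandermonde_mat_carrier])
  qed
  ultimately have "det (map_mat of_rat A) = det (mat_diag n r)" by simp
  also have "det (mat_diag n r) = prod_list (diag_mat (mat_diag n r))"
    by (rule det_upper_triangular[OF _ mat_diag_dim]) (auto simp: mat_diag_def)
  also have "diag_mat (mat_diag n r) = map r [0..<n]"
    by (auto simp: diag_mat_def mat_diag_def)
  also have "prod_list (map r [0..<n]) = (\<Prod>i<n. r i)"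
    using prod.distinct_set_conv_list[of "[0..<n]" r] by (simp add: lessThan_atLeast0)
  also have "\<dots> = (\<Prod>w\<in>conjugates z. poly (map_poly of_rat R) w)"
    unfolding r_def by (rule prod.reindex_bij_betw[OF h])
  finally have "det (map_mat of_rat A) = (\<Prod>w\<in>conjugates z. poly (map_poly of_rat R) w)" .
  moreover have "det (map_mat of_rat A) = (of_rat (det A) :: complex)"
    by (rule of_rat_hom.hom_det)
  ultimately show ?thesis by (metis Rats_of_rat)
qed

section \<open>Simple extensions and their embeddings\<close>

text \<open>Polynomial values already form the field \<open>\<rat>(\<xi>)\<close> when
  \<open>\<xi>\<close> is algebraic; inverses come from Bezout identities.\<close>

definition qext :: "complex \<Rightarrow> complex set" where
  "qext \<xi> = range (\<lambda>R. poly (map_poly of_rat R) \<xi>)"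

text \<open>The embedding of \<open>\<rat>(\<xi>)\<close> that sends \<open>\<xi>\<close> to its
  conjugate \<open>\<eta>\<close>. The chosen representative \<open>R\<close> does not matter, since
  two of them differ by a multiple of the minimal polynomial of \<open>\<xi>\<close>. Outside
  \<open>qext \<xi>\<close> the value is arbitrary.\<close>

definition emb :: "complex \<Rightarrow> complex \<Rightarrow> complex \<Rightarrow> complex" where
  "emb \<xi> \<eta> z = poly (map_poly of_rat (SOME R. poly (map_poly of_rat R) \<xi> = z)) \<eta>"

lemma qextI: "poly (map_poly of_rat R) \<xi> \<in> qext \<xi>"
  by (simp add: qext_def)

lemma qextE:
  assumes "z \<in> qext \<xi>" obtains R where "z = poly (map_poly of_rat R) \<xi>"
  using assms by (auto simp: qext_def)

lemma qext_of_rat: "of_rat q \<in> qext \<xi>"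
  using qextI[of "[:q:]" \<xi>] by (simp add: poly_of_rat_const)

lemma qext_0: "0 \<in> qext \<xi>" and qext_1: "1 \<in> qext \<xi>"
  using qext_of_rat[of 0 \<xi>] qext_of_rat[of 1 \<xi>] by simp_all

lemma qext_of_nat: "of_nat k \<in> qext \<xi>"
  using qext_of_rat[of "of_nat k" \<xi>] by simp

lemma qext_of_int: "of_int k \<in> qext \<xi>"
  using qext_of_rat[of "of_int k" \<xi>] by simp

lemma qext_self: "\<xi> \<in> qext \<xi>"
  using qextI[of "[:0, 1:]" \<xi>] by (simp add: of_rat_hom.map_poly_pCons_hom)

lemma qext_add: "x \<in> qext \<xi> \<Longrightarrow> y \<in> qext \<xi> \<Longrightarrow> x + y \<in> qext \<xi>"
  by (elim qextE) (metis poly_of_rat_add qextI)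

lemma qext_mult: "x \<in> qext \<xi> \<Longrightarrow> y \<in> qext \<xi> \<Longrightarrow> x * y \<in> qext \<xi>"
  by (elim qextE) (metis poly_of_rat_mult qextI)

lemma qext_minus: "x \<in> qext \<xi> \<Longrightarrow> - x \<in> qext \<xi>"
  using qext_mult[OF qext_of_int[of "-1"]] by fastforce

lemma qext_diff: "x \<in> qext \<xi> \<Longrightarrow> y \<in> qext \<xi> \<Longrightarrow> x - y \<in> qext \<xi>"
  using qext_add[of x \<xi> "- y"] qext_minus by simp

lemma qext_sum: "(\<And>i. i \<in> I \<Longrightarrow> f i \<in> qext \<xi>) \<Longrightarrow> (\<Sum>i\<in>I. f i) \<in> qext \<xi>"
  by (induction I rule: infinite_finite_induct) (auto intro: qext_add qext_0)

lemma qext_prod: "(\<And>i. i \<in> I \<Longrightarrow> f i \<in> qext \<xi>) \<Longrightarrow> (\<Prod>i\<in>I. f i) \<in> qext \<xi>"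
  by (induction I rule: infinite_finite_induct) (auto intro: qext_mult qext_1)

lemma qext_power: "x \<in> qext \<xi> \<Longrightarrow> x ^ n \<in> qext \<xi>"
  by (induction n) (auto intro: qext_mult qext_1)

lemma qext_inverse:
  assumes \<xi>: "algebraic \<xi>" and z: "z \<in> qext \<xi>"
  shows "inverse z \<in> qext \<xi>"
proof (cases "z = 0")
  case True
  thus ?thesis by (simp add: qext_0)
next
  case False
  obtain R where R: "z = poly (map_poly of_rat R) \<xi>" using z by (rule qextE)
  have "\<not> min_poly \<xi> dvd R" using False min_poly_dvd_iff[OF \<xi>] R by simp
  then obtain r s where rs: "r * min_poly \<xi> + s * R = 1" by (rule bezout_min_poly[OF \<xi>])
  have "poly (map_poly of_rat (r * min_poly \<xi> + s * R)) \<xi> = poly (map_poly of_rat s) \<xi> * z"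
    unfolding poly_of_rat_add poly_of_rat_mult poly_min_poly[OF \<xi>] R by simp
  hence "poly (map_poly of_rat s) \<xi> * z = 1" unfolding rs by simp
  hence "inverse z = poly (map_poly of_rat s) \<xi>" using False by (simp add: field_simps)
  thus ?thesis by (simp add: qextI)
qed

lemma qext_powi: "algebraic \<xi> \<Longrightarrow> x \<in> qext \<xi> \<Longrightarrow> x powi k \<in> qext \<xi>"
  by (auto simp: power_int_def intro: qext_power qext_inverse)

lemma is_subfield_qext: "algebraic \<xi> \<Longrightarrow> is_subfield (qext \<xi>)"
  unfolding is_subfield_def
  by (auto intro: qext_0 qext_1 qext_add qext_mult qext_minus qext_inverse)

lemma qext_trans: "x \<in> qext y \<Longrightarrow> y \<in> qext z \<Longrightarrow> x \<in> qext z"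
  by (erule qextE)
    (auto simp: poly_altdef coeff_map_poly intro!: qext_sum qext_mult qext_of_rat qext_power)

context
  fixes \<xi> :: complex
  assumes \<xi>: "algebraic \<xi>"
begin

lemma emb_poly:
  assumes \<eta>: "\<eta> \<in> conjugates \<xi>"
  shows "emb \<xi> \<eta> (poly (map_poly of_rat R) \<xi>) = poly (map_poly of_rat R) \<eta>"
proof -
  define S where "S = (SOME S. poly (map_poly of_rat S) \<xi> = poly (map_poly of_rat R) \<xi>)"
  have "poly (map_poly of_rat S) \<xi> = poly (map_poly of_rat R) \<xi>"
    unfolding S_def by (rule someI[of _ R]) simp
  hence "poly (map_poly of_rat (S - R)) \<xi> = 0"
    using poly_of_rat_add[of "S - R" R \<xi>] by simp
  hence "poly (map_poly of_rat (S - R)) \<eta> = 0" by (rule conjugatesD[OF \<xi> \<eta>])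
  thus ?thesis using poly_of_rat_add[of "S - R" R \<eta>] by (simp add: emb_def S_def)
qed

lemma emb_add: "\<eta> \<in> conjugates \<xi> \<Longrightarrow> x \<in> qext \<xi> \<Longrightarrow> y \<in> qext \<xi> \<Longrightarrow>
    emb \<xi> \<eta> (x + y) = emb \<xi> \<eta> x + emb \<xi> \<eta> y"
  by (elim qextE) (simp add: emb_poly flip: poly_of_rat_add)

lemma emb_mult: "\<eta> \<in> conjugates \<xi> \<Longrightarrow> x \<in> qext \<xi> \<Longrightarrow> y \<in> qext \<xi> \<Longrightarrow>
    emb \<xi> \<eta> (x * y) = emb \<xi> \<eta> x * emb \<xi> \<eta> y"
  by (elim qextE) (simp add: emb_poly flip: poly_of_rat_mult)

lemma emb_of_rat: "\<eta> \<in> conjugates \<xi> \<Longrightarrow> emb \<xi> \<eta> (of_rat q) = of_rat q"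
  using emb_poly[of \<eta> "[:q:]"] by (simp add: poly_of_rat_const)

lemma emb_0: "\<eta> \<in> conjugates \<xi> \<Longrightarrow> emb \<xi> \<eta> 0 = 0"
  and emb_1: "\<eta> \<in> conjugates \<xi> \<Longrightarrow> emb \<xi> \<eta> 1 = 1"
  and emb_of_nat: "\<eta> \<in> conjugates \<xi> \<Longrightarrow> emb \<xi> \<eta> (of_nat k) = of_nat k"
  and emb_of_int: "\<eta> \<in> conjugates \<xi> \<Longrightarrow> emb \<xi> \<eta> (of_int m) = of_int m"
  using emb_of_rat[of \<eta> 0] emb_of_rat[of \<eta> 1] emb_of_rat[of \<eta> "of_nat k"] emb_of_rat[of \<eta> "of_int m"]
  by simp_all

lemma emb_diff: "\<eta> \<in> conjugates \<xi> \<Longrightarrow> x \<in> qext \<xi> \<Longrightarrow> y \<in> qext \<xi> \<Longrightarrow>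
    emb \<xi> \<eta> (x - y) = emb \<xi> \<eta> x - emb \<xi> \<eta> y"
  using emb_add[of \<eta> "x - y" y] by (simp add: qext_diff)

lemma emb_sum: "\<eta> \<in> conjugates \<xi> \<Longrightarrow> (\<And>i. i \<in> I \<Longrightarrow> f i \<in> qext \<xi>) \<Longrightarrow>
    emb \<xi> \<eta> (\<Sum>i\<in>I. f i) = (\<Sum>i\<in>I. emb \<xi> \<eta> (f i))"
  by (induction I rule: infinite_finite_induct) (auto simp: emb_0 emb_add qext_sum)

lemma emb_prod: "\<eta> \<in> conjugates \<xi> \<Longrightarrow> (\<And>i. i \<in> I \<Longrightarrow> f i \<in> qext \<xi>) \<Longrightarrow>
    emb \<xi> \<eta> (\<Prod>i\<in>I. f i) = (\<Prod>i\<in>I. emb \<xi> \<eta> (f i))"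
  by (induction I rule: infinite_finite_induct) (auto simp: emb_1 emb_mult qext_prod)

lemma emb_power: "\<eta> \<in> conjugates \<xi> \<Longrightarrow> x \<in> qext \<xi> \<Longrightarrow> emb \<xi> \<eta> (x ^ n) = emb \<xi> \<eta> x ^ n"
  by (induction n) (auto simp: emb_1 emb_mult qext_power)

lemma emb_inverse:
  assumes \<eta>: "\<eta> \<in> conjugates \<xi>" and x: "x \<in> qext \<xi>"
  shows "emb \<xi> \<eta> (inverse x) = inverse (emb \<xi> \<eta> x)"
proof (cases "x = 0")
  case True
  thus ?thesis using emb_0[OF \<eta>] by simp
next
  case False
  hence "emb \<xi> \<eta> (inverse x) * emb \<xi> \<eta> x = 1"
    using emb_mult[OF \<eta> qext_inverse[OF \<xi> x] x] emb_1[OF \<eta>] by simp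
  thus ?thesis by (metis inverse_unique mult.commute)
qed

lemma emb_powi: "\<eta> \<in> conjugates \<xi> \<Longrightarrow> x \<in> qext \<xi> \<Longrightarrow> emb \<xi> \<eta> (x powi k) = emb \<xi> \<eta> x powi k"
  by (auto simp: power_int_def emb_power emb_inverse qext_inverse[OF \<xi>])

lemma emb_eq_0_iff:
  assumes \<eta>: "\<eta> \<in> conjugates \<xi>" and x: "x \<in> qext \<xi>"
  shows "emb \<xi> \<eta> x = 0 \<longleftrightarrow> x = 0"
proof
  assume "emb \<xi> \<eta> x = 0"
  hence "emb \<xi> \<eta> (x * inverse x) = 0"
    using emb_mult[OF \<eta> x qext_inverse[OF \<xi> x]] by simp
  thus "x = 0" using emb_1[OF \<eta>] by (cases "x = 0") auto
qed (simp add: emb_0[OF \<eta>])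

lemma poly_emb:
  assumes \<eta>: "\<eta> \<in> conjugates \<xi>" and x: "x \<in> qext \<xi>"
  shows "emb \<xi> \<eta> (poly (map_poly of_rat p) x) = poly (map_poly of_rat p) (emb \<xi> \<eta> x)"
  by (simp add: poly_altdef coeff_map_poly emb_sum[OF \<eta>] emb_mult[OF \<eta>] emb_power[OF \<eta>] x
      emb_of_rat[OF \<eta>] qext_mult qext_of_rat qext_power)

lemma emb_self: "x \<in> qext \<xi> \<Longrightarrow> emb \<xi> \<xi> x = x"
  by (erule qextE) (simp add: emb_poly self_in_conjugates[OF \<xi>])

lemma algebraic_int_emb:
  assumes \<eta>: "\<eta> \<in> conjugates \<xi>" and x: "x \<in> qext \<xi>" "algebraic_int x"
  shows "algebraic_int (emb \<xi> \<eta> x)"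
proof -
  obtain q :: "int poly" where q: "monic q" "poly (map_poly of_rat (map_poly of_int q)) x = 0"
    using algebraic_int_poly_of_rat[OF x(2)] by blast
  have "poly (map_poly of_rat (map_poly of_int q)) (emb \<xi> \<eta> x) = 0"
    unfolding poly_emb[OF \<eta> x(1), symmetric] q(2) by (rule emb_0[OF \<eta>])
  also have "map_poly of_rat (map_poly of_int q :: rat poly) = (map_poly of_int q :: complex poly)"
    by (intro poly_eqI) (simp add: coeff_map_poly)
  finally show ?thesis using q(1) unfolding algebraic_int_altdef_ipoly by blast
qed

lemma prod_emb_rational: "x \<in> qext \<xi> \<Longrightarrow> (\<Prod>\<eta>\<in>conjugates \<xi>. emb \<xi> \<eta> x) \<in> \<rat>"
proof (erule qextE)
  fix R assume x: "x = poly (map_poly of_rat R) \<xi>"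
  have "(\<Prod>\<eta>\<in>conjugates \<xi>. emb \<xi> \<eta> x) = (\<Prod>\<eta>\<in>conjugates \<xi>. poly (map_poly of_rat R) \<eta>)"
    unfolding x by (intro prod.cong emb_poly) auto
  thus "(\<Prod>\<eta>\<in>conjugates \<xi>. emb \<xi> \<eta> x) \<in> \<rat>" using prod_conjugates_rational[OF \<xi>] by simp
qed

text \<open>The product is the absolute value of the field norm, a nonzero rational integer. This is
  the product form of Liouville's inequality.\<close>

lemma prod_emb_ge_1:
  assumes x: "x \<in> qext \<xi>" "algebraic_int x" "x \<noteq> 0"
  shows "(\<Prod>\<eta>\<in>conjugates \<xi>. norm (emb \<xi> \<eta> x)) \<ge> 1"
proof -
  have "norm (\<Prod>\<eta>\<in>conjugates \<xi>. emb \<xi> \<eta> x) \<ge> 1"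
    using x finite_conjugates[OF \<xi>]
    by (intro norm_ge_1_if_rational_algebraic_int prod_emb_rational algebraic_int_prod algebraic_int_emb)
      (auto simp: emb_eq_0_iff)
  thus ?thesis by (simp add: prod_norm)
qed

end

text \<open>Divided differences lower the degree: subtract the value at a rational point and divide
  by the linear factor. Rationality of the quotient is lost at that one point, which is why a finite
  exceptional set \<open>B\<close> is carried along. The lemma turns rational norms into rational
  characteristic polynomials.\<close>

lemma rational_coeffs_if_rational_values:
  fixes p :: "complex poly"
  assumes "finite B" "\<And>x :: rat. x \<notin> B \<Longrightarrow> poly p (of_rat x) \<in> \<rat>"
  shows "coeff p i \<in> \<rat>"
  using assms
proof (induction "degree p" arbitrary: p B i rule: less_induct)
  case less
  show ?case
  proof (cases "degree p = 0")
    case True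
    then obtain c where c: "p = [:c:]" by (auto elim: degree_eq_zeroE)
    obtain x where "x \<notin> B" using ex_new_if_finite[OF infinite_UNIV_char_0 less.prems(1)] by blast
    thus ?thesis using less.prems(2)[of x] c by (auto simp: coeff_pCons split: nat.splits)
  next
    case False
    obtain x where x: "x \<notin> B" using ex_new_if_finite[OF infinite_UNIV_char_0 less.prems(1)] by blast
    let ?v = "poly p (of_rat x)"
    obtain q where q: "p - [:?v:] = [:- of_rat x, 1:] * q"
      using poly_eq_0_iff_dvd[of "p - [:?v:]" "of_rat x"] by (auto elim: dvdE)
    hence p: "p = [:?v:] + [:- of_rat x, 1:] * q" by (simp add: algebra_simps)
    have "q \<noteq> 0" using p False by (metis add.right_neutral degree_pCons_0 mult_zero_right)
    have "degree (p - [:?v:]) = Suc (degree q)"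
      unfolding q using \<open>q \<noteq> 0\<close> by (subst degree_mult_eq) auto
    moreover have "degree (p - [:?v:]) \<le> degree p" by (intro degree_diff_le) auto
    ultimately have deg: "degree q < degree p" by simp
    have IH: "coeff q j \<in> \<rat>" for j
    proof (rule less.hyps[OF deg, of "insert x B"])
      fix y assume y: "y \<notin> insert x B"
      have "poly p (of_rat y) = ?v + (of_rat y - of_rat x) * poly q (of_rat y)"
        by (subst p) (simp add: algebra_simps)
      hence "poly q (of_rat y) = (poly p (of_rat y) - ?v) / (of_rat y - of_rat x)"
        using y by (simp add: field_simps)
      thus "poly q (of_rat y) \<in> \<rat>" using less.prems(2) x y by auto
    qed (use less.prems(1) in auto)
    show ?thesis
      by (subst p) (use IH less.prems(2)[OF x] in \<open>auto simp: coeff_pCons split: nat.splits\<close>)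
  qed
qed

text \<open>The value at a rational \<open>x\<close> is the norm of \<open>x * w - u\<close>. The
  free leading coefficient \<open>w\<close> allows a quotient \<open>u / w\<close> to be treated by
  its numerator and denominator.\<close>

lemma coeff_prod_emb_rational:
  assumes \<xi>: "algebraic \<xi>" and uw: "u \<in> qext \<xi>" "w \<in> qext \<xi>"
  shows "coeff (\<Prod>\<eta>\<in>conjugates \<xi>. [:- emb \<xi> \<eta> u, emb \<xi> \<eta> w:]) i \<in> \<rat>"
proof (rule rational_coeffs_if_rational_values[of "{}"])
  fix x :: rat
  have "poly (\<Prod>\<eta>\<in>conjugates \<xi>. [:- emb \<xi> \<eta> u, emb \<xi> \<eta> w:]) (of_rat x)
          = (\<Prod>\<eta>\<in>conjugates \<xi>. emb \<xi> \<eta> (of_rat x * w - u))"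
    unfolding poly_prod
    by (intro prod.cong) (simp_all add: emb_diff[OF \<xi>] emb_mult[OF \<xi>] emb_of_rat[OF \<xi>]
        qext_mult qext_of_rat uw)
  also have "\<dots> \<in> \<rat>"
    by (intro prod_emb_rational[OF \<xi>] qext_diff qext_mult qext_of_rat uw)
  finally show "poly (\<Prod>\<eta>\<in>conjugates \<xi>. [:- emb \<xi> \<eta> u, emb \<xi> \<eta> w:]) (of_rat x) \<in> \<rat>" .
qed simp

text \<open>The characteristic polynomial of \<open>z\<close> over the embeddings is rational and
  vanishes at \<open>z\<close>, so the minimal polynomial divides it and every conjugate is an
  image. Conversely embeddings fix \<open>\<rat>\<close> and preserve roots of rational
  polynomials.\<close>

lemma
  assumes \<xi>: "algebraic \<xi>" and z: "z \<in> qext \<xi>"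
  shows algebraic_qext: "algebraic z"
    and conjugates_qext: "conjugates z = (\<lambda>\<eta>. emb \<xi> \<eta> z) ` conjugates \<xi>"
proof -
  define p where "p = (\<Prod>\<eta>\<in>conjugates \<xi>. [:- emb \<xi> \<eta> z, 1:])"
  have "coeff p i \<in> \<rat>" for i
  proof -
    have "p = (\<Prod>\<eta>\<in>conjugates \<xi>. [:- emb \<xi> \<eta> z, emb \<xi> \<eta> 1:])"
      unfolding p_def by (intro prod.cong) (auto simp: emb_1[OF \<xi>])
    thus ?thesis using coeff_prod_emb_rational[OF \<xi> z qext_1] by simp
  qed
  then obtain q where q: "p = map_poly of_rat q" using ratpolyE by blast
  have roots: "poly p x = 0 \<longleftrightarrow> (\<exists>\<eta>\<in>conjugates \<xi>. x = emb \<xi> \<eta> z)" for x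
    using finite_conjugates[OF \<xi>] by (auto simp: p_def poly_prod)
  have pz: "poly (map_poly of_rat q) z = 0"
    using roots[of z] self_in_conjugates[OF \<xi>] emb_self[OF \<xi> z] unfolding q by metis
  have "p \<noteq> 0" using finite_conjugates[OF \<xi>] by (auto simp: p_def)
  thus alg: "algebraic z"
    using pz q by (intro algebraicI'[of p]) (auto simp: coeff_map_poly)
  show "conjugates z = (\<lambda>\<eta>. emb \<xi> \<eta> z) ` conjugates \<xi>"
  proof (intro equalityI subsetI)
    fix w assume "w \<in> conjugates z"
    hence "poly (map_poly of_rat q) w = 0" by (rule conjugatesD[OF alg _ pz])
    thus "w \<in> (\<lambda>\<eta>. emb \<xi> \<eta> z) ` conjugates \<xi>" using roots[of w] unfolding q by auto
  next
    fix w assume "w \<in> (\<lambda>\<eta>. emb \<xi> \<eta> z) ` conjugates \<xi>"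
    then obtain \<eta> where \<eta>: "\<eta> \<in> conjugates \<xi>" "w = emb \<xi> \<eta> z" by auto
    have "poly (map_poly of_rat (min_poly z)) w = 0"
      unfolding \<eta>(2) poly_emb[OF \<xi> \<eta>(1) z, symmetric] poly_min_poly[OF alg] by (rule emb_0[OF \<xi> \<eta>(1)])
    thus "w \<in> conjugates z" by (simp add: conjugates_def)
  qed
qed

section \<open>Primitive elements\<close>

text \<open>Polynomial division over a ring that is given as a set of complex numbers: cancelling
  leading terms against a monic divisor never leaves \<open>S\<close>.\<close>

lemma monic_division_in_subring:
  fixes h p :: "complex poly"
  assumes ring: "0 \<in> S" "\<And>x y. x \<in> S \<Longrightarrow> y \<in> S \<Longrightarrow> x + y \<in> S" "\<And>x y. x \<in> S \<Longrightarrow> y \<in> S \<Longrightarrow> x - y \<in> S"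
    "\<And>x y. x \<in> S \<Longrightarrow> y \<in> S \<Longrightarrow> x * y \<in> S"
    and h: "lead_coeff h = 1" "\<And>i. coeff h i \<in> S"
    and p: "\<And>i. coeff p i \<in> S"
  shows "\<exists>q. (\<forall>i. coeff (p - q * h) i \<in> S) \<and> (p - q * h = 0 \<or> degree (p - q * h) < degree h)"
  using p
proof (induction "degree p" arbitrary: p rule: less_induct)
  case less
  show ?case
  proof (cases "p = 0 \<or> degree p < degree h")
    case True
    thus ?thesis using less.prems by (intro exI[of _ 0]) auto
  next
    case False
    define m where "m = monom (lead_coeff p) (degree p - degree h)"
    define p' where "p' = p - m * h"
    have mS: "coeff m i \<in> S" for i using less.prems ring(1) by (simp add: m_def)
    have mhS: "coeff (m * h) i \<in> S" for i
      unfolding m_def coeff_monom_mult using less.prems h ring by simp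
    have p'S: "coeff p' i \<in> S" for i unfolding p'_def using less.prems mhS ring(3) by simp
    have h0: "h \<noteq> 0" using h(1) by auto
    have m0: "m \<noteq> 0" using False by (simp add: m_def)
    have "degree (m * h) = degree p"
      using False h0 m0 by (simp add: degree_mult_eq m_def degree_monom_eq)
    hence "degree p' \<le> degree p" unfolding p'_def by (intro degree_diff_le) auto
    moreover have "coeff p' (degree p) = 0"
      unfolding p'_def m_def using False h(1) by (simp add: coeff_monom_mult)
    ultimately have "p' = 0 \<or> degree p' < degree p" by (metis eq_zero_or_degree_less)
    thus ?thesis
    proof
      assume "p' = 0"
      thus ?thesis using ring(1) by (intro exI[of _ m]) (auto simp: p'_def)
    next
      assume "degree p' < degree p"
      then obtain q where q: "\<forall>i. coeff (p' - q * h) i \<in> S"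
        "p' - q * h = 0 \<or> degree (p' - q * h) < degree h"
        using less.hyps[of p'] p'S by blast
      have "p - (q + m) * h = p' - q * h" by (simp add: p'_def algebra_simps)
      thus ?thesis using q by (intro exI[of _ "q + m"]) simp
    qed
  qed
qed

lemma rsquarefree_dvd:
  fixes p q :: "complex poly"
  assumes "rsquarefree p" "q dvd p"
  shows "rsquarefree q"
  using assms by (auto simp: rsquarefree_roots pderiv_mult elim!: dvdE)

text \<open>The monic polynomial of least degree over \<open>S\<close> that vanishes at
  \<open>y\<close> divides both \<open>f\<close> and \<open>g\<close>. Its only root is then
  \<open>y\<close>, and being squarefree it is linear, so its constant coefficient exhibits
  \<open>y\<close> in \<open>S\<close>.\<close>

lemma linear_if_unique_common_root:
  fixes f g :: "complex poly"
  assumes S: "is_subfield S"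
    and f: "\<And>i. coeff f i \<in> S" "rsquarefree f" "poly f y = 0"
    and g: "\<And>i. coeff g i \<in> S" "poly g y = 0"
    and uniq: "\<And>w. poly f w = 0 \<Longrightarrow> poly g w = 0 \<Longrightarrow> w = y"
  shows "y \<in> S"
proof -
  have ring: "0 \<in> S" "\<And>x y. x \<in> S \<Longrightarrow> y \<in> S \<Longrightarrow> x + y \<in> S" "\<And>x y. x \<in> S \<Longrightarrow> y \<in> S \<Longrightarrow> x * y \<in> S"
    "\<And>x. x \<in> S \<Longrightarrow> - x \<in> S" "\<And>x. x \<in> S \<Longrightarrow> inverse x \<in> S"
    using S unfolding is_subfield_def by auto
  have diff: "x - y \<in> S" if "x \<in> S" "y \<in> S" for x y
    using ring(2)[OF that(1) ring(4)[OF that(2)]] by simp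
  have f0: "f \<noteq> 0" using f(2) by (auto simp: rsquarefree_def)
  define Q where "Q = (\<lambda>h :: complex poly. h \<noteq> 0 \<and> (\<forall>i. coeff h i \<in> S) \<and> poly h y = 0)"
  have "Q f" using f f0 by (auto simp: Q_def)
  then obtain h0 where h0: "Q h0" "\<And>h. Q h \<Longrightarrow> degree h0 \<le> degree h"
    using ex_has_least_nat[of Q f degree] by blast
  define h where "h = smult (inverse (lead_coeff h0)) h0"
  have h: "lead_coeff h = 1" "\<And>i. coeff h i \<in> S" "poly h y = 0" "degree h = degree h0" "h \<noteq> 0"
    using h0(1) by (auto simp: h_def Q_def intro!: ring)
  have dvd: "h dvd p" if p: "\<And>i. coeff p i \<in> S" "poly p y = 0" for p
  proof -
    obtain q where q: "\<forall>i. coeff (p - q * h) i \<in> S" "p - q * h = 0 \<or> degree (p - q * h) < degree h"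
      using monic_division_in_subring[of S h p] ring(1,2,3) diff h(1,2) p(1) by blast
    have "p - q * h = 0"
    proof (rule ccontr)
      assume nz: "p - q * h \<noteq> 0"
      hence "Q (p - q * h)" using q(1) p(2) h(3) by (simp add: Q_def)
      hence "degree h \<le> degree (p - q * h)" using h0(2) h(4) by simp
      thus False using nz q(2) by simp
    qed
    thus ?thesis by (metis dvd_triv_right eq_iff_diff_eq_0)
  qed
  have "h dvd f" "h dvd g" using dvd f g by auto
  hence "{w. poly h w = 0} = {y}" using uniq h(3) by (auto elim!: dvdE)
  moreover have "rsquarefree h" using f(2) \<open>h dvd f\<close> by (rule rsquarefree_dvd)
  ultimately have deg: "degree h = 1" using h(5) by (simp add: rsquarefree_card_degree)
  have "h = [:coeff h 0, 1:]"
    by (rule poly_eqI) (use deg h(1) in \<open>auto simp: coeff_pCons coeff_eq_0 split: nat.splits\<close>)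
  hence "poly h y = coeff h 0 + y" by (metis poly_pCons poly_0 mult_1_right mult_zero_right add_0_right)
  hence "y = - coeff h 0" using h(3) by (simp add: eq_neg_iff_add_eq_0 add.commute)
  thus ?thesis using ring(4) h(2) by simp
qed

text \<open>The minimal polynomial of \<open>y\<close> and the polynomial
  \<open>f(\<xi> - k X)\<close> over \<open>\<rat>(\<xi>)\<close> both vanish at \<open>y\<close>; a
  generic \<open>k\<close> makes this their only common root.\<close>

theorem primitive_element:
  assumes x: "algebraic x" and y: "algebraic y"
  obtains k :: nat where "algebraic (x + of_nat k * y)"
    "x \<in> qext (x + of_nat k * y)" "y \<in> qext (x + of_nat k * y)"
    "deg_over_rat (x + of_nat k * y) \<le> deg_over_rat x * deg_over_rat y"
proof -
  \<comment> \<open>The values of \<open>k\<close> for which another conjugate of \<open>y\<close>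
    would be a second common root. Pairs with \<open>y' = y\<close> contribute only 0 because
    division by zero is zero, so they merely exclude \<open>k = 0\<close>.\<close>
  define B where "B = (\<lambda>(x', y'). (x' - x) / (y - y')) ` (conjugates x \<times> conjugates y)"
  have "finite B" using finite_conjugates x y by (auto simp: B_def)
  hence "finite {k :: nat. (of_nat k :: complex) \<in> B}"
    by (rule finite_vimageI[of B "of_nat :: nat \<Rightarrow> complex", unfolded vimage_def]) (simp add: inj_on_def)
  then obtain k :: nat where k: "(of_nat k :: complex) \<notin> B"
    using ex_new_if_finite[OF infinite_UNIV_nat] by blast
  define \<xi> where "\<xi> = x + of_nat k * y"
  define f where "f = min_poly x"
  \<comment> \<open>A rational polynomial of degree \<open>deg_over_rat x * deg_over_rat y\<close>
    vanishing at \<open>\<xi>\<close>: its value at a rational \<open>q\<close> is the norm of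
    \<open>f(q - k y)\<close>. It supplies the degree bound without a tower law.\<close>
  define p where "p = (\<Prod>y'\<in>conjugates y. (map_poly of_rat f :: complex poly) \<circ>\<^sub>p [:- of_nat k * y', 1:])"
  have "coeff p i \<in> \<rat>" for i
  proof (rule rational_coeffs_if_rational_values[of "{}"])
    fix q :: rat
    have "poly p (of_rat q) = (\<Prod>y'\<in>conjugates y. poly (map_poly of_rat (f \<circ>\<^sub>p [:q, - of_nat k:])) y')"
      unfolding p_def poly_prod of_rat_hom.map_poly_pcompose
      by (intro prod.cong) (simp_all add: poly_pcompose of_rat_hom.map_poly_pCons_hom algebra_simps of_rat_minus)
    thus "poly p (of_rat q) \<in> \<rat>" using prod_conjugates_rational[OF y] by simp
  qed simp
  then obtain q where q: "p = map_poly of_rat q" using ratpolyE by blast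
  have f0: "map_poly of_rat f \<noteq> (0 :: complex poly)" using min_poly_nonzero[OF x] by (simp add: f_def)
  have p0: "p \<noteq> 0"
    unfolding p_def using f0 finite_conjugates[OF y] by (auto simp: pcompose_eq_0_iff)
  have "degree p = (\<Sum>y'\<in>conjugates y. degree f)"
    unfolding p_def using f0 by (subst degree_prod_eq_sum_degree) (auto simp: pcompose_eq_0_iff degree_pcompose)
  hence degp: "degree p = deg_over_rat x * deg_over_rat y"
    using card_conjugates[OF y] by (simp add: f_def deg_over_rat_def)
  have "poly ((map_poly of_rat f :: complex poly) \<circ>\<^sub>p [:- of_nat k * y, 1:]) \<xi> = 0"
    using poly_min_poly[OF x] by (simp add: poly_pcompose \<xi>_def f_def)
  hence p\<xi>: "poly p \<xi> = 0"
    unfolding p_def poly_prod using finite_conjugates[OF y] self_in_conjugates[OF y] by (intro prod_zero) auto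
  have \<xi>: "algebraic \<xi>"
    using p0 p\<xi> q by (intro algebraicI'[of p]) (auto simp: coeff_map_poly)
  have "min_poly \<xi> dvd q" using p\<xi> min_poly_dvd_iff[OF \<xi>] q by simp
  moreover have "q \<noteq> 0" using p0 q by auto
  ultimately have "degree (min_poly \<xi>) \<le> degree q" by (intro dvd_imp_degree_le)
  hence deg: "deg_over_rat \<xi> \<le> deg_over_rat x * deg_over_rat y"
    using degp q by (simp add: deg_over_rat_def)
  have yq: "y \<in> qext \<xi>"
  proof (rule linear_if_unique_common_root[OF is_subfield_qext[OF \<xi>],
      of "map_poly of_rat (min_poly y)" y "map_poly of_rat f \<circ>\<^sub>p [:\<xi>, - of_nat k:]"])
    show "coeff (map_poly of_rat (min_poly y)) i \<in> qext \<xi>" for i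
      by (simp add: coeff_map_poly qext_of_rat)
    show "rsquarefree (map_poly of_rat (min_poly y) :: complex poly)" by (rule rsquarefree_min_poly[OF y])
    show "poly (map_poly of_rat (min_poly y)) y = 0" by (rule poly_min_poly[OF y])
    show "poly (map_poly of_rat f \<circ>\<^sub>p [:\<xi>, - of_nat k:]) y = 0"
      using poly_min_poly[OF x] by (simp add: poly_pcompose \<xi>_def f_def algebra_simps)
    show "coeff (map_poly of_rat f \<circ>\<^sub>p [:\<xi>, - of_nat k:]) i \<in> qext \<xi>" for i
    proof (induction f arbitrary: i)
      case (pCons a f)
      have "coeff ([:\<xi>, - of_nat k:] * (map_poly of_rat f \<circ>\<^sub>p [:\<xi>, - of_nat k:])) i \<in> qext \<xi>" for i
        unfolding coeff_mult using pCons.IH qext_self qext_minus[OF qext_of_nat]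
        by (intro qext_sum qext_mult) (auto simp: coeff_pCons qext_0 split: nat.splits)
      moreover have "coeff [:of_rat a:] i \<in> qext \<xi>"
        by (auto simp: coeff_pCons qext_of_rat qext_0 split: nat.splits)
      ultimately show ?case
        unfolding of_rat_hom.map_poly_pCons_hom pcompose_pCons coeff_add by (intro qext_add)
    qed (simp add: qext_0)
    fix w assume w: "poly (map_poly of_rat (min_poly y)) w = 0"
      "poly (map_poly of_rat f \<circ>\<^sub>p [:\<xi>, - of_nat k:]) w = 0"
    define x' where "x' = \<xi> - of_nat k * w"
    have x': "x' \<in> conjugates x"
      using w(2) by (simp add: poly_pcompose x'_def conjugates_def f_def algebra_simps)
    show "w = y"
    proof (rule ccontr)
      assume "w \<noteq> y"
      hence "of_nat k = (x' - x) / (y - w)" by (simp add: x'_def \<xi>_def field_simps)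
      moreover have "w \<in> conjugates y" using w(1) by (simp add: conjugates_def)
      ultimately have "of_nat k \<in> B" unfolding B_def using x' by force
      thus False using k by simp
    qed
  qed
  have "\<xi> - of_nat k * y \<in> qext \<xi>" by (intro qext_diff qext_self qext_mult qext_of_nat yq)
  hence "x \<in> qext \<xi>" by (simp add: \<xi>_def)
  thus ?thesis using that[of k] \<xi> yq deg unfolding \<xi>_def by blast
qed

section \<open>Subfields generated by finitely many algebraic numbers\<close>

lemma is_subfieldD:
  assumes "is_subfield K"
  shows "0 \<in> K" "1 \<in> K" "x \<in> K \<Longrightarrow> y \<in> K \<Longrightarrow> x + y \<in> K" "x \<in> K \<Longrightarrow> y \<in> K \<Longrightarrow> x * y \<in> K"
    "x \<in> K \<Longrightarrow> - x \<in> K" "x \<in> K \<Longrightarrow> inverse x \<in> K"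
  using assms by (auto simp: is_subfield_def)

lemma is_subfield_of_nat: "is_subfield K \<Longrightarrow> of_nat k \<in> K"
  by (induction k) (auto intro: is_subfieldD)

lemma is_subfield_of_rat:
  assumes K: "is_subfield K"
  shows "of_rat q \<in> K"
proof -
  have int: "of_int m \<in> K" for m
  proof (cases m)
    case (nonneg n)
    thus ?thesis using is_subfield_of_nat[OF K] by simp
  next
    case (neg n)
    have "- of_nat (Suc n) \<in> K" by (rule is_subfieldD(5)[OF K is_subfield_of_nat[OF K]])
    thus ?thesis unfolding neg by simp
  qed
  obtain a b where ab: "quotient_of q = (a, b)" by (cases "quotient_of q")
  have "q = of_int a / of_int b" by (rule quotient_of_div[OF ab])
  hence "(of_rat q :: complex) = of_int a * inverse (of_int b)" by (simp add: of_rat_divide field_simps)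
  thus ?thesis using is_subfieldD(4)[OF K int is_subfieldD(6)[OF K int]] by simp
qed

lemma qext_subset_subfield:
  assumes K: "is_subfield K" and z: "z \<in> K"
  shows "qext z \<subseteq> K"
proof
  fix w assume "w \<in> qext z"
  then obtain R where w: "w = poly (map_poly of_rat R) z" by (rule qextE)
  show "w \<in> K" unfolding w
    by (induction R) (auto simp: of_rat_hom.map_poly_pCons_hom intro!: is_subfieldD[OF K] is_subfield_of_rat[OF K] z)
qed

text \<open>The last property, membership of \<open>\<theta>\<close> in every subfield containing
  \<open>A\<close>, is what later identifies \<open>qext \<theta>\<close> with the intersection
  defining \<open>rat_adjoin A\<close>.\<close>

lemma primitive_element_finite:
  assumes "finite A" "\<And>a. a \<in> A \<Longrightarrow> algebraic a"
  obtains \<theta> where "algebraic \<theta>" "A \<subseteq> qext \<theta>" "\<And>K. is_subfield K \<Longrightarrow> A \<subseteq> K \<Longrightarrow> \<theta> \<in> K"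
  using assms
proof (induction A arbitrary: thesis rule: finite_induct)
  case empty
  show ?case by (rule empty(1)[of 0]) (auto intro: is_subfieldD)
next
  case (insert a A)
  obtain \<theta> where \<theta>: "algebraic \<theta>" "A \<subseteq> qext \<theta>" "\<And>K. is_subfield K \<Longrightarrow> A \<subseteq> K \<Longrightarrow> \<theta> \<in> K"
    using insert.IH insert.prems(2) by blast
  obtain k :: nat where k: "algebraic (a + of_nat k * \<theta>)" "a \<in> qext (a + of_nat k * \<theta>)"
    "\<theta> \<in> qext (a + of_nat k * \<theta>)"
    using primitive_element[of a \<theta>] insert.prems(2) \<theta>(1) by blast
  show ?case
  proof (rule insert.prems(1)[OF k(1)])
    show "insert a A \<subseteq> qext (a + of_nat k * \<theta>)" using \<theta>(2) k(2,3) qext_trans by blast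
    show "a + of_nat k * \<theta> \<in> K" if "is_subfield K" "insert a A \<subseteq> K" for K
      using that \<theta>(3)[of K] by (auto intro!: is_subfieldD is_subfield_of_nat)
  qed
qed

lemma rat_adjoin_primitive_element:
  assumes "finite A" "\<And>a. a \<in> A \<Longrightarrow> algebraic a"
  obtains \<theta> where "algebraic \<theta>" "A \<subseteq> qext \<theta>" "rat_adjoin A = qext \<theta>"
proof -
  obtain \<theta> where \<theta>: "algebraic \<theta>" "A \<subseteq> qext \<theta>" "\<And>K. is_subfield K \<Longrightarrow> A \<subseteq> K \<Longrightarrow> \<theta> \<in> K"
    using primitive_element_finite[of A] assms by blast
  have "rat_adjoin A = qext \<theta>"
    unfolding rat_adjoin_def using \<theta> is_subfield_qext qext_subset_subfield by blast
  thus ?thesis using that \<theta> by blast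
qed

text \<open>The powers of \<open>\<theta>\<close> below its degree form a basis: independent by
  minimality, spanning by division with remainder. The number of embeddings in Liouville's
  inequality is thereby at most \<open>d\<close>.\<close>

lemma deg_over_rat_le_ext_degree:
  assumes "algebraic \<theta>"
  shows "deg_over_rat \<theta> \<le> ext_degree (qext \<theta>)"
proof -
  define n where "n = deg_over_rat \<theta>"
  define B where "B = (\<lambda>i. \<theta> ^ i) ` {..<n}"
  have small: "poly (map_poly of_rat R) \<theta> \<noteq> 0" if "R \<noteq> 0" "degree R < n" for R
    using that min_poly_dvd_iff[OF assms, of R] dvd_imp_degree_le[of "min_poly \<theta>" R]
    by (auto simp: n_def deg_over_rat_def)
  have inj: "inj_on (\<lambda>i. \<theta> ^ i) {..<n}"
  proof (rule inj_onI, rule ccontr)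
    fix i j assume ij: "i \<in> {..<n}" "j \<in> {..<n}" "\<theta> ^ i = \<theta> ^ j" "i \<noteq> j"
    define R :: "rat poly" where "R = monom 1 i - monom 1 j"
    have "coeff R i = 1" using ij by (simp add: R_def)
    hence "R \<noteq> 0" by auto
    moreover have "degree R < n" using ij unfolding R_def
      by (intro degree_diff_less) (auto simp: degree_monom_eq)
    moreover have "poly (map_poly of_rat R) \<theta> = 0"
      using poly_of_rat_add[of R "monom 1 j" \<theta>] ij
      by (simp add: R_def of_rat_hom.map_poly_hom_monom poly_monom)
    ultimately show False using small by blast
  qed
  have indep: "rat_vs.independent B"
  proof (rule rat_vs.independent_if_scalars_zero)
    show "finite B" by (simp add: B_def)
    fix u x assume u: "(\<Sum>x\<in>B. of_rat (u x) * x) = 0" and x: "x \<in> B"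
    define R where "R = (\<Sum>i<n. monom (u (\<theta> ^ i)) i)"
    have c: "coeff R i = (if i < n then u (\<theta> ^ i) else 0)" for i
      by (simp add: R_def coeff_sum)
    have "0 = (\<Sum>i<n. of_rat (u (\<theta> ^ i)) * \<theta> ^ i)"
      using u inj by (simp add: B_def sum.reindex)
    also have "\<dots> = poly (map_poly of_rat R) \<theta>"
    proof -
      have "poly (map_poly of_rat R) \<theta> = (\<Sum>i\<le>degree R. of_rat (coeff R i) * \<theta> ^ i)"
        by (simp add: poly_altdef coeff_map_poly)
      also have "\<dots> = (\<Sum>i<n. of_rat (u (\<theta> ^ i)) * \<theta> ^ i)"
        by (rule sum.mono_neutral_cong) (auto simp: c coeff_eq_0 not_le, metis c coeff_eq_0 not_le)
      finally show ?thesis by simp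
    qed
    finally have ev: "poly (map_poly of_rat R) \<theta> = 0" by simp
    have "R = 0"
    proof (rule ccontr)
      assume nz: "R \<noteq> 0"
      have "coeff R (degree R) \<noteq> 0" using nz by simp
      hence "degree R < n" using c[of "degree R"] by presburger
      thus False using small[OF nz] ev by simp
    qed
    then obtain i where "i < n" "x = \<theta> ^ i" using x by (auto simp: B_def)
    thus "u x = 0" using c[of i] \<open>R = 0\<close> by simp
  qed
  have sub: "B \<subseteq> qext \<theta>" by (auto simp: B_def intro: qext_power qext_self)
  have span: "qext \<theta> \<subseteq> rat_vs.span B"
  proof
    fix w assume "w \<in> qext \<theta>"
    then obtain R where w: "w = poly (map_poly of_rat R) \<theta>" by (rule qextE)
    define f where "f = min_poly \<theta>"
    have f0: "f \<noteq> 0" using min_poly_nonzero[OF assms] by (simp add: f_def)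
    have n0: "n \<noteq> 0"
      using irreducible_min_poly[OF assms] f0 unfolding n_def deg_over_rat_def f_def
      by (metis irreducible_not_unit is_unit_iff_degree)
    have deg: "degree (R mod f) < n"
      using degree_mod_less[OF f0, of R] n0 by (auto simp: n_def deg_over_rat_def f_def)
    have "w = poly (map_poly of_rat (R div f * f + R mod f)) \<theta>" using w by simp
    also have "\<dots> = poly (map_poly of_rat (R mod f)) \<theta>"
      unfolding poly_of_rat_add poly_of_rat_mult using poly_min_poly[OF assms] by (simp add: f_def)
    also have "\<dots> = (\<Sum>i\<le>degree (R mod f). of_rat (coeff (R mod f) i) * \<theta> ^ i)"
      by (simp add: poly_altdef coeff_map_poly)
    also have "\<dots> \<in> rat_vs.span B"
      using deg by (intro rat_vs.span_sum rat_vs.span_scale rat_vs.span_base) (auto simp: B_def)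
    finally show "w \<in> rat_vs.span B" .
  qed
  have "ext_degree (qext \<theta>) = card B"
    unfolding ext_degree_def by (rule rat_vs.dim_unique[OF sub span indep]) simp
  also have "\<dots> = n" using inj by (simp add: B_def card_image)
  finally show ?thesis by (simp add: n_def)
qed

section \<open>Mahler measures of roots\<close>

lemma content_eq_1_if_coeffs:
  fixes f g :: "int poly"
  assumes "content f = 1" "\<And>c. (\<And>i. c dvd coeff g i) \<Longrightarrow> (\<And>i. c dvd coeff f i)"
  shows "content g = 1"
proof -
  have "content g dvd coeff f i" for i using assms(2)[of "content g"] content_dvd_coeff by blast
  hence "[:content g:] dvd f" by (simp add: const_poly_dvd_iff)
  hence "content g dvd 1" using assms(1) by (simp add: const_poly_dvd_iff_dvd_content)
  thus ?thesis using is_unit_content_iff by blast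
qed

text \<open>The product \<open>f(x) f(-x)\<close> is primitive by Gauss' lemma and even in
  \<open>x\<close>. Read as a polynomial in \<open>x^2\<close> it has the squared roots, and its
  content is unchanged because only zero coefficients were dropped.\<close>

lemma graeffe_primitive:
  fixes f :: "int poly" and b :: "'b \<Rightarrow> complex"
  assumes cf: "content f = 1" and f: "map_poly of_int f = smult c (\<Prod>i\<in>I. [:- b i, 1:])"
  obtains g :: "int poly" where "content g = 1"
    "map_poly of_int g = smult ((-1) ^ card I * c ^ 2) (\<Prod>i\<in>I. [:- (b i ^ 2), 1:])"
proof -
  define f' where "f' = f \<circ>\<^sub>p [:0, -1:]"
  define h where "h = f * f'"
  have coeff_f': "coeff f' i = (-1) ^ i * coeff f i" for i by (simp add: f'_def coeff_pcompose_linear)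
  have "content f' = 1"
  proof (rule content_eq_1_if_coeffs[OF cf])
    fix c i assume "\<And>i. c dvd coeff f' i"
    hence "c dvd (-1) ^ i * coeff f' i" by (rule dvd_mult)
    thus "c dvd coeff f i" by (simp add: coeff_f' flip: mult.assoc power_add)
  qed
  hence ch: "content h = 1" using cf by (simp add: h_def content_mult)
  have "h \<circ>\<^sub>p [:0, -1:] = h"
  proof -
    have "f' \<circ>\<^sub>p [:0, -1:] = f"
      by (rule poly_eqI) (simp add: coeff_pcompose_linear coeff_f' flip: mult.assoc power_add)
    thus ?thesis by (simp add: h_def pcompose_mult f'_def[symmetric])
  qed
  hence "(-1) ^ i * coeff h i = coeff h i" for i by (metis coeff_pcompose_linear)
  hence odd0: "coeff h i = 0" if "odd i" for i using that by (metis mult_minus1 power_minus_odd power_one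
        add.inverse_unique add_cancel_right_right equal_neg_zero)
  define g where "g = (\<Sum>i\<le>degree h. monom (coeff h (2 * i)) i)"
  have cg: "coeff g i = coeff h (2 * i)" for i
    by (auto simp: g_def coeff_sum coeff_eq_0)
  have "content g = 1"
  proof (rule content_eq_1_if_coeffs[OF ch])
    fix c i assume *: "\<And>i. c dvd coeff g i"
    show "c dvd coeff h i"
      using *[of "i div 2"] odd0[of i] by (cases "even i") (auto simp: cg)
  qed
  moreover have "map_poly of_int g = smult ((-1) ^ card I * c ^ 2) (\<Prod>i\<in>I. [:- (b i ^ 2), 1:])"
  proof (rule poly_eq_poly_eq_iff[THEN iffD1], rule ext)
    fix y :: complex
    define x where "x = csqrt y"
    have y: "y = x ^ 2" by (simp add: x_def)
    define N where "N = degree h"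
    have "poly (map_poly of_int h) x = (\<Sum>j\<le>degree h. of_int (coeff h j) * x ^ j)"
      by (simp add: poly_altdef)
    also have "\<dots> = (\<Sum>j\<le>Suc (2 * N). of_int (coeff h j) * x ^ j)"
      by (rule sum.mono_neutral_left) (auto simp: N_def coeff_eq_0)
    also have "\<dots> = (\<Sum>i\<le>N. of_int (coeff g i) * y ^ i)"
      unfolding sum.in_pairs_0 by (intro sum.cong) (auto simp: cg odd0 y power_mult)
    also have "\<dots> = (\<Sum>i\<le>degree g. of_int (coeff g i) * y ^ i)"
      by (rule sum.mono_neutral_right) (auto simp: coeff_eq_0 N_def g_def intro!: degree_sum_le degree_monom_le[THEN order_trans])
    also have "\<dots> = poly (map_poly of_int g) y" by (simp add: poly_altdef)
    finally have "poly (map_poly of_int g) y = poly (map_poly of_int f) x * poly (map_poly of_int f) (- x)"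
      by (simp add: h_def f'_def of_int_poly_hom.hom_mult of_int_hom.map_poly_pcompose poly_pcompose)
    also have "\<dots> = c ^ 2 * (\<Prod>i\<in>I. (x - b i) * (- x - b i))"
      unfolding f prod.distrib by (simp add: poly_prod power2_eq_square mult_ac minus_diff_commute)
    also have "(\<Prod>i\<in>I. (x - b i) * (- x - b i)) = (\<Prod>i\<in>I. - 1 * (y - b i ^ 2))"
      by (intro prod.cong) (auto simp: y power2_eq_square algebra_simps)
    also have "\<dots> = (-1) ^ card I * (\<Prod>i\<in>I. y - b i ^ 2)"
      unfolding prod.distrib prod_constant by simp
    finally show "poly (map_poly of_int g) y
        = poly (smult ((-1) ^ card I * c ^ 2) (\<Prod>i\<in>I. [:- (b i ^ 2), 1:])) y"
      by (simp add: poly_prod mult_ac)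
  qed
  ultimately show ?thesis using that by blast
qed

lemma graeffe_primitive_iterate:
  fixes f :: "int poly" and b :: "'b \<Rightarrow> complex"
  assumes "content f = 1" "map_poly of_int f = smult c (\<Prod>i\<in>I. [:- b i, 1:])"
  shows "\<exists>g c'. content g = 1 \<and> norm c' = norm c ^ (2 ^ s) \<and>
    map_poly of_int (g :: int poly) = smult c' (\<Prod>i\<in>I. [:- (b i ^ (2 ^ s)), 1:])"
proof (induction s)
  case 0
  show ?case using assms by (intro exI[of _ f] exI[of _ c]) simp
next
  case (Suc s)
  then obtain g c' where g: "content g = 1" "norm c' = norm c ^ (2 ^ s)"
    "map_poly of_int (g :: int poly) = smult c' (\<Prod>i\<in>I. [:- (b i ^ (2 ^ s)), 1:])" by blast
  obtain g' :: "int poly" where "content g' = 1"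
    "map_poly of_int g' = smult ((-1) ^ card I * c' ^ 2) (\<Prod>i\<in>I. [:- ((b i ^ (2 ^ s)) ^ 2), 1:])"
    using graeffe_primitive[OF g(1,3)] by blast
  moreover have "norm ((-1) ^ card I * c' ^ 2) = norm c ^ (2 ^ Suc s)"
    by (simp add: norm_mult norm_power g(2) mult.commute flip: power_mult)
  ultimately show ?case
    by (intro exI[of _ g'] exI[of _ "(-1) ^ card I * c' ^ 2"]) (simp add: mult.commute flip: power_mult)
qed

section \<open>Primitive integer multiples of rational polynomials\<close>

lemma rat_poly_common_denominator:
  fixes q :: "rat poly"
  shows "\<exists>d p. d \<noteq> (0::int) \<and> map_poly of_int p = smult (of_int d) q"
proof (induction q)
  case 0
  show ?case by (rule exI[of _ 1], rule exI[of _ 0]) simp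
next
  case (pCons a q)
  obtain d p where dp: "d \<noteq> 0" "map_poly of_int p = smult (of_int d) q" using pCons.IH by blast
  obtain m n where mn: "quotient_of a = (m, n)" by (cases "quotient_of a")
  have "n > 0" by (rule quotient_of_denom_pos[OF mn])
  moreover have "a = of_int m / of_int n" by (rule quotient_of_div[OF mn])
  ultimately have "map_poly of_int (pCons (d * m) (smult n p)) = smult (of_int (d * n)) (pCons a q)"
    using dp(2) by (simp add: of_int_hom.map_poly_pCons_hom of_int_hom.map_poly_hom_smult mult.commute)
  thus ?case using dp(1) \<open>n > 0\<close>
    by (intro exI[of _ "d * n"] exI[of _ "pCons (d * m) (smult n p)"]) auto
qed

lemma primitive_multiple_of_rational_poly:
  fixes p :: "complex poly"
  assumes "\<And>i. coeff p i \<in> \<rat>" "p \<noteq> 0"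
  obtains f :: "int poly" and c where "content f = 1" "map_poly of_int f = smult c p"
proof -
  obtain q where q: "p = map_poly of_rat q" using assms(1) ratpolyE by blast
  obtain d h where dh: "d \<noteq> (0::int)" "map_poly of_int h = smult (of_int d) q"
    using rat_poly_common_denominator by blast
  have "q \<noteq> 0" using assms(2) q by auto
  have "h \<noteq> 0"
  proof
    assume "h = 0"
    hence "smult (of_int d) q = 0" using dh(2) by simp
    thus False using dh(1) \<open>q \<noteq> 0\<close> by simp
  qed
  have "map_poly of_int h = (map_poly of_rat (map_poly of_int h) :: complex poly)"
    by (intro poly_eqI) (simp add: coeff_map_poly)
  also have "\<dots> = smult (of_int d) p"
    unfolding dh(2) q by (intro poly_eqI) (simp add: coeff_map_poly of_rat_mult)
  finally have h: "map_poly of_int h = smult (of_int d) p" .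
  define f where "f = primitive_part h"
  have "map_poly of_int h = smult (of_int (content h)) (map_poly of_int f :: complex poly)"
    unfolding f_def of_int_hom.map_poly_hom_smult[symmetric] by simp
  hence "smult (of_int (content h)) (map_poly of_int f :: complex poly) = smult (of_int d) p" using h by simp
  hence "smult (inverse (of_int (content h))) (smult (of_int (content h)) (map_poly of_int f :: complex poly))
           = smult (inverse (of_int (content h)) * of_int d) p" by simp
  moreover have "content h \<noteq> 0" using \<open>h \<noteq> 0\<close> by simp
  ultimately have "map_poly of_int f = smult (inverse (of_int (content h)) * of_int d) p" by simp
  moreover have "content f = 1" using \<open>h \<noteq> 0\<close> by (simp add: f_def)
  ultimately show ?thesis using that by blast
qed

lemma coeff_prod_linear_card:
  fixes a b :: "'b \<Rightarrow> complex"
  assumes "finite I"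
  shows "coeff (\<Prod>i\<in>I. [:a i, b i:]) (card I) = (\<Prod>i\<in>I. b i)"
    and "degree (\<Prod>i\<in>I. [:a i, b i:]) \<le> card I"
proof -
  have "coeff (\<Prod>i\<in>I. [:a i, b i:]) (card I) = (\<Prod>i\<in>I. b i) \<and> degree (\<Prod>i\<in>I. [:a i, b i:]) \<le> card I"
    using assms
  proof (induction I rule: finite_induct)
    case (insert j I)
    let ?P = "\<Prod>i\<in>I. [:a i, b i:]"
    have "degree ([:a j, b j:] * ?P) \<le> Suc (card I)"
      using insert.IH by (intro order_trans[OF degree_mult_le]) (auto simp: degree_pCons_eq_if)
    thus ?case using insert by (simp add: coeff_eq_0)
  qed simp
  thus "coeff (\<Prod>i\<in>I. [:a i, b i:]) (card I) = (\<Prod>i\<in>I. b i)"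
    and "degree (\<Prod>i\<in>I. [:a i, b i:]) \<le> card I" by auto
qed

text \<open>A \<open>2^s\<close>-th power of \<open>\<beta>\<close> that is a quotient of algebraic integers of size at most \<open>B\<close> controls the
  Mahler measure of \<open>\<beta>\<close>, leading coefficient included: Graeffe's transform preserves primitivity by
  Gauss' lemma.\<close>

lemma mahler_bound_from_power:
  assumes \<xi>: "algebraic \<xi>" and \<beta>: "\<beta> \<in> qext \<xi>"
    and u: "u \<in> qext \<xi>" "algebraic_int u" and w: "w \<in> qext \<xi>" "algebraic_int w" "w \<noteq> 0"
    and rel: "\<beta> ^ (2 ^ s) * w = u"
    and bound: "\<And>\<eta>. \<eta> \<in> conjugates \<xi> \<Longrightarrow> norm (emb \<xi> \<eta> u) \<le> B"
      "\<And>\<eta>. \<eta> \<in> conjugates \<xi> \<Longrightarrow> norm (emb \<xi> \<eta> w) \<le> B"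
    and small: "B ^ card (conjugates \<xi>) < 2 ^ (2 ^ s)"
  shows "algebraic_int \<beta>"
    and "(\<Prod>\<eta>\<in>conjugates \<xi>. max 1 (norm (emb \<xi> \<eta> \<beta>))) ^ (2 ^ s) \<le> B ^ card (conjugates \<xi>)"
proof -
  let ?C = "conjugates \<xi>"
  define q :: nat where "q = 2 ^ s"
  define b where "b = (\<lambda>\<eta>. emb \<xi> \<eta> \<beta>)"
  define M where "M = (\<Prod>\<eta>\<in>?C. max 1 (norm (b \<eta>)))"
  have fin: "finite ?C" by (rule finite_conjugates[OF \<xi>])
  define cp where "cp = (\<Prod>\<eta>\<in>?C. [:- b \<eta>, 1:])"
  have "coeff cp i \<in> \<rat>" for i
  proof -
    have "cp = (\<Prod>\<eta>\<in>?C. [:- emb \<xi> \<eta> \<beta>, emb \<xi> \<eta> 1:])"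
      unfolding cp_def b_def by (intro prod.cong) (auto simp: emb_1[OF \<xi>])
    thus ?thesis using coeff_prod_emb_rational[OF \<xi> \<beta> qext_1] by simp
  qed
  moreover have "cp \<noteq> 0" using fin by (auto simp: cp_def)
  \<comment> \<open>The leading coefficient \<open>c\<close> of the primitive multiple measures the
    denominator of \<open>\<beta>\<close>; the quantity to be bounded is
    \<open>norm c * M\<close>.\<close>
  ultimately obtain f :: "int poly" and c where f: "content f = 1" "map_poly of_int f = smult c cp"
    using primitive_multiple_of_rational_poly by blast
  obtain g c' where g: "content g = 1" "norm c' = norm c ^ q"
    "map_poly of_int (g :: int poly) = smult c' (\<Prod>\<eta>\<in>?C. [:- (b \<eta> ^ q), 1:])"
    using graeffe_primitive_iterate[OF f(1) f(2)[unfolded cp_def], of s] unfolding q_def by blast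
  define n where "n = card ?C"
  have c: "c = of_int (coeff f n)"
  proof -
    have "of_int (coeff f n) = coeff (map_poly of_int f) n" by (simp add: coeff_map_poly)
    also have "\<dots> = c" unfolding f(2) cp_def n_def using coeff_prod_linear_card(1)[OF fin, of "\<lambda>\<eta>. - b \<eta>" "\<lambda>_. 1"] by simp
    finally show ?thesis by simp
  qed
  have c': "c' = of_int (coeff g n)"
  proof -
    have "of_int (coeff g n) = coeff (map_poly of_int g) n" by (simp add: coeff_map_poly)
    also have "\<dots> = c'" unfolding g(3) n_def using coeff_prod_linear_card(1)[OF fin, of "\<lambda>\<eta>. - (b \<eta> ^ q)" "\<lambda>_. 1"] by simp
    finally show ?thesis by simp
  qed
  define G where "G = (\<Prod>\<eta>\<in>?C. [:- emb \<xi> \<eta> u, emb \<xi> \<eta> w:])"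
  have "coeff G i \<in> \<int>" for i
  proof (rule rational_algebraic_int_is_int)
    show "coeff G i \<in> \<rat>" unfolding G_def by (rule coeff_prod_emb_rational[OF \<xi> u(1) w(1)])
    show "algebraic_int (coeff G i)" unfolding G_def using u w
      by (intro algebraic_int_coeff_prod)
        (auto simp: coeff_pCons algebraic_int_emb[OF \<xi>] split: nat.splits)
  qed
  then obtain G' where G': "G = map_poly of_int G'" using intpolyE by blast
  define N where "N = (\<Prod>\<eta>\<in>?C. emb \<xi> \<eta> w)"
  have N: "N = of_int (coeff G' n)"
    using coeff_prod_linear_card(1)[OF fin, of "\<lambda>\<eta>. - emb \<xi> \<eta> u" "\<lambda>\<eta>. emb \<xi> \<eta> w"]
    by (simp add: N_def n_def coeff_map_poly flip: G_def G')
      (simp add: G' coeff_map_poly)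
  have emb_u: "emb \<xi> \<eta> u = emb \<xi> \<eta> w * b \<eta> ^ q" if "\<eta> \<in> ?C" for \<eta>
    unfolding rel[symmetric] b_def q_def
    by (simp add: emb_mult[OF \<xi> that] emb_power[OF \<xi> that] qext_power \<beta> w)
  have "G = (\<Prod>\<eta>\<in>?C. smult (emb \<xi> \<eta> w) [:- (b \<eta> ^ q), 1:])"
    unfolding G_def by (intro prod.cong) (auto simp: emb_u)
  also have "\<dots> = smult N (\<Prod>\<eta>\<in>?C. [:- (b \<eta> ^ q), 1:])"
    unfolding N_def by (rule prod_smult)
  \<comment> \<open>Both \<open>G\<close> and the primitive \<open>g\<close> are integer polynomials
    with the roots \<open>b \<eta> ^ q\<close>. Comparing contents, the leading coefficient of
    \<open>g\<close> is at most that of \<open>G\<close> in absolute value, which is the norm of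
    \<open>w\<close>.\<close>
  finally have "smult c' G = smult N (map_poly of_int g)" by (simp add: g(3) mult.commute)
  hence "map_poly of_int (smult (coeff g n) G') = (map_poly of_int (smult (coeff G' n) g) :: complex poly)"
    by (simp add: of_int_hom.map_poly_hom_smult G' flip: c' N)
  hence "smult (coeff g n) G' = smult (coeff G' n) g"
    by (metis of_int_poly_hom.injectivity)
  hence "content (smult (coeff g n) G') = content (smult (coeff G' n) g)" by simp
  hence eq: "\<bar>coeff g n\<bar> * content G' = \<bar>coeff G' n\<bar>" using g(1) by (simp add: content_smult)
  have N0: "N \<noteq> 0" using fin w by (auto simp: N_def emb_eq_0_iff[OF \<xi>])
  hence "content G' \<noteq> 0" using N eq by auto
  moreover have "content G' \<ge> 0" by (metis abs_ge_zero normalize_content normalize_int_def)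
  ultimately have "content G' \<ge> 1" by linarith
  hence "\<bar>coeff g n\<bar> \<le> \<bar>coeff G' n\<bar>" using eq by (metis abs_ge_zero mult_left_mono mult.right_neutral)
  hence "norm c' \<le> norm N" unfolding c' N by (simp add: norm_of_int)
  hence cN: "norm c ^ q \<le> norm N" using g(2) by simp
  have "norm c ^ q * M ^ q \<le> norm N * M ^ q"
    using cN by (intro mult_right_mono) (auto simp: M_def intro!: prod_nonneg zero_le_power)
  also have "\<dots> = (\<Prod>\<eta>\<in>?C. norm (emb \<xi> \<eta> w) * max 1 (norm (b \<eta>)) ^ q)"
    by (simp add: N_def M_def prod_norm prod.distrib prod_power_distrib)
  also have "\<dots> \<le> (\<Prod>\<eta>\<in>?C. B)"
  proof (rule prod_mono, safe)
    fix \<eta> assume \<eta>: "\<eta> \<in> ?C"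
    have "norm (emb \<xi> \<eta> w) * max 1 (norm (b \<eta>)) ^ q = max (norm (emb \<xi> \<eta> w)) (norm (emb \<xi> \<eta> u))"
    proof (cases "norm (b \<eta>) \<le> 1")
      case True
      hence "norm (b \<eta>) ^ q \<le> 1" by (simp add: power_le_one)
      hence "norm (emb \<xi> \<eta> w) * norm (b \<eta>) ^ q \<le> norm (emb \<xi> \<eta> w) * 1"
        by (intro mult_left_mono) auto
      thus ?thesis using True by (simp add: emb_u[OF \<eta>] norm_mult norm_power max_def)
    next
      case False
      hence "1 \<le> norm (b \<eta>) ^ q" by (intro one_le_power) auto
      hence "norm (emb \<xi> \<eta> w) * 1 \<le> norm (emb \<xi> \<eta> w) * norm (b \<eta>) ^ q"
        by (intro mult_left_mono) auto
      thus ?thesis using False by (simp add: emb_u[OF \<eta>] norm_mult norm_power max_def)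
    qed
    also have "\<dots> \<le> B" using bound[OF \<eta>] by simp
    finally show "norm (emb \<xi> \<eta> w) * max 1 (norm (b \<eta>)) ^ q \<le> B" .
  qed auto
  also have "\<dots> = B ^ n" by (simp add: n_def)
  finally have key: "norm c ^ q * M ^ q \<le> B ^ n" .
  have M1: "M \<ge> 1" unfolding M_def by (intro prod_ge_1) auto
  have "norm c ^ q \<le> norm c ^ q * M ^ q"
    using one_le_power[OF M1, of q] by (intro mult_le_cancel_left1[THEN iffD2]) auto
  \<comment> \<open>The smallness hypothesis enters here: the leading coefficient is a nonzero
    integer of absolute value below 2, so \<open>\<beta>\<close> is integral and \<open>c\<close>
    drops out of the bound.\<close>
  hence "norm c ^ q < 2 ^ q" using key small by (simp add: n_def q_def)
  hence "norm c < 2" by (rule power_less_imp_less_base) simp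
  hence "\<bar>coeff f n\<bar> < 2" unfolding c by (simp add: norm_of_int)
  moreover have "f \<noteq> 0" using f(1) by auto
  hence "c \<noteq> 0" using f(2) by auto
  hence "coeff f n \<noteq> 0" unfolding c by simp
  ultimately have f1: "coeff f n = 1 \<or> coeff f n = -1" by linarith
  hence "norm c = 1" unfolding c by auto
  thus "(\<Prod>\<eta>\<in>?C. max 1 (norm (emb \<xi> \<eta> \<beta>))) ^ (2 ^ s) \<le> B ^ card ?C"
    using key by (simp add: M_def b_def q_def n_def)
  have "poly cp \<beta> = 0"
    using fin self_in_conjugates[OF \<xi>] emb_self[OF \<xi> \<beta>]
    by (auto simp: cp_def poly_prod b_def intro!: bexI[of _ \<xi>])
  hence root: "poly (map_poly of_int f) \<beta> = 0" unfolding f(2) by simp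
  have "degree f = degree cp"
    using arg_cong[OF f(2), of degree] \<open>c \<noteq> 0\<close> by simp
  also have "\<dots> \<le> n" unfolding cp_def n_def by (rule coeff_prod_linear_card(2)[OF fin])
  finally have "degree f = n" using \<open>coeff f n \<noteq> 0\<close> le_degree[of f n] by simp
  define f' where "f' = smult (coeff f n) f"
  have "monic f'" using f1 \<open>degree f = n\<close> by (auto simp: f'_def)
  moreover have "poly (map_poly of_int f') \<beta> = 0"
    using root by (simp add: f'_def of_int_hom.map_poly_hom_smult)
  ultimately show "algebraic_int \<beta>" unfolding algebraic_int_altdef_ipoly by blast
qed

section \<open>Counting primes\<close>

text \<open>Induction along the identity
  \<open>1/((m+1) C(n,m+1)) = 1/(m C(n-1,m)) - 1/(m C(n,m))\<close> of the Leibniz harmonic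
  triangle: multiplied by the lcm, both terms on the right are integers.\<close>

lemma Lcm_over_binomial_int:
  assumes "1 \<le> m" "m \<le> n"
  shows "of_nat (Lcm {1..n}) / of_nat (m * (n choose m)) \<in> (\<int> :: rat set)"
  using assms
proof (induction m arbitrary: n rule: nat_induct_at_least)
  case base
  have "n dvd Lcm {1..n}" using base by (intro dvd_Lcm) auto
  then obtain k where k: "Lcm {1..n} = n * k" by (elim dvdE)
  have "(of_nat (n * k) :: rat) / of_nat n = of_nat k" using base by simp
  thus ?case using k by simp
next
  case (Suc m)
  obtain n' where n: "n = Suc n'" using Suc.prems by (cases n) auto
  have m: "m \<ge> 1" "m \<le> n'" using Suc n by auto
  define L where "L = (of_nat (Lcm {1..n}) :: rat)"
  have e1: "Suc m * (n choose Suc m) = n * (n' choose m)"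
    unfolding n by (rule Suc_times_binomial)
  have e2: "(n - m) * (n choose m) = n * (n' choose m)"
    using binomial_absorb_comp[of n m] n by simp
  have c0: "n' choose m > 0" "n choose m > 0" using m n by auto
  have e2': "(of_nat n - of_nat m) * of_nat (n choose m) = (of_nat n * of_nat (n' choose m) :: rat)"
    using e2 m n by (metis of_nat_diff of_nat_mult le_SucI)
  have "1 / of_nat (Suc m * (n choose Suc m))
          = 1 / of_nat (m * (n' choose m)) - (1 / of_nat (m * (n choose m)) :: rat)"
  proof -
    have nz: "(of_nat (n choose m) :: rat) \<noteq> 0" "(of_nat (n' choose m) :: rat) \<noteq> 0"
      "(of_nat m :: rat) \<noteq> 0" "(of_nat n :: rat) \<noteq> 0" using c0 m n by auto
    have "1 / of_nat (m * (n' choose m)) - (1 / of_nat (m * (n choose m)) :: rat)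
        = (of_nat (n choose m) - of_nat (n' choose m)) / (of_nat m * of_nat (n' choose m) * of_nat (n choose m))"
      using nz by (simp add: field_simps)
    also have "of_nat (n choose m) - of_nat (n' choose m) = (of_nat m / of_nat n * of_nat (n choose m) :: rat)"
    proof -
      have "of_nat n * (of_nat (n choose m) - of_nat (n' choose m)) = (of_nat m * of_nat (n choose m) :: rat)"
        using e2' by (simp only: left_diff_distrib right_diff_distrib)
      thus ?thesis using nz(4) by (metis nonzero_mult_div_cancel_left times_divide_eq_left)
    qed
    also have "of_nat m / of_nat n * of_nat (n choose m) / (of_nat m * of_nat (n' choose m) * of_nat (n choose m))
                 = (1 / (of_nat n * of_nat (n' choose m)) :: rat)"
      using nz by (simp add: field_simps)
    finally show ?thesis unfolding e1 by simp
  qed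
  hence "L / of_nat (Suc m * (n choose Suc m)) = L / of_nat (m * (n' choose m)) - L / of_nat (m * (n choose m))"
    by (simp add: divide_inverse right_diff_distrib flip: of_nat_Suc)
  moreover have "L / of_nat (m * (n' choose m)) \<in> \<int>"
  proof -
    have "Lcm {1..n'} dvd Lcm {1..n}" using n by (intro Lcm_subset) auto
    then obtain k where k: "Lcm {1..n} = Lcm {1..n'} * k" by (elim dvdE)
    have "L / of_nat (m * (n' choose m)) = of_nat k * (of_nat (Lcm {1..n'}) / of_nat (m * (n' choose m)))"
      unfolding L_def k by simp
    also have "\<dots> \<in> \<int>" using Suc.IH[OF m(2)] by (intro Ints_mult) auto
    finally show ?thesis .
  qed
  moreover have "L / of_nat (m * (n choose m)) \<in> \<int>"
    unfolding L_def using m n by (intro Suc.IH) auto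
  ultimately show ?case unfolding L_def by (metis Ints_diff)
qed

text \<open>The lcm is a multiple of \<open>n\<close> times the central binomial coefficient, and
  that product is at least \<open>4^n / 2\<close>.\<close>

lemma Lcm_atLeastAtMost_ge:
  assumes "n \<ge> 1"
  shows "2 ^ n \<le> Lcm {1..2 * n :: nat}"
proof -
  define K where "K = n * ((2 * n) choose n)"
  have K0: "K > 0" using assms by (simp add: K_def)
  have "of_nat (Lcm {1..2 * n}) / of_nat K \<in> (\<int> :: rat set)"
    unfolding K_def using assms by (intro Lcm_over_binomial_int) auto
  then obtain z :: int where z: "of_nat (Lcm {1..2 * n}) / of_nat K = (of_int z :: rat)"
    by (elim Ints_cases)
  have L0: "Lcm {1..2 * n} > 0" by (intro Nat.gr0I) (auto simp: Lcm_0_iff)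
  have "(of_int z :: rat) > 0" unfolding z[symmetric] using K0 L0 by simp
  hence "z \<ge> 1" by simp
  hence "1 \<le> of_nat (Lcm {1..2 * n}) / (of_nat K :: rat)" unfolding z by simp
  hence "K \<le> Lcm {1..2 * n}" using K0 by (simp add: field_simps)
  moreover have "real (2 ^ n) \<le> real K"
  proof -
    have "(2::real) ^ n * 2 \<le> 2 ^ n * 2 ^ n" using power_increasing[of 1 n "2::real"] assms by simp
    also have "\<dots> = 4 ^ n" by (simp flip: power_mult_distrib)
    also have "\<dots> \<le> real ((2 * n) choose n) * (2 * real n)"
      using central_binomial_lower_bound[of n] assms by (simp add: field_simps)
    finally show ?thesis by (simp add: K_def mult.commute)
  qed
  ultimately show ?thesis by (metis of_nat_le_iff order_trans)
qed

text \<open>Each prime contributes to the lcm a single power not exceeding \<open>x\<close>.\<close>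

lemma Lcm_atLeastAtMost_le:
  assumes "x \<ge> 1"
  shows "Lcm {1..x :: nat} \<le> x ^ card {p. prime p \<and> p \<le> x}"
proof -
  define A where "A = {p. prime p \<and> p \<le> x}"
  define e where "e = (\<lambda>p. Max {e. p ^ e \<le> x})"
  have finA: "finite A" by (rule finite_subset[of _ "{..x}"]) (auto simp: A_def)
  have fin: "finite {e. p ^ e \<le> x}" if "p \<ge> 2" for p
  proof (rule finite_subset[of _ "{..x}"], safe)
    fix e assume "p ^ e \<le> x"
    moreover have "e < 2 ^ e" by (rule less_exp)
    moreover have "(2::nat) ^ e \<le> p ^ e" using that by (rule power_mono) simp
    ultimately show "e \<le> x" by linarith
  qed
  have e_le: "p ^ e p \<le> x" if "p \<ge> 2" for p
  proof -
    have "p ^ 0 \<le> x" using assms by simp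
    hence "{e. p ^ e \<le> x} \<noteq> {}" by blast
    from Max_in[OF fin[OF that] this] show ?thesis by (simp add: e_def)
  qed
  have e_ge: "k \<le> e p" if "p \<ge> 2" "p ^ k \<le> x" for p k
    unfolding e_def using fin[OF that(1)] that(2) by (intro Max_ge) auto
  have "Lcm {1..x} dvd (\<Prod>p\<in>A. p ^ e p)"
  proof (rule Lcm_least)
    fix i assume "i \<in> {1..x}"
    hence i: "i > 0" "i \<le> x" by auto
    have "i = (\<Prod>p\<in>prime_factors i. p ^ multiplicity p i)"
      using i by (simp add: prime_factorization_nat)
    also have "\<dots> dvd (\<Prod>p\<in>A. p ^ e p)"
    proof (rule prod_dvd_prod_subset2[OF finA])
      show "prime_factors i \<subseteq> A"
        using i by (auto simp: A_def prime_factors_dvd dest!: dvd_imp_le)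
      fix p assume "p \<in> prime_factors i"
      hence p: "prime p" by auto
      have "p ^ multiplicity p i \<le> i" using i by (intro dvd_imp_le multiplicity_dvd) auto
      hence "multiplicity p i \<le> e p" using i prime_ge_2_nat[OF p] by (intro e_ge) auto
      thus "p ^ multiplicity p i dvd p ^ e p" by (rule le_imp_power_dvd)
    qed
    finally show "i dvd (\<Prod>p\<in>A. p ^ e p)" .
  qed
  moreover have "(\<Prod>p\<in>A. p ^ e p) > 0" by (intro prod_pos) (auto simp: A_def prime_gt_0_nat)
  ultimately have "Lcm {1..x} \<le> (\<Prod>p\<in>A. p ^ e p)" by (rule dvd_imp_le)
  also have "\<dots> \<le> (\<Prod>p\<in>A. x)"
    by (intro prod_mono) (auto simp: A_def intro!: e_le prime_ge_2_nat)
  finally show ?thesis by (simp add: A_def)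
qed

lemma prime_count_lower:
  assumes "n \<ge> 1"
  shows "real n * ln 2 \<le> real (card {p. prime p \<and> p \<le> 2 * n}) * ln (2 * real n)"
proof -
  have "2 ^ n \<le> (2 * n) ^ card {p. prime p \<and> p \<le> 2 * n}"
    using Lcm_atLeastAtMost_ge[OF assms] Lcm_atLeastAtMost_le[of "2 * n"] assms by simp
  hence "real (2 ^ n) \<le> real ((2 * n) ^ card {p. prime p \<and> p \<le> 2 * n})" by (subst of_nat_le_iff)
  hence "ln (2 ^ n) \<le> ln ((2 * real n) ^ card {p. prime p \<and> p \<le> 2 * n})"
    using assms by (subst ln_le_cancel_iff) auto
  thus ?thesis using assms by (subst (asm) (1 2) ln_realpow) auto
qed

text \<open>Only primes above the square root of \<open>P\<close> are kept, so that
  \<open>ln p \<ge> ln P / 2\<close> for each of them; the discarded ones are negligible next to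
  Chebyshev's lower bound. The term with \<open>J\<close> pays for the bad primes of the Dobrowolski
  argument.\<close>

lemma eventually_many_large_primes:
  fixes J :: real and s :: real
  shows "eventually (\<lambda>P::nat. s + J * ln (real P) \<le> real (card {p. prime p \<and> p \<le> P \<and> P < p ^ 2})) at_top"
proof -
  have "eventually (\<lambda>x::real. (x / 2 - 1) * ln 2 / ln x - sqrt x - 1 \<ge> s + J * ln x) at_top"
    by real_asymp
  hence "eventually (\<lambda>P::nat. (real P / 2 - 1) * ln 2 / ln (real P) - sqrt (real P) - 1 \<ge> s + J * ln (real P)) at_top"
    using eventually_compose_filterlim[OF _ filterlim_real_sequentially] by blast
  moreover have "eventually (\<lambda>P::nat. P \<ge> 4) at_top" by (rule eventually_ge_at_top)
  ultimately show ?thesis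
  proof eventually_elim
    case (elim P)
    define n where "n = P div 2"
    have n: "n \<ge> 1" "real P / 2 - 1 \<le> real n" "2 * n \<le> P" using elim(2) by (auto simp: n_def field_simps)
    define A where "A = {p. prime p \<and> p \<le> P}"
    define S where "S = {p. p ^ 2 \<le> P}"
    have finA: "finite A" by (rule finite_subset[of _ "{..P}"]) (auto simp: A_def)
    have Ssub: "S \<subseteq> {..nat \<lfloor>sqrt (real P)\<rfloor>}"
    proof
      fix p assume "p \<in> S"
      hence "real (p ^ 2) \<le> real P" unfolding S_def by (subst of_nat_le_iff) simp
      hence "real p \<le> sqrt (real P)" by (intro real_le_rsqrt) simp
      thus "p \<in> {..nat \<lfloor>sqrt (real P)\<rfloor>}" by (simp add: le_nat_floor)
    qed
    have "card S \<le> Suc (nat \<lfloor>sqrt (real P)\<rfloor>)" using card_mono[OF _ Ssub] by simp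
    hence cS: "real (card S) \<le> sqrt (real P) + 1"
      using of_nat_floor[of "sqrt (real P)"] real_sqrt_ge_zero[of "real P"] by linarith
    have finS: "finite S" using Ssub finite_subset by blast
    have lnP: "ln (real P) > 0" using elim(2) by simp
    have "(real P / 2 - 1) * ln 2 \<le> real n * ln 2" using n by (intro mult_right_mono) auto
    also have "\<dots> \<le> real (card {p. prime p \<and> p \<le> 2 * n}) * ln (2 * real n)"
      by (rule prime_count_lower[OF n(1)])
    also have "\<dots> \<le> real (card A) * ln (real P)"
    proof (rule mult_mono)
      show "real (card {p. prime p \<and> p \<le> 2 * n}) \<le> real (card A)"
        using n finA by (subst of_nat_le_iff, intro card_mono) (auto simp: A_def)
      have "2 * real n \<le> real P" using n(3) by linarith
      thus "ln (2 * real n) \<le> ln (real P)" using n(1) by (subst ln_le_cancel_iff) auto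
    qed (use n in auto)
    finally have "(real P / 2 - 1) * ln 2 / ln (real P) \<le> real (card A)"
      using lnP by (simp add: field_simps)
    moreover have "real (card A) - real (card S) \<le> real (card (A - S))"
      using diff_card_le_card_Diff[OF finS, of A] by linarith
    moreover have "A - S = {p. prime p \<and> p \<le> P \<and> P < p ^ 2}" by (auto simp: A_def S_def)
    ultimately show ?case using elim(1) cS by simp
  qed
qed

section \<open>Frobenius congruences and powers of conjugates\<close>

lemma algebraic_int_freshman:
  assumes p: "prime p" and x: "algebraic_int x" and y: "algebraic_int y"
  shows "algebraic_int (((x + y) ^ p - x ^ p - y ^ p) / of_nat p :: complex)"
proof -
  define T where "T = (\<lambda>k. of_nat (p choose k) * x ^ k * y ^ (p - k))"
  have p0: "p > 0" using prime_gt_0_nat[OF p] .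
  have "(x + y) ^ p = (\<Sum>k\<le>p. T k)" unfolding T_def by (rule binomial_ring)
  also have "{..p} = insert 0 (insert p {0<..<p})" using p0 by auto
  also have "(\<Sum>k\<in>insert 0 (insert p {0<..<p}). T k) = T 0 + (T p + (\<Sum>k\<in>{0<..<p}. T k))"
    using p0 by simp
  finally have "(x + y) ^ p - x ^ p - y ^ p = (\<Sum>k\<in>{0<..<p}. T k)" by (simp add: T_def)
  also have "\<dots> / of_nat p = (\<Sum>k\<in>{0<..<p}. of_nat ((p choose k) div p) * x ^ k * y ^ (p - k))"
    unfolding sum_divide_distrib
  proof (rule sum.cong)
    fix k assume k: "k \<in> {0<..<p}"
    have "p dvd (p choose k)" using k p by (intro dvd_choose_prime) auto
    then obtain c where c: "p choose k = p * c" by (elim dvdE)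
    thus "T k / of_nat p = of_nat ((p choose k) div p) * x ^ k * y ^ (p - k)"
      using p0 by (simp add: T_def)
  qed simp
  finally show ?thesis
    using x y by (simp add: algebraic_int_sum algebraic_int_mult algebraic_int_power)
qed

text \<open>The congruence of \<open>f(x^p)\<close> and \<open>f(x)^p\<close> modulo
  \<open>p\<close> in the ring of algebraic integers. Going through the coefficients, the binomial
  congruence splits off one term and Fermat's little theorem handles its integer
  coefficient.\<close>

lemma algebraic_int_frobenius:
  assumes p: "prime p" and x: "algebraic_int x"
  shows "algebraic_int ((poly (map_poly of_int f) (x ^ p) - poly (map_poly of_int f) x ^ p) / of_nat p :: complex)"
proof (induction f)
  case 0
  show ?case using prime_gt_0_nat[OF p] by (simp add: zero_power)
next
  case (pCons a f)
  define g where "g = poly (map_poly of_int f) x"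
  define g' where "g' = poly (map_poly of_int f) (x ^ p)"
  have g: "algebraic_int g" unfolding g_def using x by (intro algebraic_int_poly) auto
  have p0: "(of_nat p :: complex) \<noteq> 0" using prime_gt_0_nat[OF p] by simp
  have "[a ^ p = a] (mod int p)"
  proof (cases "int p dvd a")
    case True
    hence "int p dvd a ^ p" using prime_gt_0_nat[OF p] by (meson dvd_power dvd_trans)
    thus ?thesis using True by (simp add: cong_def mod_eq_0_iff_dvd)
  next
    case False
    define r where "r = nat (a mod int p)"
    have r: "int r = a mod int p" using prime_gt_0_nat[OF p] by (simp add: r_def)
    have "\<not> p dvd r" using False by (metis r dvd_mod_iff int_dvd_int_iff dvd_refl)
    hence "[r ^ (p - 1) = 1] (mod p)" by (rule fermat_theorem[OF p])
    hence "[int r ^ (p - 1) = 1] (mod int p)" by (metis cong_int_iff of_nat_1 of_nat_power)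
    moreover have "[a ^ (p - 1) = int r ^ (p - 1)] (mod int p)"
      by (rule cong_pow) (simp add: r cong_def)
    ultimately have "[a ^ (p - 1) = 1] (mod int p)" by (rule cong_trans[rotated])
    hence "[a ^ (p - 1) * a = 1 * a] (mod int p)" by (intro cong_mult) auto
    thus ?thesis using prime_gt_0_nat[OF p] by (simp add: power_eq_if mult.commute)
  qed
  then obtain c where c: "a ^ p - a = int p * c" by (auto simp: cong_iff_dvd_diff elim: dvdE)
  hence c': "(of_int a ^ p :: complex) - of_int a = of_nat p * of_int c"
    by (metis of_int_diff of_int_mult of_int_of_nat_eq of_int_power)
  have eq: "(poly (map_poly of_int (pCons a f)) (x ^ p) - poly (map_poly of_int (pCons a f)) x ^ p) / of_nat p
      = x ^ p * ((g' - g ^ p) / of_nat p) - of_int c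
          - ((of_int a + x * g) ^ p - of_int a ^ p - (x * g) ^ p) / of_nat p"
  proof -
    have "(of_int a + x ^ p * g' - (of_int a + x * g) ^ p)
        = x ^ p * (g' - g ^ p) - (of_int a ^ p - of_int a)
          - ((of_int a + x * g) ^ p - of_int a ^ p - (x * g) ^ p)"
      by (simp add: algebra_simps power_mult_distrib)
    also have "\<dots> / of_nat p = x ^ p * ((g' - g ^ p) / of_nat p) - of_int c
          - ((of_int a + x * g) ^ p - of_int a ^ p - (x * g) ^ p) / of_nat p"
      unfolding c' using p0 by (simp add: diff_divide_distrib right_diff_distrib)
    finally show ?thesis by (simp add: of_int_hom.map_poly_pCons_hom g_def g'_def)
  qed
  have "algebraic_int (((of_int a + x * g) ^ p - of_int a ^ p - (x * g) ^ p) / of_nat p)"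
    using x g by (intro algebraic_int_freshman p algebraic_int_mult) auto
  thus ?case
    unfolding eq using x pCons.IH[folded g_def g'_def]
    by (intro algebraic_int_diff algebraic_int_mult algebraic_int_power algebraic_int_of_int)
qed

section \<open>Differences between powers of conjugates\<close>

lemma emb_self_power: "algebraic \<beta> \<Longrightarrow> b \<in> conjugates \<beta> \<Longrightarrow> emb \<beta> b (\<beta> ^ c) = b ^ c"
  using emb_poly[of \<beta> b "monom 1 c"] by (simp add: of_rat_hom.map_poly_hom_monom poly_monom)

lemma power_conjugates_rat_poly:
  assumes "algebraic \<beta>"
  obtains q where "map_poly of_rat q = (\<Prod>b\<in>conjugates \<beta>. [:- (b ^ c), 1:] :: complex poly)"
proof -
  have "(\<Prod>b\<in>conjugates \<beta>. [:- (b ^ c), 1:]) = (\<Prod>b\<in>conjugates \<beta>. [:- emb \<beta> b (\<beta> ^ c), emb \<beta> b 1:])"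
    using assms by (intro prod.cong) (auto simp: emb_self_power emb_1)
  hence "coeff (\<Prod>b\<in>conjugates \<beta>. [:- (b ^ c), 1:]) i \<in> \<rat>" for i
    using coeff_prod_emb_rational[OF assms qext_power[OF qext_self] qext_1] by simp
  thus ?thesis using that ratpolyE by metis
qed

lemma poly_pderiv_prod_linear:
  fixes y :: "'b \<Rightarrow> complex"
  assumes "finite I" "i \<in> I"
  shows "poly (pderiv (\<Prod>j\<in>I. [:- y j, 1:])) (y i) = (\<Prod>j\<in>I - {i}. y i - y j)"
proof -
  have I: "I = insert i (I - {i})" using assms by auto
  have "(\<Prod>j\<in>I. [:- y j, 1:]) = [:- y i, 1:] * (\<Prod>j\<in>I - {i}. [:- y j, 1:])"
    using assms by (subst I) (simp del: insert_Diff_single)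
  thus ?thesis by (simp add: pderiv_mult pderiv_pCons poly_prod del: mult_pCons_left)
qed

text \<open>The off-diagonal partners of the node \<open>b ^ a\<close> among the nodes
  \<open>b' ^ c\<close>: for equal exponents a conjugate is not compared with itself.\<close>

definition power_pairs :: "complex \<Rightarrow> nat \<Rightarrow> nat \<Rightarrow> complex \<Rightarrow> complex set" where
  "power_pairs \<beta> a c b = (if a = c then conjugates \<beta> - {b} else conjugates \<beta>)"

text \<open>Let \<open>q\<close> have the roots \<open>b' ^ c\<close>. For distinct exponents the
  product is \<open>q\<close> at \<open>b ^ a\<close>; for equal exponents the derivative of
  \<open>q\<close> yields the product without its zero factor. Having one rational polynomial for
  all \<open>b\<close> gives both rational norms and transfer between conjugates.\<close>

lemma power_pairs_poly:
  assumes \<beta>: "algebraic \<beta>"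
  obtains R where "\<And>b. b \<in> conjugates \<beta> \<Longrightarrow>
    poly (map_poly of_rat R) b = (\<Prod>b'\<in>power_pairs \<beta> a c b. b ^ a - b' ^ c)"
proof -
  obtain q where q: "map_poly of_rat q = (\<Prod>b\<in>conjugates \<beta>. [:- (b ^ c), 1:] :: complex poly)"
    using power_conjugates_rat_poly[OF \<beta>] by blast
  show ?thesis
  proof (cases "a = c")
    case True
    show ?thesis
    proof (rule that[of "pderiv q \<circ>\<^sub>p monom 1 a"])
      fix b assume b: "b \<in> conjugates \<beta>"
      have "poly (map_poly of_rat (pderiv q \<circ>\<^sub>p monom 1 a)) b = poly (pderiv (map_poly of_rat q)) (b ^ c)"
        using True by (simp add: of_rat_hom.map_poly_pcompose of_rat_hom.map_poly_hom_monom poly_pcompose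
            poly_monom of_rat_hom.map_poly_pderiv)
      also have "\<dots> = (\<Prod>b'\<in>conjugates \<beta> - {b}. b ^ c - b' ^ c)"
        unfolding q by (rule poly_pderiv_prod_linear[OF finite_conjugates[OF \<beta>] b])
      finally show "poly (map_poly of_rat (pderiv q \<circ>\<^sub>p monom 1 a)) b = (\<Prod>b'\<in>power_pairs \<beta> a c b. b ^ a - b' ^ c)"
        using True by (simp add: power_pairs_def)
    qed
  next
    case False
    show ?thesis
      by (rule that[of "q \<circ>\<^sub>p monom 1 a"])
        (simp add: of_rat_hom.map_poly_pcompose of_rat_hom.map_poly_hom_monom poly_pcompose
          poly_monom q poly_prod power_pairs_def False)
  qed
qed

lemma prod_power_pairs_rational:
  assumes \<beta>: "algebraic \<beta>"
  shows "(\<Prod>b\<in>conjugates \<beta>. \<Prod>b'\<in>power_pairs \<beta> a c b. b ^ a - b' ^ c) \<in> \<rat>"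
proof -
  obtain R where R: "\<And>b. b \<in> conjugates \<beta> \<Longrightarrow>
      poly (map_poly of_rat R) b = (\<Prod>b'\<in>power_pairs \<beta> a c b. b ^ a - b' ^ c)"
    using power_pairs_poly[OF \<beta>] by blast
  have "(\<Prod>b\<in>conjugates \<beta>. \<Prod>b'\<in>power_pairs \<beta> a c b. b ^ a - b' ^ c)
          = (\<Prod>b\<in>conjugates \<beta>. poly (map_poly of_rat R) b)"
    by (intro prod.cong) (simp_all add: R)
  thus ?thesis using prod_conjugates_rational[OF \<beta>] by simp
qed

text \<open>A coincidence at one conjugate is a zero of a rational polynomial, hence it occurs at
  every conjugate. This plays the part of a transitive Galois action.\<close>

lemma power_pairs_transitive:
  assumes \<beta>: "algebraic \<beta>" and "b \<in> conjugates \<beta>" "b' \<in> power_pairs \<beta> a c b" "b ^ a = b' ^ c"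
    and x: "x \<in> conjugates \<beta>"
  shows "\<exists>y\<in>power_pairs \<beta> a c x. x ^ a = y ^ c"
proof -
  obtain R where R: "\<And>b. b \<in> conjugates \<beta> \<Longrightarrow>
      poly (map_poly of_rat R) b = (\<Prod>b'\<in>power_pairs \<beta> a c b. b ^ a - b' ^ c)"
    using power_pairs_poly[OF \<beta>] by blast
  have fin: "finite (power_pairs \<beta> a c y)" for y
    using finite_conjugates[OF \<beta>] by (simp add: power_pairs_def)
  have "poly (map_poly of_rat R) b = 0"
    using R[OF assms(2)] assms(3,4) fin by auto
  hence "poly (map_poly of_rat R) x = 0"
    using conjugatesD[OF algebraic_conjugate[OF \<beta> assms(2)]] conjugates_conjugate[OF \<beta> assms(2)] x by simp
  thus ?thesis using R[OF x] fin by auto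
qed

lemma norm_prod_power_pairs_ge_1:
  assumes \<beta>: "algebraic_int \<beta>"
    and nz: "\<And>b b'. b \<in> conjugates \<beta> \<Longrightarrow> b' \<in> power_pairs \<beta> a c b \<Longrightarrow> b ^ a \<noteq> b' ^ c"
  shows "(\<Prod>b\<in>conjugates \<beta>. \<Prod>b'\<in>power_pairs \<beta> a c b. norm (b ^ a - b' ^ c)) \<ge> 1"
proof -
  have alg: "algebraic \<beta>" using \<beta> by auto
  have ai: "algebraic_int b" if "b \<in> conjugates \<beta>" for b
    by (rule algebraic_int_conjugate[OF \<beta> that])
  have sub: "b' \<in> conjugates \<beta>" if "b' \<in> power_pairs \<beta> a c b" for b b'
    using that by (auto simp: power_pairs_def split: if_splits)
  have fin: "finite (conjugates \<beta>)" "finite (power_pairs \<beta> a c y)" for y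
    using finite_conjugates[OF alg] by (simp_all add: power_pairs_def)
  have "norm (\<Prod>b\<in>conjugates \<beta>. \<Prod>b'\<in>power_pairs \<beta> a c b. b ^ a - b' ^ c) \<ge> 1"
  proof (rule norm_ge_1_if_rational_algebraic_int)
    show "algebraic_int (\<Prod>b\<in>conjugates \<beta>. \<Prod>b'\<in>power_pairs \<beta> a c b. b ^ a - b' ^ c)"
      using ai sub by (intro algebraic_int_prod algebraic_int_diff algebraic_int_power) blast+
  qed (use prod_power_pairs_rational[OF alg] nz fin in auto)
  thus ?thesis by (simp add: prod_norm)
qed

text \<open>Since \<open>f(b) = 0\<close>, the Frobenius congruence makes each
  \<open>f(b^p) / p\<close> integral, so the norm is still a nonzero integer after one factor
  \<open>p\<close> has been removed per conjugate.\<close>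

lemma norm_prod_prime_power_pairs_ge:
  assumes \<beta>: "algebraic_int \<beta>" and p: "prime p"
    and nz: "\<And>b b'. b \<in> conjugates \<beta> \<Longrightarrow> b' \<in> conjugates \<beta> \<Longrightarrow> b ^ p \<noteq> b'"
  shows "(\<Prod>b\<in>conjugates \<beta>. \<Prod>b'\<in>conjugates \<beta>. norm (b ^ p - b')) \<ge> real p ^ card (conjugates \<beta>)"
proof -
  let ?C = "conjugates \<beta>"
  have alg: "algebraic \<beta>" using \<beta> by auto
  have ai: "algebraic_int b" if "b \<in> ?C" for b by (rule algebraic_int_conjugate[OF \<beta> that])
  have fin: "finite ?C" by (rule finite_conjugates[OF alg])
  have p0: "p > 0" "p \<noteq> 1" using prime_gt_1_nat[OF p] by auto
  obtain f where ev: "\<And>x. poly (map_poly of_int f) x = (\<Prod>b\<in>?C. x - b)"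
    using int_poly_conjugates[OF \<beta>] by blast
  define h where "h = (\<lambda>b. (\<Prod>b'\<in>?C. b ^ p - b') / of_nat p)"
  have "algebraic_int (h b)" if b: "b \<in> ?C" for b
  proof -
    have "poly (map_poly of_int f) b = 0" unfolding ev using b fin by auto
    thus ?thesis using algebraic_int_frobenius[OF p ai[OF b], of f] p0
      by (simp add: h_def ev[symmetric] zero_power)
  qed
  moreover have "(\<Prod>b\<in>?C. h b) \<in> \<rat>"
  proof -
    have "(\<Prod>b\<in>?C. h b) = (\<Prod>b\<in>?C. \<Prod>b'\<in>power_pairs \<beta> p 1 b. b ^ p - b' ^ 1) / of_nat p ^ card ?C"
      using p0 by (simp add: h_def prod_dividef power_pairs_def)
    thus ?thesis using prod_power_pairs_rational[OF alg, of p 1] by (simp add: Rats_divide Rats_power)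
  qed
  moreover have "(\<Prod>b\<in>?C. h b) \<noteq> 0" using fin nz p0 by (auto simp: h_def)
  ultimately have "norm (\<Prod>b\<in>?C. h b) \<ge> 1"
    by (intro norm_ge_1_if_rational_algebraic_int algebraic_int_prod) auto
  also have "norm (\<Prod>b\<in>?C. h b) = (\<Prod>b\<in>?C. \<Prod>b'\<in>?C. norm (b ^ p - b')) / real p ^ card ?C"
    by (simp add: h_def prod_dividef norm_divide norm_power prod_norm)
  finally show ?thesis using p0 by (simp add: field_simps)
qed

lemma conjugate_nonzero:
  assumes \<beta>: "algebraic \<beta>" "\<beta> \<noteq> 0" and b: "b \<in> conjugates \<beta>"
  shows "b \<noteq> 0"
proof
  assume "b = 0"
  hence "\<beta> \<in> conjugates 0" using conjugates_conjugate[OF \<beta>(1) b] self_in_conjugates[OF \<beta>(1)] by simp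
  moreover have "poly (map_poly of_rat [:0, 1:]) (0::complex) = 0"
    by (simp add: of_rat_hom.map_poly_pCons_hom)
  ultimately have "poly (map_poly of_rat [:0, 1:]) \<beta> = 0" using conjugatesD[of 0 \<beta> "[:0,1:]"] by simp
  thus False using \<beta>(2) by (simp add: of_rat_hom.map_poly_pCons_hom)
qed

text \<open>The coincidence spreads to a self-map \<open>\<pi>\<close> of the conjugates with
  \<open>x ^ a = \<pi> x ^ c\<close>. On a finite set some iterate has a fixed point
  \<open>y\<close>, so \<open>y ^ (a ^ k) = y ^ (c ^ k)\<close> with different exponents. Thus
  \<open>y\<close>, and with it its conjugate \<open>\<beta>\<close>, is a root of unity.\<close>

lemma root_of_unity_if_powers_meet:
  assumes \<beta>: "algebraic \<beta>" "\<beta> \<noteq> 0" and b: "b \<in> conjugates \<beta>" "b' \<in> conjugates \<beta>" "b ^ a = b' ^ c"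
    and ac: "a \<noteq> c"
  shows "\<exists>n>0. \<beta> ^ n = 1"
proof -
  have "\<forall>x\<in>conjugates \<beta>. \<exists>y\<in>conjugates \<beta>. x ^ a = y ^ c"
    using power_pairs_transitive[OF \<beta>(1) b(1) _ b(3)] b(2) ac by (simp add: power_pairs_def)
  then obtain \<pi> where \<pi>: "\<And>x. x \<in> conjugates \<beta> \<Longrightarrow> \<pi> x \<in> conjugates \<beta>"
    "\<And>x. x \<in> conjugates \<beta> \<Longrightarrow> x ^ a = \<pi> x ^ c" by metis
  have iter_in: "(\<pi> ^^ n) x \<in> conjugates \<beta>" if "x \<in> conjugates \<beta>" for n x
    by (induction n) (auto simp: that \<pi>(1))
  have iter: "x ^ (a ^ n) = ((\<pi> ^^ n) x) ^ (c ^ n)" if "x \<in> conjugates \<beta>" for n x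
    using that
  proof (induction n arbitrary: x)
    case (Suc n)
    have "x ^ (a ^ Suc n) = (x ^ a) ^ (a ^ n)" by (simp add: power_mult)
    also have "\<dots> = (\<pi> x ^ (a ^ n)) ^ c" by (simp add: \<pi>(2)[OF Suc.prems] mult.commute flip: power_mult)
    also have "\<dots> = ((\<pi> ^^ n) (\<pi> x)) ^ (c ^ Suc n)"
      unfolding Suc.IH[OF \<pi>(1)[OF Suc.prems]] by (simp add: mult.commute flip: power_mult)
    finally show ?case by (simp add: funpow_swap1)
  qed simp
  have "\<not> inj (\<lambda>n. (\<pi> ^^ n) \<beta>)"
  proof
    assume "inj (\<lambda>n. (\<pi> ^^ n) \<beta>)"
    moreover have "range (\<lambda>n. (\<pi> ^^ n) \<beta>) \<subseteq> conjugates \<beta>"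
      using iter_in self_in_conjugates[OF \<beta>(1)] by auto
    ultimately show False
      using finite_conjugates[OF \<beta>(1)] by (metis finite_imageD finite_subset infinite_UNIV_nat)
  qed
  then obtain m n where mn: "m < n" "(\<pi> ^^ m) \<beta> = (\<pi> ^^ n) \<beta>"
    unfolding inj_def by (metis linorder_neqE_nat)
  define y where "y = (\<pi> ^^ m) \<beta>"
  define k where "k = n - m"
  have k: "k > 0" using mn by (simp add: k_def)
  have y: "y \<in> conjugates \<beta>" using iter_in self_in_conjugates[OF \<beta>(1)] by (simp add: y_def)
  have "n = k + m" using mn by (simp add: k_def)
  hence "(\<pi> ^^ k) y = y" using mn(2) by (simp add: y_def funpow_add)
  hence yy: "y ^ (a ^ k) = y ^ (c ^ k)" using iter[OF y, of k] by simp
  have y0: "y \<noteq> 0" by (rule conjugate_nonzero[OF \<beta> y])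
  have "a ^ k \<noteq> c ^ k" using ac k by (simp add: power_eq_iff_eq_base)
  then obtain e where e: "e > 0" "y ^ e = 1"
  proof (cases "a ^ k < c ^ k")
    case True
    hence "y ^ (c ^ k) = y ^ (a ^ k) * y ^ (c ^ k - a ^ k)" by (simp flip: power_add)
    hence "y ^ (c ^ k - a ^ k) = 1" using yy y0 by simp
    thus ?thesis using that[of "c ^ k - a ^ k"] True by simp
  next
    case False
    hence lt: "c ^ k < a ^ k" using \<open>a ^ k \<noteq> c ^ k\<close> by simp
    hence "y ^ (a ^ k) = y ^ (c ^ k) * y ^ (a ^ k - c ^ k)" by (simp flip: power_add)
    hence "y ^ (a ^ k - c ^ k) = 1" using yy y0 by simp
    thus ?thesis using that[of "a ^ k - c ^ k"] lt by simp
  qed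
  have "poly (map_poly of_rat (monom 1 e + [:-1:])) y = 0"
    using e by (simp only: poly_of_rat_add poly_of_rat_const of_rat_hom.map_poly_hom_monom poly_monom) simp
  hence "poly (map_poly of_rat (monom 1 e + [:-1:])) \<beta> = 0"
    using conjugatesD[OF algebraic_conjugate[OF \<beta>(1) y], of \<beta>] conjugates_conjugate[OF \<beta>(1) y]
      self_in_conjugates[OF \<beta>(1)] by simp
  hence "\<beta> ^ e = 1"
    by (simp only: poly_of_rat_add poly_of_rat_const of_rat_hom.map_poly_hom_monom poly_monom)
      (simp add: eq_neg_iff_add_eq_0)
  thus ?thesis using e(1) by blast
qed

lemma eq_if_coprime_powers_eq:
  fixes x y :: complex
  assumes "x ^ a = y ^ a" "x ^ b = y ^ b" "coprime a b" "y \<noteq> 0"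
  shows "x = y"
proof -
  define z where "z = x / y"
  have z: "z ^ a = 1" "z ^ b = 1" using assms by (auto simp: z_def power_divide)
  obtain u v :: int where uv: "u * int a + v * int b = 1"
    using assms(3) by (metis bezout_int coprime_iff_gcd_eq_1 coprime_int_iff)
  have z0: "z \<noteq> 0 \<or> (a = 0 \<and> b = 0)" using z by (cases "z = 0") (auto simp: power_0_left split: if_splits)
  have "z = 1"
  proof (cases "a = 0 \<and> b = 0")
    case True
    thus ?thesis using assms(3) by simp
  next
    case False
    hence nz: "z \<noteq> 0" using z0 by blast
    have "z = z powi (u * int a + v * int b)" unfolding uv by simp
    also have "\<dots> = (z powi int a) powi u * (z powi int b) powi v"
      using nz by (simp add: power_int_add mult.commute[of u] mult.commute[of v] power_int_mult)
    also have "\<dots> = 1" using z by simp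
    finally show ?thesis .
  qed
  thus ?thesis using assms(4) by (simp add: z_def)
qed

text \<open>Each bad prime \<open>p\<close> doubles a set of conjugates: every \<open>x\<close> has
  a partner with the same \<open>p\<close>-th power. Members of the old set agree in a power with
  exponent prime to \<open>p\<close>, so they have distinct \<open>p\<close>-th powers and the
  partners are new. Hence the bad primes number at most the binary logarithm of the degree.\<close>

lemma card_bad_primes:
  assumes \<beta>: "algebraic \<beta>" "\<beta> \<noteq> 0" and S: "finite S"
    and bad: "\<And>p. p \<in> S \<Longrightarrow> prime p \<and> (\<exists>b\<in>conjugates \<beta>. \<exists>b'\<in>conjugates \<beta>. b \<noteq> b' \<and> b ^ p = b' ^ p)"
  shows "2 ^ card S \<le> card (conjugates \<beta>)"
proof -
  note nz = conjugate_nonzero[OF \<beta>]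
  have "\<exists>X\<subseteq>conjugates \<beta>. card X = 2 ^ card S \<and> (\<forall>x\<in>X. \<forall>y\<in>X. x ^ (\<Prod>S) = y ^ (\<Prod>S))"
    using S bad
  proof (induction S rule: finite_induct)
    case empty
    show ?case using self_in_conjugates[OF \<beta>(1)] by (intro exI[of _ "{\<beta>}"]) auto
  next
    case (insert p S)
    obtain X where X: "X \<subseteq> conjugates \<beta>" "card X = 2 ^ card S"
      "\<And>x y. x \<in> X \<Longrightarrow> y \<in> X \<Longrightarrow> x ^ (\<Prod>S) = y ^ (\<Prod>S)"
      using insert by blast
    have p: "prime p" using insert.prems by simp
    have cop: "coprime p (\<Prod>S)"
    proof (rule prod_coprime_right)
      fix q assume "q \<in> S"
      hence "prime q" "q \<noteq> p" using insert by auto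
      thus "coprime p q" using p by (simp add: primes_coprime)
    qed
    obtain b b' where bb: "b \<in> conjugates \<beta>" "b' \<in> conjugates \<beta>" "b \<noteq> b'" "b ^ p = b' ^ p"
      using insert.prems[of p] by blast
    have "\<forall>x\<in>conjugates \<beta>. \<exists>y\<in>conjugates \<beta>. y \<noteq> x \<and> x ^ p = y ^ p"
      using power_pairs_transitive[OF \<beta>(1) bb(1) _ bb(4)] bb(2,3) by (simp add: power_pairs_def) blast
    then obtain h where h: "\<And>x. x \<in> conjugates \<beta> \<Longrightarrow> h x \<in> conjugates \<beta> \<and> h x \<noteq> x \<and> x ^ p = h x ^ p"
      by metis
    have uniq: "x = y" if "x \<in> X" "y \<in> X" "x ^ p = y ^ p" for x y
      using eq_if_coprime_powers_eq[OF that(3) X(3)[OF that(1,2)] cop] nz X(1) that by blast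
    have inj: "inj_on h X"
    proof (rule inj_onI)
      fix x y assume xy: "x \<in> X" "y \<in> X" "h x = h y"
      hence "x ^ p = y ^ p" using h[of x] h[of y] X(1) by (metis subsetD)
      thus "x = y" using uniq xy by blast
    qed
    have disj: "X \<inter> h ` X = {}"
    proof (rule ccontr)
      assume "X \<inter> h ` X \<noteq> {}"
      then obtain x where x: "x \<in> X" "h x \<in> X" by blast
      hence "x = h x" using uniq[of x "h x"] h[of x] X(1) by blast
      thus False using h[of x] x X(1) by auto
    qed
    have finX: "finite X" using X(1) finite_conjugates[OF \<beta>(1)] finite_subset by blast
    show ?case
    proof (intro exI[of _ "X \<union> h ` X"] conjI ballI)
      show "X \<union> h ` X \<subseteq> conjugates \<beta>" using X(1) h by blast
      show "card (X \<union> h ` X) = 2 ^ card (insert p S)"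
        using insert.hyps X(2) card_image[OF inj] finX disj by (subst card_Un_disjoint) auto
      have P: "\<Prod>(insert p S) = p * \<Prod>S" using insert.hyps by simp
      have pow: "\<exists>x\<in>X. z ^ (p * \<Prod>S) = x ^ (p * \<Prod>S)" if "z \<in> X \<union> h ` X" for z
        using that h X(1) by (auto simp: power_mult) (metis subsetD)
      fix x y assume "x \<in> X \<union> h ` X" "y \<in> X \<union> h ` X"
      then obtain x' y' where "x' \<in> X" "y' \<in> X" "x ^ (p * \<Prod>S) = x' ^ (p * \<Prod>S)" "y ^ (p * \<Prod>S) = y' ^ (p * \<Prod>S)"
        using pow by meson
      moreover from this have "x' ^ (p * \<Prod>S) = y' ^ (p * \<Prod>S)"
        using X(3)[of x' y'] by (simp add: mult.commute[of p] power_mult)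
      ultimately show "x ^ \<Prod>(insert p S) = y ^ \<Prod>(insert p S)" unfolding P by simp
    qed
  qed
  thus ?thesis using card_mono[OF finite_conjugates[OF \<beta>(1)]] by metis
qed

section \<open>A weak form of Dobrowolski's theorem\<close>

lemma prod_Sigma_offdiag:
  fixes f :: "'v \<Rightarrow> nat \<Rightarrow> 'a :: comm_monoid_mult"
  assumes "finite V" "v \<in> V" "a < m v"
  shows "(\<Prod>i\<in>Sigma V (\<lambda>v. {..<m v}) - {(v, a)}. f (fst i) (snd i))
           = (\<Prod>a'\<in>{..<m v} - {a}. f v a') * (\<Prod>v'\<in>V - {v}. \<Prod>a'<m v'. f v' a')"
proof -
  have split: "Sigma V (\<lambda>v. {..<m v}) - {(v, a)}
      = Pair v ` ({..<m v} - {a}) \<union> Sigma (V - {v}) (\<lambda>v. {..<m v})"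
    using assms by auto
  have "(\<Prod>i\<in>Sigma V (\<lambda>v. {..<m v}) - {(v, a)}. f (fst i) (snd i))
      = (\<Prod>i\<in>Pair v ` ({..<m v} - {a}). f (fst i) (snd i))
          * (\<Prod>i\<in>Sigma (V - {v}) (\<lambda>v. {..<m v}). f (fst i) (snd i))"
    unfolding split using assms by (intro prod.union_disjoint) auto
  also have "(\<Prod>i\<in>Pair v ` ({..<m v} - {a}). f (fst i) (snd i)) = (\<Prod>a'\<in>{..<m v} - {a}. f v a')"
    by (subst prod.reindex) (auto simp: inj_on_def)
  also have "(\<Prod>i\<in>Sigma (V - {v}) (\<lambda>v. {..<m v}). f (fst i) (snd i))
      = (\<Prod>v'\<in>V - {v}. \<Prod>a'<m v'. f v' a')"
    using assms(1) by (subst prod.Sigma) (auto simp: case_prod_beta)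
  finally show ?thesis .
qed

text \<open>Confluent Vandermonde products: each node is split into the nearby points \<open>y + x a\<close>, and the value
  at \<open>x = 0\<close> is recovered by the maximum principle.\<close>

lemma confluent_vandermonde_bound:
  fixes y :: "'v \<Rightarrow> complex" and m :: "'v \<Rightarrow> nat"
  assumes fin: "finite V" and m: "\<And>v. v \<in> V \<Longrightarrow> m v \<le> k" and k: "k \<ge> 1"
    and N: "N = (\<Sum>v\<in>V. m v)" "N \<ge> 1"
  shows "(\<Prod>v\<in>V. \<Prod>v'\<in>V - {v}. norm (y v - y v') ^ (m v * m v'))
           \<le> (real k * real N) ^ (\<Sum>v\<in>V. m v ^ 2) *
              (real N ^ N * exp (real N) * (\<Prod>v\<in>V. max 1 (norm (y v)) ^ m v) ^ N) ^ 2"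
proof -
  define I where "I = Sigma V (\<lambda>v. {..<m v})"
  define Z where "Z = (\<lambda>x v a. y v + x * of_nat a)"
  \<comment> \<open>With this radius every shift is at most \<open>r * k = 1 / N\<close>, so the
    \<open>N\<close> factors of the height product grow by at most
    \<open>(1 + 1/N)^N \<le> e\<close>. The price is a power of \<open>k * N\<close> for the close
    points.\<close>
  define r where "r = 1 / (real k * real N)"
  define Y where "Y = (\<Prod>v\<in>V. max 1 (norm (y v)) ^ m v)"
  \<comment> \<open>Only differences between distinct clusters are included. Therefore
    \<open>\<Phi>\<close> is a polynomial in \<open>x\<close> that does not degenerate at 0 and
    takes there, up to sign, the confluent product.\<close>
  define \<Phi> where "\<Phi> = (\<lambda>x. \<Prod>v\<in>V. \<Prod>a<m v. \<Prod>v'\<in>V - {v}. \<Prod>a'<m v'. Z x v' a' - Z x v a)"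
  define e where "e = (\<Sum>v\<in>V. m v ^ 2)"
  define U where "U = (real N ^ N * exp (real N) * Y ^ N) ^ 2"
  have finI: "finite I" using fin by (auto simp: I_def)
  have cardI: "card I = N" using fin by (simp add: I_def N)
  have kN: "real k * real N \<ge> 1"
    using k N(2) by (metis mult_le_mono nat_mult_1 of_nat_1 of_nat_le_iff of_nat_mult)
  have r: "0 < r" "r \<le> 1" using kN k N(2) by (auto simp: r_def divide_simps)
  have Y1: "Y \<ge> 1" unfolding Y_def by (intro prod_ge_1 one_le_power) auto
  have upper: "(\<Prod>i\<in>I. max 1 (norm (Z x (fst i) (snd i)))) \<le> Y * exp 1" if x: "norm x = r" for x
  proof -
    have "(\<Prod>i\<in>I. max 1 (norm (Z x (fst i) (snd i))))
            \<le> (\<Prod>i\<in>I. max 1 (norm (y (fst i))) * (1 + 1 / real N))"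
    proof (rule prod_mono, safe)
      fix v a assume "(v, a) \<in> I"
      hence v: "v \<in> V" "a < m v" by (auto simp: I_def)
      have "norm (Z x v a) \<le> norm (y v) + r * real a"
        unfolding Z_def by (rule order_trans[OF norm_triangle_ineq]) (simp add: norm_mult x)
      also have "r * real a \<le> r * real k" using v m[of v] r by (intro mult_left_mono) auto
      also have "r * real k = 1 / real N" using k by (simp add: r_def)
      finally have "norm (Z x v a) \<le> norm (y v) + 1 / real N" by simp
      moreover define mx where "mx = max 1 (norm (y v))"
      have mx: "1 \<le> mx" "norm (y v) \<le> mx" by (auto simp: mx_def)
      have "0 \<le> mx * (1 / real N)" using mx by simp
      moreover have "1 * (1 / real N) \<le> mx * (1 / real N)" using mx by (intro mult_right_mono) auto
      ultimately have "1 \<le> mx + mx * (1 / real N)" "norm (Z x v a) \<le> mx + mx * (1 / real N)"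
        using mx by linarith+
      hence "max 1 (norm (Z x v a)) \<le> mx * (1 + 1 / real N)"
        unfolding distrib_left by simp
      thus "max 1 (norm (Z x (fst (v, a)) (snd (v, a)))) \<le> max 1 (norm (y (fst (v, a)))) * (1 + 1 / real N)"
        by (simp add: mx_def)
    qed auto
    also have "\<dots> = (\<Prod>i\<in>I. max 1 (norm (y (fst i)))) * (1 + 1 / real N) ^ N"
      by (simp add: prod.distrib cardI)
    also have "(\<Prod>i\<in>I. max 1 (norm (y (fst i)))) = Y"
      unfolding I_def Y_def using fin prod.Sigma[of V "\<lambda>v. {..<m v}" "\<lambda>v a. max 1 (norm (y v))"]
      by (simp add: case_prod_beta)
    also have "Y * (1 + 1 / real N) ^ N \<le> Y * exp 1"
    proof (rule mult_left_mono)
      have "(1 + 1 / real N) ^ N \<le> exp (1 / real N) ^ N"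
        by (intro power_mono exp_ge_add_one_self) auto
      also have "\<dots> = exp 1" using N(2) by (simp flip: exp_of_nat_mult)
      finally show "(1 + 1 / real N) ^ N \<le> exp 1" .
    qed (use Y1 in auto)
    finally show ?thesis .
  qed
  have bnd: "norm (\<Phi> x) \<le> (real k * real N) ^ e * U" if x: "norm x = r" for x
  proof -
    \<comment> \<open>Completing \<open>\<Phi>\<close> to the full Vandermonde product needs the
      differences inside the clusters; each has modulus at least \<open>r\<close>, and
      \<open>e\<close> bounds their number.\<close>
    have "r ^ e * norm (\<Phi> x) \<le> (\<Prod>j\<in>I. \<Prod>i\<in>I - {j}. norm (Z x (fst i) (snd i) - Z x (fst j) (snd j)))"
    proof -
      have "r ^ e = (\<Prod>v\<in>V. \<Prod>a<m v. r ^ m v)"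
        by (simp add: e_def power_sum power2_eq_square power_mult)
      also have "\<dots> \<le> (\<Prod>v\<in>V. \<Prod>a<m v. \<Prod>a'\<in>{..<m v} - {a}. norm (Z x v a' - Z x v a))"
      proof (intro prod_mono conjI prod_nonneg ballI)
        fix v a assume v: "v \<in> V" "a \<in> {..<m v}"
        have "r ^ m v \<le> r ^ card ({..<m v} - {a})"
          using r v by (intro power_decreasing) auto
        also have "\<dots> = (\<Prod>a'\<in>{..<m v} - {a}. r)" by simp
        also have "\<dots> \<le> (\<Prod>a'\<in>{..<m v} - {a}. norm (Z x v a' - Z x v a))"
        proof (intro prod_mono conjI)
          fix a' assume a': "a' \<in> {..<m v} - {a}"
          have "Z x v a' - Z x v a = x * of_int (int a' - int a)"
            by (simp add: Z_def algebra_simps)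
          hence "norm (Z x v a' - Z x v a) = r * real_of_int \<bar>int a' - int a\<bar>"
            by (simp add: norm_mult x norm_of_int del: of_int_diff)
          moreover have "\<bar>int a' - int a\<bar> \<ge> 1" using a' by auto
          hence "real_of_int \<bar>int a' - int a\<bar> \<ge> 1" by linarith
          hence "r * 1 \<le> r * real_of_int \<bar>int a' - int a\<bar>" using r by (intro mult_left_mono) auto
          ultimately show "r \<le> norm (Z x v a' - Z x v a)" by simp
        qed (use r in auto)
        finally show "r ^ m v \<le> (\<Prod>a'\<in>{..<m v} - {a}. norm (Z x v a' - Z x v a))" .
      qed (use r in auto)
      finally have "r ^ e * norm (\<Phi> x)
          \<le> (\<Prod>v\<in>V. \<Prod>a<m v. \<Prod>a'\<in>{..<m v} - {a}. norm (Z x v a' - Z x v a)) * norm (\<Phi> x)"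
        by (rule mult_right_mono) simp
      also have "\<dots> = (\<Prod>v\<in>V. \<Prod>a<m v. (\<Prod>a'\<in>{..<m v} - {a}. norm (Z x v a' - Z x v a))
            * (\<Prod>v'\<in>V - {v}. \<Prod>a'<m v'. norm (Z x v' a' - Z x v a)))"
        by (simp add: \<Phi>_def prod.distrib prod_norm)
      also have "\<dots> = (\<Prod>v\<in>V. \<Prod>a<m v. \<Prod>i\<in>I - {(v, a)}. norm (Z x (fst i) (snd i) - Z x v a))"
        unfolding I_def using fin
        by (intro prod.cong refl prod_Sigma_offdiag[symmetric, where f = "\<lambda>v' a'. norm (Z x v' a' - Z x _ _)"]) auto
      also have "\<dots> = (\<Prod>j\<in>I. \<Prod>i\<in>I - {j}. norm (Z x (fst i) (snd i) - Z x (fst j) (snd j)))"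
        using fin by (subst prod.Sigma) (auto simp: I_def case_prod_beta)
      finally show ?thesis .
    qed
    also have "\<dots> \<le> (fact N * (\<Prod>i\<in>I. max 1 (norm (Z x (fst i) (snd i)))) ^ (N - 1)) ^ 2"
      using prod_norm_differences_le[OF finI, of "\<lambda>i. Z x (fst i) (snd i)"] cardI by simp
    also have "\<dots> \<le> (real N ^ N * (Y * exp 1) ^ N) ^ 2"
    proof (intro power_mono mult_mono)
      show "fact N \<le> real N ^ N" using fact_le_power[of N, where 'a = real] by simp
      have "1 \<le> (\<Prod>i\<in>I. max 1 (norm (Z x (fst i) (snd i))))" by (intro prod_ge_1) auto
      hence "(\<Prod>i\<in>I. max 1 (norm (Z x (fst i) (snd i)))) ^ (N - 1)
          \<le> (\<Prod>i\<in>I. max 1 (norm (Z x (fst i) (snd i)))) ^ N" by (intro power_increasing) auto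
      also have "\<dots> \<le> (Y * exp 1) ^ N"
        by (intro power_mono upper[OF x] prod_nonneg) auto
      finally show "(\<Prod>i\<in>I. max 1 (norm (Z x (fst i) (snd i)))) ^ (N - 1) \<le> (Y * exp 1) ^ N" .
    qed (auto intro!: prod_nonneg zero_le_power mult_nonneg_nonneg)
    also have "\<dots> = U"
      by (simp add: U_def power_mult_distrib exp_of_nat_mult[symmetric] mult_ac)
    finally have "r ^ e * norm (\<Phi> x) \<le> U" .
    hence "(real k * real N) ^ e * (r ^ e * norm (\<Phi> x)) \<le> (real k * real N) ^ e * U"
      by (rule mult_left_mono) simp
    moreover have "(real k * real N) ^ e * r ^ e = 1"
      using k N(2) unfolding power_mult_distrib[symmetric] by (simp add: r_def)
    ultimately show ?thesis by (simp flip: mult.assoc)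
  qed
  have "norm (\<Phi> 0) \<le> (real k * real N) ^ e * U"
  proof (rule maximum_modulus_frontier[of \<Phi> "ball 0 r"])
    show "\<Phi> holomorphic_on interior (ball 0 r)"
      unfolding \<Phi>_def Z_def by (intro holomorphic_intros)
    show "continuous_on (closure (ball 0 r)) \<Phi>"
      unfolding \<Phi>_def Z_def by (intro continuous_intros)
    show "norm (\<Phi> z) \<le> (real k * real N) ^ e * U" if "z \<in> frontier (ball 0 r)" for z
      using that r by (intro bnd) (simp add: frontier_ball dist_norm)
  qed (use r in auto)
  also have "norm (\<Phi> 0) = (\<Prod>v\<in>V. \<Prod>v'\<in>V - {v}. norm (y v - y v') ^ (m v * m v'))"
    by (simp add: \<Phi>_def Z_def prod_norm[symmetric] prod_power_distrib power_mult[symmetric]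
        norm_minus_commute mult.commute norm_power)
  finally show ?thesis by (simp add: e_def U_def Y_def)
qed

text \<open>The nodes are the conjugates with multiplicity \<open>k\<close> and their
  \<open>p\<close>-th powers with multiplicity one. Pairs joining the two kinds, in both orders,
  contribute \<open>p^(D k)\<close> twice, while the losses carry the coefficients
  \<open>k^2 + card G\<close> and \<open>k + card G\<close>. The gain of order
  \<open>k * card G\<close> wins when \<open>k\<close> is large and \<open>card G\<close> is of
  order \<open>k^2\<close>.\<close>

lemma dobrowolski_inequality:
  assumes \<beta>: "algebraic_int \<beta>" "\<beta> \<noteq> 0" "\<And>n. n > 0 \<Longrightarrow> \<beta> ^ n \<noteq> 1"
    and G: "finite G" "\<And>p. p \<in> G \<Longrightarrow> prime p \<and> p \<le> P \<and> P < p ^ 2"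
    and good: "\<And>p b b'. p \<in> G \<Longrightarrow> b \<in> conjugates \<beta> \<Longrightarrow> b' \<in> conjugates \<beta> \<Longrightarrow> b \<noteq> b' \<Longrightarrow> b ^ p \<noteq> b' ^ p"
    and k: "k \<ge> 1" and P: "P \<ge> 1"
    and D: "D = card (conjugates \<beta>)" and N: "N = D * (k + card G)"
    and L: "L = (\<Sum>b\<in>conjugates \<beta>. ln (max 1 (norm b)))"
  shows "real D * real k * real (card G) * ln (real P)
           \<le> real D * (real k ^ 2 + real (card G)) * ln (real k * real N)
              + 2 * (real N * ln (real N) + real N + real N * (real k + real (card G) * real P) * L)"
proof -
  let ?C = "conjugates \<beta>"
  have alg: "algebraic \<beta>" using \<beta>(1) by auto
  have finC: "finite ?C" by (rule finite_conjugates[OF alg])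
  have D1: "D \<ge> 1" unfolding D by (rule card_conjugates_pos[OF alg])
  have N1: "N \<ge> 1" using D1 k by (simp add: N)
  have G1: "1 \<notin> G" using G(2) by fastforce
  define E where "E = insert 1 G"
  define m where "m = (\<lambda>e::nat. if e = 1 then k else 1)"
  define V where "V = E \<times> ?C"
  define s where "s = card G"
  define M where "M = (\<Prod>b\<in>?C. max 1 (norm b))"
  have M1: "M \<ge> 1" unfolding M_def by (intro prod_ge_1) auto
  have lnM: "ln M = L" unfolding M_def L using finC by (subst ln_prod) (auto simp: less_max_iff_disj)
  have finE: "finite E" using G by (simp add: E_def)
  have sumE: "(\<Sum>e\<in>E. f (m e) e) = f k 1 + (\<Sum>e\<in>G. f 1 e)" for f :: "nat \<Rightarrow> nat \<Rightarrow> nat"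
    using G(1) G1 unfolding E_def m_def by (auto intro!: sum.cong)
  define Q where "Q = (\<lambda>e e'. \<Prod>b\<in>?C. \<Prod>b'\<in>power_pairs \<beta> e e' b. norm (b ^ e - b' ^ e'))"
  \<comment> \<open>All nodes are distinct: for equal exponents because the primes are good, for
    different ones because a coincidence would make \<open>\<beta>\<close> a root of unity. Every
    block \<open>Q e e'\<close> is therefore at least 1.\<close>
  have meet: "b ^ e \<noteq> b' ^ e'"
    if b: "b \<in> ?C" "b' \<in> power_pairs \<beta> e e' b" and e: "e \<in> E" "e' \<in> E" for b b' e e'
  proof (cases "e = e'")
    case True
    hence "b' \<in> ?C" "b' \<noteq> b" using b(2) by (auto simp: power_pairs_def)
    thus ?thesis using good[of e b b'] b(1) e(1) True by (auto simp: E_def)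
  next
    case False
    hence "b' \<in> ?C" using b(2) by (simp add: power_pairs_def)
    thus ?thesis using root_of_unity_if_powers_meet[OF alg \<beta>(2) b(1) _ _ False, of b'] \<beta>(3) by blast
  qed
  have Q1: "Q e e' \<ge> 1" if "e \<in> E" "e' \<in> E" for e e'
    unfolding Q_def using meet that by (intro norm_prod_power_pairs_ge_1[OF \<beta>(1)]) blast
  have Qp: "Q p 1 \<ge> real p ^ D" "Q 1 p \<ge> real p ^ D" if p: "p \<in> G" for p
  proof -
    have pr: "prime p" "p \<noteq> 1" using G(2)[OF p] G1 p by auto
    have *: "(\<Prod>b\<in>?C. \<Prod>b'\<in>?C. norm (b ^ p - b')) \<ge> real p ^ D" unfolding D
    proof (rule norm_prod_prime_power_pairs_ge[OF \<beta>(1) pr(1)])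
      fix b b' assume "b \<in> ?C" "b' \<in> ?C"
      thus "b ^ p \<noteq> b'" using meet[of b b' p 1] p pr(2) by (auto simp: power_pairs_def E_def)
    qed
    show "Q p 1 \<ge> real p ^ D" using * pr(2) by (simp add: Q_def power_pairs_def)
    have "Q 1 p = (\<Prod>b\<in>?C. \<Prod>b'\<in>?C. norm (b' ^ p - b))"
      using pr(2) by (simp add: Q_def power_pairs_def norm_minus_commute)
    also have "\<dots> = (\<Prod>b\<in>?C. \<Prod>b'\<in>?C. norm (b ^ p - b'))" by (rule prod.swap)
    finally show "Q 1 p \<ge> real p ^ D" using * by simp
  qed
  have VE: "(\<Prod>v\<in>V. \<Prod>v'\<in>V - {v}. norm (snd v ^ fst v - snd v' ^ fst v') ^ (m (fst v) * m (fst v')))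
      = (\<Prod>e\<in>E. \<Prod>e'\<in>E. Q e e' ^ (m e * m e'))"
  proof -
    have inner: "(\<Prod>v'\<in>V - {(e, b)}. norm (b ^ e - snd v' ^ fst v') ^ (m e * m (fst v')))
        = (\<Prod>e'\<in>E. \<Prod>b'\<in>power_pairs \<beta> e e' b. norm (b ^ e - b' ^ e') ^ (m e * m e'))"
      if "e \<in> E" "b \<in> ?C" for e b
    proof -
      have "V - {(e, b)} = Sigma E (\<lambda>e'. power_pairs \<beta> e e' b)"
        by (auto simp: V_def power_pairs_def split: if_splits)
      moreover have "finite (power_pairs \<beta> e e' b)" for e' using finC by (simp add: power_pairs_def)
      ultimately show ?thesis using finE by (subst prod.Sigma) (auto simp: case_prod_beta)
    qed
    have "(\<Prod>v\<in>V. \<Prod>v'\<in>V - {v}. norm (snd v ^ fst v - snd v' ^ fst v') ^ (m (fst v) * m (fst v')))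
        = (\<Prod>e\<in>E. \<Prod>b\<in>?C. \<Prod>v'\<in>V - {(e, b)}. norm (b ^ e - snd v' ^ fst v') ^ (m e * m (fst v')))"
      unfolding V_def by (simp add: prod.cartesian_product case_prod_beta)
    also have "\<dots> = (\<Prod>e\<in>E. \<Prod>b\<in>?C. \<Prod>e'\<in>E. \<Prod>b'\<in>power_pairs \<beta> e e' b. norm (b ^ e - b' ^ e') ^ (m e * m e'))"
      by (intro prod.cong refl inner)
    also have "\<dots> = (\<Prod>e\<in>E. \<Prod>e'\<in>E. \<Prod>b\<in>?C. \<Prod>b'\<in>power_pairs \<beta> e e' b. norm (b ^ e - b' ^ e') ^ (m e * m e'))"
      by (intro prod.cong refl prod.swap)
    finally show ?thesis by (simp add: Q_def prod_power_distrib)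
  qed
  have lower: "(\<Prod>p\<in>G. real p ^ (D * k)) ^ 2 \<le> (\<Prod>e\<in>E. \<Prod>e'\<in>E. Q e e' ^ (m e * m e'))"
  proof -
    define F where "F = (\<lambda>e. \<Prod>e'\<in>E. Q e e' ^ (m e * m e'))"
    have F1: "F 1 \<ge> (\<Prod>p\<in>G. real p ^ (D * k))"
    proof -
      have "(\<Prod>p\<in>G. real p ^ (D * k)) \<le> (\<Prod>p\<in>G. Q 1 p ^ (m 1 * m p))"
      proof (intro prod_mono conjI)
        fix p assume p: "p \<in> G"
        have "real p ^ (D * k) = (real p ^ D) ^ k" by (simp add: power_mult)
        also have "\<dots> \<le> Q 1 p ^ k" using Qp(2)[OF p] by (intro power_mono) auto
        finally show "real p ^ (D * k) \<le> Q 1 p ^ (m 1 * m p)" using p G1 by (auto simp: m_def)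
      qed auto
      also have "\<dots> \<le> Q 1 1 ^ (m 1 * m 1) * (\<Prod>p\<in>G. Q 1 p ^ (m 1 * m p))"
      proof -
        have "1 \<le> Q 1 1 ^ (m 1 * m 1)" by (intro one_le_power Q1) (auto simp: E_def)
        moreover have "0 \<le> (\<Prod>p\<in>G. Q 1 p ^ (m 1 * m p))"
          by (intro prod_nonneg zero_le_power) (auto simp: Q_def intro!: prod_nonneg)
        ultimately show ?thesis using mult_right_mono by fastforce
      qed
      also have "\<dots> = F 1" using G(1) G1 by (simp add: F_def E_def)
      finally show ?thesis .
    qed
    have Fp: "F p \<ge> real p ^ (D * k)" if p: "p \<in> G" for p
    proof -
      have pE: "p \<in> E" using p by (simp add: E_def)
      have "real p ^ (D * k) = (real p ^ D) ^ k" by (simp add: power_mult)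
      also have "\<dots> \<le> Q p 1 ^ k" using Qp(1)[OF p] by (intro power_mono) auto
      also have "Q p 1 ^ k = Q p 1 ^ (m p * m 1)" using p G1 by (auto simp: m_def)
      also have "\<dots> \<le> Q p 1 ^ (m p * m 1) * (\<Prod>e'\<in>G. Q p e' ^ (m p * m e'))"
      proof -
        have "1 \<le> (\<Prod>e'\<in>G. Q p e' ^ (m p * m e'))"
          using pE by (intro prod_ge_1 one_le_power Q1) (auto simp: E_def)
        moreover have "0 \<le> Q p 1 ^ (m p * m 1)"
          by (intro zero_le_power) (auto simp: Q_def intro!: prod_nonneg)
        ultimately show ?thesis using mult_left_mono by fastforce
      qed
      also have "\<dots> = F p" using G(1) G1 by (simp add: F_def E_def)
      finally show ?thesis .
    qed
    have "(\<Prod>p\<in>G. real p ^ (D * k)) ^ 2 = (\<Prod>p\<in>G. real p ^ (D * k)) * (\<Prod>p\<in>G. real p ^ (D * k))"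
      by (simp add: power2_eq_square)
    also have "\<dots> \<le> F 1 * (\<Prod>p\<in>G. F p)"
    proof (rule mult_mono[OF F1])
      show "(\<Prod>p\<in>G. real p ^ (D * k)) \<le> (\<Prod>p\<in>G. F p)" using Fp by (intro prod_mono) auto
      show "0 \<le> F 1" by (rule order_trans[OF _ F1]) (intro prod_nonneg, auto)
    qed (intro prod_nonneg, auto)
    also have "\<dots> = (\<Prod>e\<in>E. F e)" using G(1) G1 by (simp add: E_def)
    finally show ?thesis by (simp add: F_def)
  qed
  have sumV: "(\<Sum>v\<in>V. f (fst v)) = D * (\<Sum>e\<in>E. f e)" for f :: "nat \<Rightarrow> nat"
  proof -
    have "(\<Sum>v\<in>V. f (fst v)) = (\<Sum>e\<in>E. \<Sum>b\<in>?C. f e)"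
      unfolding V_def by (subst sum.cartesian_product) (simp add: case_prod_beta)
    thus ?thesis by (simp add: D sum_distrib_left)
  qed
  have upper: "(\<Prod>v\<in>V. \<Prod>v'\<in>V - {v}. norm (snd v ^ fst v - snd v' ^ fst v') ^ (m (fst v) * m (fst v')))
     \<le> (real k * real N) ^ (\<Sum>v\<in>V. m (fst v) ^ 2) *
              (real N ^ N * exp (real N) * (\<Prod>v\<in>V. max 1 (norm (snd v ^ fst v)) ^ m (fst v)) ^ N) ^ 2"
  proof (rule confluent_vandermonde_bound)
    show "finite V" using finE finC by (simp add: V_def)
    show "m (fst v) \<le> k" for v using k by (simp add: m_def)
    show "N = (\<Sum>v\<in>V. m (fst v))" using sumV[of m] sumE[of "\<lambda>a b. a"] by (simp add: N)
  qed (use k N1 in auto)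
  have e2: "(\<Sum>v\<in>V. m (fst v) ^ 2) = D * (k ^ 2 + s)"
    using sumV[of "\<lambda>e. m e ^ 2"] sumE[of "\<lambda>a b. a ^ 2"] by (simp add: s_def)
  have YM: "(\<Prod>v\<in>V. max 1 (norm (snd v ^ fst v)) ^ m (fst v)) = M ^ (\<Sum>e\<in>E. m e * e)"
  proof -
    have "(\<Prod>v\<in>V. max 1 (norm (snd v ^ fst v)) ^ m (fst v)) = (\<Prod>e\<in>E. \<Prod>b\<in>?C. max 1 (norm (b ^ e)) ^ m e)"
      unfolding V_def by (simp add: prod.cartesian_product case_prod_beta)
    also have "\<dots> = (\<Prod>e\<in>E. M ^ (m e * e))"
    proof (intro prod.cong refl)
      fix e assume e: "e \<in> E"
      have "max 1 (norm (b ^ e)) = max 1 (norm b) ^ e" for b :: complex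
        using power_le_one[of "norm b" e] one_le_power[of "norm b" e] by (auto simp: norm_power max_def)
      thus "(\<Prod>b\<in>?C. max 1 (norm (b ^ e)) ^ m e) = M ^ (m e * e)"
        by (simp add: M_def prod_power_distrib power_mult[symmetric] mult.commute)
    qed
    finally show ?thesis by (simp add: power_sum)
  qed
  have "(\<Sum>e\<in>E. m e * e) = k + \<Sum>G" using sumE[of "\<lambda>a b. a * b"] by simp
  also have "\<Sum>G \<le> s * P" unfolding s_def using G(2) by (intro sum_bounded_above[where K = P, simplified]) auto
  finally have eM: "(\<Sum>e\<in>E. m e * e) \<le> k + s * P" by simp
  have tot: "(\<Prod>p\<in>G. real p ^ (D * k)) ^ 2
      \<le> (real k * real N) ^ (D * (k ^ 2 + s)) * (real N ^ N * exp (real N) * M ^ ((k + s * P) * N)) ^ 2"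
  proof -
    have "(\<Prod>p\<in>G. real p ^ (D * k)) ^ 2 \<le> (real k * real N) ^ (D * (k ^ 2 + s)) *
              (real N ^ N * exp (real N) * (M ^ (\<Sum>e\<in>E. m e * e)) ^ N) ^ 2"
      using lower upper unfolding VE e2 YM by linarith
    also have "\<dots> \<le> (real k * real N) ^ (D * (k ^ 2 + s)) * (real N ^ N * exp (real N) * M ^ ((k + s * P) * N)) ^ 2"
      unfolding power_mult[of M, symmetric] using M1 eM
      by (intro mult_left_mono power_mono power_increasing mult_right_mono) auto
    finally show ?thesis .
  qed
  have pos: "real k * real N > 0" "real N > 0" "M > 0" using k N1 M1 by auto
  have pG: "real p > 0" if "p \<in> G" for p using G(2)[OF that] prime_gt_0_nat by auto
  have prodpos: "(\<Prod>p\<in>G. real p ^ (D * k)) > 0" by (intro prod_pos zero_less_power pG)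
  have "ln ((\<Prod>p\<in>G. real p ^ (D * k)) ^ 2)
      \<le> ln ((real k * real N) ^ (D * (k ^ 2 + s)) * (real N ^ N * exp (real N) * M ^ ((k + s * P) * N)) ^ 2)"
    by (rule ln_mono[OF tot zero_less_power[OF prodpos]])
  also have "\<dots> = real (D * (k ^ 2 + s)) * ln (real k * real N) + 2 * (real N * ln (real N) + real N + real ((k + s * P) * N) * L)"
  proof -
    have "ln ((real N ^ N * exp (real N) * M ^ ((k + s * P) * N)) ^ 2)
        = 2 * (real N * ln (real N) + real N + real ((k + s * P) * N) * L)"
      using pos by (simp add: ln_realpow ln_mult lnM[symmetric])
    moreover have "real N ^ N * exp (real N) * M ^ ((k + s * P) * N) > 0" using pos by simp
    hence "(real N ^ N * exp (real N) * M ^ ((k + s * P) * N)) ^ 2 > 0" by (rule zero_less_power)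
    moreover have "(real k * real N) ^ (D * (k ^ 2 + s)) > 0" using pos(1) by (rule zero_less_power)
    ultimately show ?thesis
      by (subst ln_mult_pos) (simp_all only: ln_realpow)
  qed
  also have "ln ((\<Prod>p\<in>G. real p ^ (D * k)) ^ 2) = 2 * (\<Sum>p\<in>G. real (D * k) * ln (real p))"
  proof -
    have "ln ((\<Prod>p\<in>G. real p ^ (D * k)) ^ 2) = 2 * ln (\<Prod>p\<in>G. real p ^ (D * k))"
      using prodpos by (subst ln_realpow) auto
    also have "ln (\<Prod>p\<in>G. real p ^ (D * k)) = (\<Sum>p\<in>G. ln (real p ^ (D * k)))"
      using G(1) pG by (intro ln_prod) auto
    also have "\<dots> = (\<Sum>p\<in>G. real (D * k) * ln (real p))"
      using pG by (intro sum.cong refl ln_realpow)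
    finally show ?thesis .
  qed
  finally have fin: "2 * (\<Sum>p\<in>G. real (D * k) * ln (real p))
      \<le> real (D * (k ^ 2 + s)) * ln (real k * real N) + 2 * (real N * ln (real N) + real N + real ((k + s * P) * N) * L)" .
  \<comment> \<open>Here \<open>P < p ^ 2\<close> is used; the resulting 1/2 cancels against the
    factor 2 from counting both orders.\<close>
  have "real (D * k) * (real s * (ln (real P) / 2)) \<le> (\<Sum>p\<in>G. real (D * k) * ln (real p))"
  proof -
    have "ln (real P) / 2 \<le> ln (real p)" if p: "p \<in> G" for p
    proof -
      have "real P \<le> real p ^ 2" using G(2)[OF p] by (metis less_imp_le of_nat_le_iff of_nat_power)
      hence "ln (real P) \<le> ln (real p ^ 2)" using P pG[OF p] by (subst ln_le_cancel_iff) auto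
      thus ?thesis using pG[OF p] by (simp add: ln_realpow)
    qed
    hence "(\<Sum>p\<in>G. real (D * k) * (ln (real P) / 2)) \<le> (\<Sum>p\<in>G. real (D * k) * ln (real p))"
      by (intro sum_mono mult_left_mono) auto
    thus ?thesis by (simp add: s_def mult_ac)
  qed
  with fin show ?thesis by (simp add: s_def algebra_simps)
qed

text \<open>For degrees near \<open>P ^ J\<close> the bound \<open>c / P\<close> is of order
  \<open>D^(-1/J)\<close>. Since the logarithm of the degree is at most \<open>J\<close> times
  \<open>ln P\<close>, a number of primes depending on \<open>J\<close> alone is enough.\<close>

theorem dobrowolski_weak:
  fixes J :: nat
  shows "\<exists>c>0. \<exists>P0. \<forall>P\<ge>P0. \<forall>\<beta>. algebraic_int \<beta> \<longrightarrow> \<beta> \<noteq> 0 \<longrightarrow> (\<forall>n>0. \<beta> ^ n \<noteq> 1) \<longrightarrow>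
           card (conjugates \<beta>) \<le> P ^ J \<longrightarrow>
           c / real P \<le> (\<Sum>b\<in>conjugates \<beta>. ln (max 1 (norm b)))"
proof -
  \<comment> \<open>With \<open>x = (J + 2) ln P\<close> bounding the logarithms, the losses without
    \<open>L\<close> are at most \<open>2 (k^2 + k + 2 s) x\<close>, which is \<open>6 s x\<close>
    for \<open>s = k^2 + k\<close>. As \<open>k\<close> exceeds \<open>6 (J + 2)\<close> by one,
    exactly \<open>s ln P\<close> of the main term \<open>k s ln P\<close> survives.\<close>
  define k :: nat where "k = 6 * (J + 2) + 1"
  define s :: nat where "s = k ^ 2 + k"
  define c where "c = real s / (2 * (real k + real s) ^ 2)"
  have k1: "k \<ge> 1" and s1: "s \<ge> 1" by (auto simp: k_def s_def)
  have c0: "c > 0" using k1 s1 by (simp add: c_def)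
  have "eventually (\<lambda>P::nat. real s + (real J / ln 2) * ln (real P)
      \<le> real (card {p. prime p \<and> p \<le> P \<and> P < p ^ 2})) at_top"
    by (rule eventually_many_large_primes)
  moreover have "eventually (\<lambda>P::nat. P \<ge> max 3 (k + s)) at_top" by (rule eventually_ge_at_top)
  ultimately have "eventually (\<lambda>P::nat. real s + (real J / ln 2) * ln (real P)
      \<le> real (card {p. prime p \<and> p \<le> P \<and> P < p ^ 2}) \<and> P \<ge> max 3 (k + s)) at_top"
    by (rule eventually_conj)
  then obtain P0 where P0: "\<And>P. P \<ge> P0 \<Longrightarrow> real s + (real J / ln 2) * ln (real P)
      \<le> real (card {p. prime p \<and> p \<le> P \<and> P < p ^ 2}) \<and> P \<ge> max 3 (k + s)"
    unfolding eventually_at_top_linorder by blast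
  have "c / real P \<le> (\<Sum>b\<in>conjugates \<beta>. ln (max 1 (norm b)))"
    if PP: "P \<ge> P0" and \<beta>: "algebraic_int \<beta>" "\<beta> \<noteq> 0" "\<forall>n>0. \<beta> ^ n \<noteq> 1"
      and D: "card (conjugates \<beta>) \<le> P ^ J" for P \<beta>
  proof -
    have alg: "algebraic \<beta>" using \<beta>(1) by auto
    define A where "A = {p. prime p \<and> p \<le> P \<and> P < p ^ 2}"
    define bad where "bad = {p \<in> A. \<exists>b\<in>conjugates \<beta>. \<exists>b'\<in>conjugates \<beta>. b \<noteq> b' \<and> b ^ p = b' ^ p}"
    define L where "L = (\<Sum>b\<in>conjugates \<beta>. ln (max 1 (norm b)))"
    define D' where "D' = card (conjugates \<beta>)"
    have finA: "finite A" by (rule finite_subset[of _ "{..P}"]) (auto simp: A_def)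
    have P3: "P \<ge> 3" "P \<ge> k + s" using P0[OF PP] by auto
    have D1: "D' \<ge> 1" unfolding D'_def by (rule card_conjugates_pos[OF alg])
    \<comment> \<open>At most \<open>J ln P / ln 2\<close> primes are bad, which is the reserve
      included in the prime count; at least \<open>s\<close> good primes remain.\<close>
    have "2 ^ card bad \<le> card (conjugates \<beta>)"
      by (rule card_bad_primes[OF alg \<beta>(2)]) (use finA in \<open>auto simp: bad_def A_def\<close>)
    hence "2 ^ card bad \<le> P ^ J" using D by linarith
    hence "real (2 ^ card bad) \<le> real (P ^ J)" by (subst of_nat_le_iff)
    hence "ln (2 ^ card bad) \<le> ln (real P ^ J)" using P3 by (subst ln_le_cancel_iff) auto
    hence "real (card bad) * ln 2 \<le> real J * ln (real P)" using P3 by (simp add: ln_realpow)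
    hence "real (card bad) \<le> (real J / ln 2) * ln (real P)" by (simp add: field_simps)
    moreover have "real s + (real J / ln 2) * ln (real P) \<le> real (card A)"
      using P0[OF PP] by (simp add: A_def)
    moreover have "bad \<subseteq> A" by (auto simp: bad_def)
    hence "card (A - bad) = card A - card bad" using finA by (intro card_Diff_subset) (auto intro: finite_subset)
    ultimately have "s \<le> card (A - bad)" by linarith
    then obtain G where G: "G \<subseteq> A - bad" "card G = s" "finite G"
      by (metis obtain_subset_with_card_n)
    define N where "N = D' * (k + card G)"
    have "real D' * real k * real (card G) * ln (real P)
           \<le> real D' * (real k ^ 2 + real (card G)) * ln (real k * real N)
              + 2 * (real N * ln (real N) + real N + real N * (real k + real (card G) * real P) * L)"
    proof (rule dobrowolski_inequality[OF \<beta>(1,2)])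
      show "\<And>n. n > 0 \<Longrightarrow> \<beta> ^ n \<noteq> 1" using \<beta>(3) by blast
      show "finite G" by fact
      show "\<And>p. p \<in> G \<Longrightarrow> prime p \<and> p \<le> P \<and> P < p ^ 2" using G(1) by (auto simp: A_def)
      show "\<And>p b b'. p \<in> G \<Longrightarrow> b \<in> conjugates \<beta> \<Longrightarrow> b' \<in> conjugates \<beta> \<Longrightarrow> b \<noteq> b' \<Longrightarrow> b ^ p \<noteq> b' ^ p"
        using G(1) by (auto simp: bad_def)
    qed (use k1 P3 in \<open>auto simp: N_def D'_def L_def\<close>)
    hence ineq: "real D' * real k * real s * ln (real P)
           \<le> real D' * (real k ^ 2 + real s) * ln (real k * real N)
              + 2 * (real N * ln (real N) + real N + real N * (real k + real s * real P) * L)"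
      by (simp add: G(2))
    have N: "N = D' * (k + s)" by (simp add: N_def G(2))
    have Nk: "N \<ge> k" using mult_le_mono[OF D1, of k "k + s"] by (simp add: N)
    have N1: "N \<ge> 1" using Nk k1 by linarith
    have L0: "L \<ge> 0" unfolding L_def by (intro sum_nonneg) auto
    define lP where "lP = ln (real P)"
    have lP1: "lP \<ge> 1"
    proof -
      have "exp 1 \<le> (3::real)" using exp_le by simp
      hence "exp 1 \<le> real P" using P3 by linarith
      thus ?thesis unfolding lP_def using P3 by (simp add: ln_ge_iff)
    qed
    have lN: "ln (real N) \<le> real (J + 1) * lP"
    proof -
      have "N \<le> P ^ J * P" unfolding N using D P3 by (intro mult_mono) (auto simp: D'_def)
      hence "real N \<le> real P ^ (J + 1)" by (metis of_nat_le_iff of_nat_power power_add power_one_right)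
      hence "ln (real N) \<le> ln (real P ^ (J + 1))" using N1 P3 by (subst ln_le_cancel_iff) auto
      thus ?thesis using P3 by (simp add: ln_realpow lP_def del: power_Suc)
    qed
    have lN0: "ln (real N) \<ge> 0" using N1 by simp
    have lkN: "ln (real k * real N) \<le> 2 * ln (real N)"
    proof -
      have "ln (real k * real N) = ln (real k) + ln (real N)" using k1 N1 by (simp add: ln_mult)
      moreover have "ln (real k) \<le> ln (real N)" using k1 Nk by (subst ln_le_cancel_iff) auto
      ultimately show ?thesis by simp
    qed
    define x where "x = real (J + 2) * lP"
    have lNx: "ln (real N) \<le> x" "ln (real N) + 1 \<le> x"
      using lN lP1 by (auto simp: x_def algebra_simps)
    have rN: "real N = real D' * (real k + real s)" by (simp add: N)
    have "real D' * real k * real s * lP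
       \<le> real D' * (real k ^ 2 + real s) * (2 * x) + 2 * (real N * x + real N * (real k + real s * real P) * L)"
    proof -
      have "real D' * (real k ^ 2 + real s) * ln (real k * real N) \<le> real D' * (real k ^ 2 + real s) * (2 * x)"
        using lkN lNx by (intro mult_left_mono) auto
      moreover have "real N * ln (real N) + real N \<le> real N * x"
        using mult_left_mono[OF lNx(2), of "real N"] by (simp add: distrib_left)
      hence "2 * (real N * ln (real N) + real N + real N * (real k + real s * real P) * L)
          \<le> 2 * (real N * x + real N * (real k + real s * real P) * L)" by simp
      ultimately show ?thesis by (intro order_trans[OF ineq[folded lP_def]] add_mono)
    qed
    also have "\<dots> = real D' * ((real k ^ 2 + real s) * (2 * x) + 2 * (real k + real s) * (x + (real k + real s * real P) * L))"
      unfolding rN by (simp add: algebra_simps)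
    finally have "real D' * (real k * real s * lP)
        \<le> real D' * ((real k ^ 2 + real s) * (2 * x) + 2 * (real k + real s) * (x + (real k + real s * real P) * L))"
      by (simp only: mult.assoc)
    hence "real k * real s * lP
        \<le> (real k ^ 2 + real s) * (2 * x) + 2 * (real k + real s) * (x + (real k + real s * real P) * L)"
      using D1 by (subst (asm) mult_le_cancel_left_pos) auto
    also have "\<dots> = 2 * (real k ^ 2 + real k + 2 * real s) * x + 2 * (real k + real s) * ((real k + real s * real P) * L)"
      by (simp add: algebra_simps)
    also have "real k ^ 2 + real k + 2 * real s = 3 * real s" by (simp add: s_def)
    finally have "real k * real s * lP - 6 * real s * x \<le> 2 * (real k + real s) * ((real k + real s * real P) * L)" by simp
    moreover have "real k * real s * lP - 6 * real s * x = real s * lP"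
      by (simp add: k_def x_def algebra_simps)
    ultimately have "real s * lP \<le> 2 * (real k + real s) * ((real k + real s * real P) * L)" by simp
    also have "\<dots> \<le> 2 * (real k + real s) * (((real k + real s) * real P) * L)"
      using L0 P3 mult_left_mono[of 1 "real P" "real k"]
      by (intro mult_left_mono mult_right_mono) (auto simp: distrib_right)
    finally have "real s * lP \<le> 2 * (real k + real s) ^ 2 * real P * L"
      by (simp only: power2_eq_square mult_ac)
    moreover have "real s * 1 \<le> real s * lP" using lP1 by (intro mult_left_mono) auto
    ultimately have "real s \<le> 2 * (real k + real s) ^ 2 * (real P * L)" by simp
    hence "c \<le> real P * L" unfolding c_def using k1 by (simp add: divide_le_eq mult.commute)
    thus ?thesis using P3 by (simp add: L_def[symmetric] field_simps)
  qed
  thus ?thesis using c0 by blast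
qed

section \<open>Orders of roots of unity\<close>

text \<open>The derivative of \<open>X^w - 1\<close> at the root \<open>z\<close>, computed in two
  ways.\<close>

lemma prod_differences_roots_of_unity:
  fixes z :: complex
  assumes w: "w > 0" and z: "z ^ w = 1"
  shows "(\<Prod>\<zeta>\<in>{\<zeta>. \<zeta> ^ w = 1} - {z}. z - \<zeta>) = of_nat w * z ^ (w - 1)"
    and "finite {\<zeta> :: complex. \<zeta> ^ w = 1}"
proof -
  define p :: "complex poly" where "p = monom 1 w - 1"
  have poly_p: "poly p x = x ^ w - 1" for x by (simp add: p_def poly_monom)
  have pderiv_p: "poly (pderiv p) x = of_nat w * x ^ (w - 1)" for x
    by (simp add: p_def pderiv_diff pderiv_monom poly_monom)
  have cw: "coeff p w = 1" using w by (simp add: p_def)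
  have "degree p \<le> w" unfolding p_def by (intro degree_diff_le) (auto simp: degree_monom_eq)
  hence deg: "degree p = w" using le_degree[of p w] cw by simp
  have p0: "p \<noteq> 0" using cw by auto
  have roots: "{x. poly p x = 0} = {\<zeta>. \<zeta> ^ w = 1}" by (simp add: poly_p)
  show fin: "finite {\<zeta> :: complex. \<zeta> ^ w = 1}" using poly_roots_finite[OF p0] roots by simp
  have "rsquarefree p"
    unfolding rsquarefree_roots pderiv_p poly_p using w by (auto simp: power_0_left)
  from complex_poly_decompose_rsquarefree[OF this] have "p = (\<Prod>\<zeta>\<in>{\<zeta>. \<zeta> ^ w = 1}. [:- \<zeta>, 1:])"
    using cw deg roots by simp
  thus "(\<Prod>\<zeta>\<in>{\<zeta>. \<zeta> ^ w = 1} - {z}. z - \<zeta>) = of_nat w * z ^ (w - 1)"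
    using poly_pderiv_prod_linear[OF fin, of z "\<lambda>x. x"] z pderiv_p[of z] by simp
qed

text \<open>The classical argument for cyclotomic irreducibility. Let \<open>f\<close> have the
  conjugates as roots. If \<open>z = b ^ p\<close> were not one of them, \<open>f(z)\<close> would
  divide the product of all differences \<open>z - \<zeta>\<close>, which is \<open>w\<close> up to
  a unit. But \<open>p\<close> divides \<open>f(z)\<close> by the Frobenius congruence, so
  \<open>p\<close> would divide \<open>w\<close>.\<close>

lemma root_of_unity_conjugate_prime_power:
  assumes \<beta>: "\<beta> ^ w = 1" "w > 0" and p: "prime p" "\<not> p dvd w" and b: "b \<in> conjugates \<beta>"
  shows "b ^ p \<in> conjugates \<beta>"
proof (rule ccontr)
  assume nin: "b ^ p \<notin> conjugates \<beta>"
  let ?C = "conjugates \<beta>"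
  have ai: "algebraic_int x" if "x ^ w = 1" for x :: complex
  proof -
    have "algebraic_int (x ^ w)" using that by simp
    thus ?thesis using \<beta>(2) algebraic_int_root[of "x ^ w" "monom 1 w" x]
      by (simp add: poly_monom degree_monom_eq)
  qed
  have ai\<beta>: "algebraic_int \<beta>" by (rule ai[OF \<beta>(1)])
  have alg: "algebraic \<beta>" using ai\<beta> by auto
  have fin: "finite ?C" by (rule finite_conjugates[OF alg])
  have conj1: "x ^ w = 1" if "x \<in> ?C" for x
  proof -
    have "poly (map_poly of_rat (monom 1 w + [:-1:])) \<beta> = 0"
      using \<beta> by (simp only: poly_of_rat_add poly_of_rat_const of_rat_hom.map_poly_hom_monom poly_monom) simp
    hence "poly (map_poly of_rat (monom 1 w + [:-1:])) x = 0" by (rule conjugatesD[OF alg that])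
    thus ?thesis
      by (simp only: poly_of_rat_add poly_of_rat_const of_rat_hom.map_poly_hom_monom poly_monom)
        (simp add: eq_neg_iff_add_eq_0)
  qed
  define R where "R = {\<zeta> :: complex. \<zeta> ^ w = 1}"
  define z where "z = b ^ p"
  have z: "z ^ w = 1" using conj1[OF b] by (simp add: z_def power_commuting_commutes flip: power_mult) (metis mult.commute power_mult power_one)
  have finR: "finite R" unfolding R_def by (rule prod_differences_roots_of_unity(2)[OF \<beta>(2) z])
  have sub: "?C \<subseteq> R - {z}" using conj1 nin by (auto simp: R_def z_def)
  have p0: "(of_nat p :: complex) \<noteq> 0" using prime_gt_0_nat[OF p(1)] by simp
  obtain f where ev: "\<And>x. poly (map_poly of_int f) x = (\<Prod>b\<in>?C. x - b)"
    using int_poly_conjugates[OF ai\<beta>] by blast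
  have "poly (map_poly of_int f) b = 0" unfolding ev using b fin by auto
  hence "algebraic_int ((\<Prod>b'\<in>?C. z - b') / of_nat p)"
    using algebraic_int_frobenius[OF p(1) ai[OF conj1[OF b]], of f] prime_gt_0_nat[OF p(1)]
    by (simp add: ev[symmetric] zero_power z_def)
  moreover have "algebraic_int (\<Prod>\<zeta>\<in>R - {z} - ?C. z - \<zeta>)"
    by (intro algebraic_int_prod algebraic_int_diff ai z) (auto simp: R_def)
  ultimately have "algebraic_int ((\<Prod>b'\<in>?C. z - b') / of_nat p * (\<Prod>\<zeta>\<in>R - {z} - ?C. z - \<zeta>) * z)"
    using ai[OF z] by (intro algebraic_int_mult)
  also have "(\<Prod>b'\<in>?C. z - b') / of_nat p * (\<Prod>\<zeta>\<in>R - {z} - ?C. z - \<zeta>) * z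
      = (\<Prod>\<zeta>\<in>R - {z}. z - \<zeta>) * z / of_nat p"
    using prod.subset_diff[OF sub, of "\<lambda>\<zeta>. z - \<zeta>"] finR by simp
  also have "\<dots> = of_nat w * (z ^ (w - 1) * z) / of_nat p"
    using prod_differences_roots_of_unity(1)[OF \<beta>(2) z] by (simp add: R_def)
  also have "z ^ (w - 1) * z = 1" using z \<beta>(2) by (metis mult.commute power_eq_if not_gr_zero)
  finally have "algebraic_int (of_nat w / of_nat p :: complex)" by simp
  hence "(of_nat w / of_nat p :: complex) \<in> \<int>" by (rule rational_algebraic_int_is_int) auto
  then obtain j :: int where "of_nat w / of_nat p = (of_int j :: complex)" by (elim Ints_cases)
  hence "(of_nat w :: complex) = of_int j * of_nat p" using p0 by (simp add: field_simps)
  hence "(of_int (int w) :: complex) = of_int (j * int p)" by simp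
  hence "int w = j * int p" by (simp only: of_int_eq_iff)
  hence "int p dvd int w" by simp
  thus False using p(2) by simp
qed

text \<open>An exponent coprime to \<open>w\<close> is a product of primes not dividing
  \<open>w\<close>, and each prime step stays among the conjugates.\<close>

lemma totient_le_card_conjugates:
  assumes \<beta>: "\<beta> ^ w = 1" "w > 0" and min: "\<And>j. 0 < j \<Longrightarrow> j < w \<Longrightarrow> \<beta> ^ j \<noteq> 1"
    and alg: "algebraic \<beta>"
  shows "totient w \<le> card (conjugates \<beta>)"
proof -
  have conj: "\<beta> ^ e \<in> conjugates \<beta>" if "coprime e w" "e > 0" for e
    using that
  proof (induction e rule: less_induct)
    case (less e)
    show ?case
    proof (cases "e = 1")
      case True
      thus ?thesis using self_in_conjugates[OF alg] by simp
    next
      case False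
      then obtain p where p: "prime p" "p dvd e" using prime_factor_nat by blast
      then obtain e' where e: "e = p * e'" by (elim dvdE)
      have "\<not> p dvd w" using less.prems(1) p by (meson coprime_common_divisor not_prime_unit)
      moreover have "\<beta> ^ e' \<in> conjugates \<beta>"
      proof (rule less.IH)
        show "e' < e" using e less.prems(2) prime_gt_1_nat[OF p(1)] by simp
        show "coprime e' w" using less.prems(1) e by simp
        show "e' > 0" using e less.prems(2) by simp
      qed
      ultimately have "(\<beta> ^ e') ^ p \<in> conjugates \<beta>"
        using root_of_unity_conjugate_prime_power[OF \<beta> p(1)] by blast
      thus ?thesis by (simp add: e mult.commute flip: power_mult)
    qed
  qed
  have "inj_on (\<lambda>e. \<beta> ^ e) (totatives w)"
  proof (rule linorder_inj_onI')
    fix i j assume ij: "i \<in> totatives w" "j \<in> totatives w" "i < j"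
    have \<beta>0: "\<beta> \<noteq> 0" using \<beta> by (auto simp: power_0_left)
    have "\<beta> ^ j = \<beta> ^ i * \<beta> ^ (j - i)" using ij(3) by (simp flip: power_add)
    moreover have "j - i < w" using ij by (auto simp: totatives_def)
    hence "\<beta> ^ (j - i) \<noteq> 1" using ij(3) by (intro min) auto
    ultimately show "\<beta> ^ i \<noteq> \<beta> ^ j" using \<beta>0 by simp
  qed
  moreover have "(\<lambda>e. \<beta> ^ e) ` totatives w \<subseteq> conjugates \<beta>"
    using conj by (auto simp: totatives_def)
  ultimately show ?thesis
    unfolding totient_def by (rule card_inj_on_le) (rule finite_conjugates[OF alg])
qed

lemma one_divide_nat_le_one: "1 / real n \<le> 1"
  by (cases "n = 0") simp_all

text \<open>Since \<open>w\<close> is at least the product of its prime factors,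
  \<open>\<phi>(w)^3 / w^2\<close> is at least the product of the factors
  \<open>p (1 - 1/p)^3\<close>. Only \<open>p = 2\<close> and \<open>p = 3\<close> give less than 1,
  namely 1/4 and 8/9, with product 2/9. The cube is what yields orders of size
  \<open>D^(3/2)\<close>.\<close>

lemma totient_cube_lower:
  assumes "w > 0"
  shows "2 * real w ^ 2 \<le> 9 * real (totient w) ^ 3"
proof -
  let ?P = "prime_factors w"
  define g :: "nat \<Rightarrow> real" where "g = (\<lambda>p. if p = 2 then 1 / 4 else if p = 3 then 8 / 9 else 1)"
  define f :: "nat \<Rightarrow> real" where "f = (\<lambda>p. real p * (1 - 1 / real p) ^ 3)"
  have fg: "g p \<le> f p" if "p \<in> ?P" for p
  proof -
    have p: "p \<ge> 2" using that prime_ge_2_nat by auto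
    show ?thesis
    proof (cases "p \<ge> 4")
      case True
      hence "1 / real p \<le> 1 / 4" by (simp add: field_simps)
      hence "(3 / 4) ^ 3 \<le> (1 - 1 / real p) ^ 3" by (intro power_mono) auto
      hence "4 * (3 / 4) ^ 3 \<le> real p * (1 - 1 / real p) ^ 3" using True by (intro mult_mono) auto
      moreover have "(1::real) \<le> 4 * (3 / 4) ^ 3" by (simp add: power3_eq_cube)
      ultimately have "1 \<le> real p * (1 - 1 / real p) ^ 3" by (rule order_trans[rotated])
      thus ?thesis using True by (simp add: g_def f_def)
    next
      case False
      hence "p = 2 \<or> p = 3" using p by auto
      thus ?thesis by (auto simp: g_def f_def power3_eq_cube)
    qed
  qed
  have "2 / 9 = (\<Prod>p\<in>{2, 3}. g p)" by (simp add: g_def)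
  also have "\<dots> \<le> (\<Prod>p\<in>?P \<inter> {2, 3}. g p)"
  proof -
    have "(\<Prod>p\<in>{2, 3}. g p) = (\<Prod>p\<in>{2, 3} - ?P \<inter> {2, 3}. g p) * (\<Prod>p\<in>?P \<inter> {2, 3}. g p)"
      by (rule prod.subset_diff) auto
    also have "\<dots> \<le> 1 * (\<Prod>p\<in>?P \<inter> {2, 3}. g p)"
      by (intro mult_right_mono prod_le_1 prod_nonneg) (auto simp: g_def)
    finally show ?thesis by simp
  qed
  also have "\<dots> = (\<Prod>p\<in>?P. g p)"
    by (rule prod.mono_neutral_left) (auto simp: g_def)
  also have "\<dots> \<le> (\<Prod>p\<in>?P. f p)" using fg by (intro prod_mono) (auto simp: g_def)
  also have "\<dots> = (\<Prod>p\<in>?P. real p) * (\<Prod>p\<in>?P. 1 - 1 / real p) ^ 3"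
    by (simp add: f_def prod.distrib prod_power_distrib)
  also have "\<dots> \<le> real w * (\<Prod>p\<in>?P. 1 - 1 / real p) ^ 3"
  proof (rule mult_right_mono)
    have "(\<Prod>p\<in>?P. p) \<le> (\<Prod>p\<in>?P. p ^ multiplicity p w)"
    proof (rule prod_mono)
      fix p assume p: "p \<in> ?P"
      hence "multiplicity p w \<ge> 1" by (simp add: prime_factors_multiplicity Suc_le_eq)
      moreover have "p \<ge> 1" using p prime_gt_0_nat by (simp add: Suc_le_eq in_prime_factors_imp_prime)
      ultimately show "0 \<le> p \<and> p \<le> p ^ multiplicity p w" using power_increasing[of 1 "multiplicity p w" p] by simp
    qed
    also have "\<dots> = w" using assms by (simp add: prime_factorization_nat[symmetric])
    finally have "real (\<Prod>p\<in>?P. p) \<le> real w" by (subst of_nat_le_iff)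
    thus "(\<Prod>p\<in>?P. real p) \<le> real w" by simp
    show "0 \<le> (\<Prod>p\<in>?P. 1 - 1 / real p) ^ 3"
      by (intro zero_le_power prod_nonneg) (simp add: one_divide_nat_le_one)
  qed
  finally have "2 / 9 * real w ^ 2 \<le> real w * (\<Prod>p\<in>?P. 1 - 1 / real p) ^ 3 * real w ^ 2"
    by (rule mult_right_mono) simp
  also have "\<dots> = (real w * (\<Prod>p\<in>?P. 1 - 1 / real p)) ^ 3"
    by (simp add: power3_eq_cube power2_eq_square mult_ac)
  also have "\<dots> = real (totient w) ^ 3" by (simp add: totient_formula2)
  finally show ?thesis by simp
qed

lemma root_of_unity_order_bound:
  assumes \<beta>: "\<beta> ^ n = 1" "n > 0" and alg: "algebraic \<beta>" and D: "card (conjugates \<beta>) \<le> D"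
  obtains w where "w > 0" "\<beta> ^ w = 1" "real w ^ 2 \<le> 9 * real D ^ 3"
proof -
  define w where "w = (LEAST w. w > 0 \<and> \<beta> ^ w = 1)"
  have w: "w > 0 \<and> \<beta> ^ w = 1" unfolding w_def by (rule LeastI[of _ n]) (use \<beta> in auto)
  have "\<beta> ^ j \<noteq> 1" if "0 < j" "j < w" for j
    using not_less_Least[of j "\<lambda>w. w > 0 \<and> \<beta> ^ w = 1"] that by (auto simp: w_def)
  hence "totient w \<le> D" using totient_le_card_conjugates[of \<beta> w] w alg D by (meson order_trans)
  hence "real (totient w) ^ 3 \<le> real D ^ 3" by (intro power_mono) auto
  moreover have "2 * real w ^ 2 \<le> 9 * real (totient w) ^ 3" using w by (intro totient_cube_lower) simp
  moreover have "real w ^ 2 \<ge> 0" by simp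
  ultimately have "real w ^ 2 \<le> 9 * real D ^ 3" by linarith
  thus ?thesis using that w by blast
qed

section \<open>Logarithmic forms\<close>

text \<open>The tail is dominated by a geometric series of ratio at most 1/2. The term at
  \<open>j = 0\<close> is zero because of the division by zero, so the sum may start there.\<close>

lemma norm_Ln_Taylor_le:
  fixes z :: complex
  assumes "norm z \<le> 1 / 2"
  shows "norm (Ln (1 + z) - (\<Sum>j<h. (-1) ^ Suc j / of_nat j * z ^ j)) \<le> 2 * norm z ^ h"
proof -
  define f where "f = (\<lambda>j. (-1) ^ Suc j / of_nat j * z ^ j)"
  have sums: "f sums Ln (1 + z)" unfolding f_def using assms by (intro Ln_series) simp
  have "(\<lambda>j. f (j + h)) sums (Ln (1 + z) - (\<Sum>j<h. f j))"
    using sums by (simp add: sums_iff_shift)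
  hence eq: "Ln (1 + z) - (\<Sum>j<h. f j) = (\<Sum>j. f (j + h))" by (simp add: sums_iff)
  have sg: "(\<lambda>j. norm z ^ h * norm z ^ j) sums (norm z ^ h * (1 / (1 - norm z)))"
    using assms by (intro sums_mult geometric_sums) simp
  have "norm (\<Sum>j. f (j + h)) \<le> (\<Sum>j. norm z ^ h * norm z ^ j)"
  proof (rule norm_suminf_le)
    show "summable (\<lambda>j. norm z ^ h * norm z ^ j)" using sg by (rule sums_summable)
    fix j
    have "norm (f (j + h)) = 1 / real (j + h) * norm z ^ (j + h)"
      unfolding f_def norm_mult norm_divide norm_power norm_of_nat by simp
    also have "\<dots> \<le> 1 * norm z ^ (j + h)"
      by (intro mult_right_mono one_divide_nat_le_one) auto
    finally show "norm (f (j + h)) \<le> norm z ^ h * norm z ^ j" by (simp add: power_add mult.commute)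
  qed
  also have "\<dots> = norm z ^ h * (1 / (1 - norm z))" using sg by (simp add: sums_iff)
  also have "\<dots> \<le> norm z ^ h * 2" using assms by (intro mult_left_mono) (auto simp: divide_simps)
  finally have "norm (Ln (1 + z) - (\<Sum>j<h. f j)) \<le> 2 * norm z ^ h"
    unfolding eq by (simp only: mult.commute)
  thus ?thesis by (simp only: f_def)
qed

lemma norm_Ln_le:
  fixes z :: complex
  assumes "norm z \<le> 1 / 2"
  shows "norm (Ln (1 + z)) \<le> 2 * norm z"
  using norm_Ln_Taylor_le[OF assms, of 1] by simp

text \<open>Once the lower power sums vanish, the leading term of the expansion has order
  \<open>t^(-j)\<close> and the remainder has order \<open>t^(-j-1)\<close>; hence the next power
  sum is of order \<open>1 / t\<close>.\<close>

lemma power_sum_bound_from_log_relation: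
  fixes a :: "'i \<Rightarrow> complex" and l :: "'i \<Rightarrow> int" and t :: complex
  assumes fin: "finite I" and rel: "(\<Sum>i\<in>I. of_int (l i) * Ln (1 + a i / t)) = 0"
    and A: "\<And>i. i \<in> I \<Longrightarrow> norm (a i) \<le> A" "A \<ge> 0" and \<Lambda>: "\<And>i. i \<in> I \<Longrightarrow> \<bar>real_of_int (l i)\<bar> \<le> \<Lambda>"
    and T: "2 * A \<le> norm t" "norm t > 0"
    and j: "j \<ge> 1" and zero: "\<And>h. 1 \<le> h \<Longrightarrow> h < j \<Longrightarrow> (\<Sum>i\<in>I. of_int (l i) * a i ^ h) = 0"
  shows "norm (\<Sum>i\<in>I. of_int (l i) * a i ^ j) \<le> 2 * real j * real (card I) * \<Lambda> * A ^ Suc j / norm t"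
proof -
  define S where "S = (\<lambda>h. \<Sum>i\<in>I. of_int (l i) * a i ^ h)"
  define R where "R = (\<lambda>i. Ln (1 + a i / t) - (\<Sum>h<Suc j. (-1) ^ Suc h / of_nat h * (a i / t) ^ h))"
  have t0: "t \<noteq> 0" using T(2) by auto
  have "0 = (\<Sum>i\<in>I. of_int (l i) * ((\<Sum>h<Suc j. (-1) ^ Suc h / of_nat h * (a i / t) ^ h) + R i))"
    using rel by (simp add: R_def)
  also have "\<dots> = (\<Sum>i\<in>I. \<Sum>h<Suc j. of_int (l i) * ((-1) ^ Suc h / of_nat h * (a i / t) ^ h)) + (\<Sum>i\<in>I. of_int (l i) * R i)"
    by (simp add: distrib_left sum.distrib sum_distrib_left del: sum.lessThan_Suc power_Suc)
  also have "(\<Sum>i\<in>I. \<Sum>h<Suc j. of_int (l i) * ((-1) ^ Suc h / of_nat h * (a i / t) ^ h))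
      = (\<Sum>h<Suc j. (-1) ^ Suc h / of_nat h / t ^ h * S h)"
    unfolding S_def sum_distrib_left
    by (subst sum.swap) (intro sum.cong refl, simp add: power_divide)
  \<comment> \<open>The terms with \<open>1 \<le> h < j\<close> vanish by hypothesis, and the term
    \<open>h = 0\<close> by the convention for division by zero.\<close>
  also have "\<dots> = (\<Sum>h\<in>{j}. (-1) ^ Suc h / of_nat h / t ^ h * S h)"
  proof (rule sum.mono_neutral_right)
    show "\<forall>h\<in>{..<Suc j} - {j}. (-1) ^ Suc h / of_nat h / t ^ h * S h = 0"
    proof
      fix h assume h: "h \<in> {..<Suc j} - {j}"
      show "(-1) ^ Suc h / of_nat h / t ^ h * S h = 0"
      proof (cases "h = 0")
        case False
        hence "S h = 0" unfolding S_def using h by (intro zero) auto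
        thus ?thesis by simp
      qed simp
    qed
  qed auto
  finally have "(-1) ^ Suc j / of_nat j / t ^ j * S j = - (\<Sum>i\<in>I. of_int (l i) * R i)"
    by (simp add: eq_neg_iff_add_eq_0)
  hence "norm ((-1) ^ Suc j / of_nat j / t ^ j * S j) = norm (\<Sum>i\<in>I. of_int (l i) * R i)" by simp
  hence "norm (S j) / (real j * norm t ^ j) = norm (\<Sum>i\<in>I. of_int (l i) * R i)"
    by (simp add: norm_mult norm_divide norm_power)
  also have "\<dots> \<le> (\<Sum>i\<in>I. \<Lambda> * (2 * (A / norm t) ^ Suc j))"
  proof (rule order_trans[OF norm_sum sum_mono])
    fix i assume i: "i \<in> I"
    have le: "norm (a i / t) \<le> A / norm t" using A(1)[OF i] by (simp add: norm_divide divide_right_mono)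
    also have "\<dots> \<le> 1 / 2" using T by (simp add: field_simps)
    finally have "norm (R i) \<le> 2 * norm (a i / t) ^ Suc j" unfolding R_def by (rule norm_Ln_Taylor_le)
    also have "\<dots> \<le> 2 * (A / norm t) ^ Suc j" using le by (intro mult_left_mono power_mono) auto
    finally show "norm (of_int (l i) * R i) \<le> \<Lambda> * (2 * (A / norm t) ^ Suc j)"
      unfolding norm_mult norm_of_int using \<Lambda>[OF i] by (intro mult_mono) auto
  qed
  finally have "norm (S j) / (real j * norm t ^ j) \<le> real (card I) * (\<Lambda> * (2 * (A / norm t) ^ Suc j))" by simp
  hence "norm (S j) \<le> real (card I) * (\<Lambda> * (2 * (A / norm t) ^ Suc j)) * (real j * norm t ^ j)"
    using j T(2) by (subst (asm) pos_divide_le_eq) auto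
  also have "\<dots> = 2 * real j * real (card I) * \<Lambda> * A ^ Suc j / norm t"
    using T(2) by (simp add: power_divide field_simps)
  finally show ?thesis by (simp add: S_def)
qed

section \<open>Small multiplicative relations\<close>

text \<open>Restricting embeddings to \<open>\<rat>(\<theta>)\<close> makes the bounds on embedded
  \<open>\<alpha> i\<close> refer to a fixed field, so the constants do not depend on
  \<open>t\<close>.\<close>

lemma emb_tower:
  assumes \<xi>: "algebraic \<xi>" and \<theta>: "\<theta> \<in> qext \<xi>" and \<eta>: "\<eta> \<in> conjugates \<xi>"
  shows "emb \<xi> \<eta> \<theta> \<in> conjugates \<theta>"
    and "x \<in> qext \<theta> \<Longrightarrow> emb \<xi> \<eta> x = emb \<theta> (emb \<xi> \<eta> \<theta>) x"
proof -
  show c: "emb \<xi> \<eta> \<theta> \<in> conjugates \<theta>" using conjugates_qext[OF \<xi> \<theta>] \<eta> by simp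
  assume "x \<in> qext \<theta>"
  then obtain R where x: "x = poly (map_poly of_rat R) \<theta>" by (rule qextE)
  show "emb \<xi> \<eta> x = emb \<theta> (emb \<xi> \<eta> \<theta>) x"
    unfolding x poly_emb[OF \<xi> \<eta> \<theta>] emb_poly[OF algebraic_qext[OF \<xi> \<theta>] c] ..
qed

lemma prod_powi: "(\<Prod>i\<in>I. f i) powi N = (\<Prod>i\<in>I. (f i :: complex) powi N)"
  by (induction I rule: infinite_finite_induct) (auto simp: power_int_mult_distrib)

text \<open>Dividing by the largest entry leaves only \<open>n - 1\<close> ratios, all of modulus at
  most 1, for Dirichlet's simultaneous approximation. This is why \<open>Q\<close> enters with
  exponent \<open>n - 1\<close>.\<close>

lemma approximate_integer_direction:
  fixes k :: "nat \<Rightarrow> int" and n Q :: nat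
  assumes i0: "i0 \<in> {1..n}" "k i0 \<noteq> 0" "\<And>i. i \<in> {1..n} \<Longrightarrow> \<bar>k i\<bar> \<le> \<bar>k i0\<bar>" and Q: "Q \<ge> 1"
  obtains l :: "nat \<Rightarrow> int" where "l i0 \<ge> 1" "\<And>i. i \<in> {1..n} \<Longrightarrow> \<bar>real_of_int (l i)\<bar> \<le> 2 * real Q ^ (n - 1)"
    "\<And>i. i \<in> {1..n} \<Longrightarrow> \<bar>real_of_int (l i0) * (real_of_int (k i) / real_of_int (k i0)) - real_of_int (l i)\<bar> \<le> 1 / real Q"
proof -
  have "card ({1..n} - {i0}) = n - 1" using i0(1) by simp
  then obtain h where h: "bij_betw h {..<n - 1} ({1..n} - {i0})"
    using ex_bij_betw_nat_finite[of "{1..n} - {i0}"] by (auto simp: lessThan_atLeast0)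
  define \<rho> where "\<rho> = (\<lambda>i. real_of_int (k i) / real_of_int (k i0))"
  obtain q p where qp: "0 < q" "q \<le> int (Q ^ (n - 1))"
    "\<And>j. j < n - 1 \<Longrightarrow> \<bar>of_int q * \<rho> (h j) - of_int (p j)\<bar> < 1 / real Q"
    using Dirichlet_approx_simult[of Q "n - 1" "\<rho> \<circ> h"] Q by auto
  define l where "l = (\<lambda>i. if i = i0 then q else p (inv_into {..<n - 1} h i))"
  have li0: "l i0 = q" by (simp add: l_def)
  have approx: "\<bar>real_of_int q * \<rho> i - real_of_int (l i)\<bar> \<le> 1 / real Q" if i: "i \<in> {1..n}" for i
  proof (cases "i = i0")
    case True
    thus ?thesis using i0(2) by (simp add: l_def \<rho>_def)
  next
    case False
    hence "i \<in> h ` {..<n - 1}" using i h by (auto simp: bij_betw_def)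
    hence j: "inv_into {..<n - 1} h i < n - 1" "h (inv_into {..<n - 1} h i) = i"
      using inv_into_into[of i h "{..<n - 1}"] f_inv_into_f[of i h "{..<n - 1}"] by auto
    show ?thesis using qp(3)[OF j(1)] j(2) False by (simp add: l_def)
  qed
  have Qn: "real Q ^ (n - 1) \<ge> 1" using Q by (intro one_le_power) simp
  have q: "real_of_int q \<le> real Q ^ (n - 1)" using qp(2) by (metis of_int_le_iff of_int_of_nat_eq of_nat_power)
  have size: "\<bar>real_of_int (l i)\<bar> \<le> 2 * real Q ^ (n - 1)" if i: "i \<in> {1..n}" for i
  proof -
    have "\<bar>\<rho> i\<bar> \<le> 1" using i0(2) i0(3)[OF i] by (simp add: \<rho>_def abs_divide divide_le_eq_1 flip: of_int_abs)
    hence "\<bar>real_of_int q * \<rho> i\<bar> \<le> real_of_int q * 1"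
      unfolding abs_mult using qp(1) by (intro mult_mono) auto
    moreover have "1 / real Q \<le> 1" by (rule one_divide_nat_le_one)
    ultimately have "\<bar>real_of_int (l i)\<bar> \<le> real_of_int q + 1" using approx[OF i] by linarith
    thus ?thesis using q Qn by linarith
  qed
  show ?thesis
    using that[of l] qp(1) size approx unfolding li0 \<rho>_def by simp
qed

text \<open>Modulo the given relation, a high power \<open>\<beta> ^ q\<close> is a product of the
  \<open>z i\<close> with exponents \<open>l i * q - k i * N\<close>. For the nearest integer
  \<open>N\<close> these are of size \<open>q / Q\<close> instead of \<open>q\<close>, so the
  \<open>q\<close>-th root has logarithmic size of order \<open>1 / Q\<close>.\<close>

lemma small_height_of_approximate_relation:
  fixes z :: "nat \<Rightarrow> complex" and k l :: "nat \<Rightarrow> int" and a n Q :: nat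
  assumes \<xi>: "algebraic \<xi>"
    and z: "\<And>i. i \<in> {1..n} \<Longrightarrow> z i \<in> qext \<xi>" "\<And>i. i \<in> {1..n} \<Longrightarrow> z i \<noteq> 0"
      "\<And>i. i \<in> {1..n} \<Longrightarrow> algebraic_int (of_nat a * z i)"
    and a: "a \<ge> 1" "real a \<le> H"
    and H: "\<And>i \<eta>. i \<in> {1..n} \<Longrightarrow> \<eta> \<in> conjugates \<xi> \<Longrightarrow> norm (emb \<xi> \<eta> (of_nat a * z i)) \<le> H"
    and rel: "(\<Prod>i\<in>{1..n}. z i powi k i) = 1"
    and i0: "k i0 \<noteq> 0" and kmax: "\<And>i. i \<in> {1..n} \<Longrightarrow> \<bar>k i\<bar> \<le> \<bar>k i0\<bar>"
    and Q: "Q \<ge> 1"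
    and approx: "\<And>i. i \<in> {1..n} \<Longrightarrow> \<bar>real_of_int (l i0) * (real_of_int (k i) / real_of_int (k i0)) - real_of_int (l i)\<bar> \<le> 1 / real Q"
    and small: "2 * real n * real (card (conjugates \<xi>)) * ln H / real Q < ln 2"
    and \<beta>: "\<beta> = (\<Prod>i\<in>{1..n}. z i powi l i)"
  shows "algebraic_int \<beta>"
    and "(\<Sum>b\<in>conjugates \<beta>. ln (max 1 (norm b))) \<le> 2 * real n * real (card (conjugates \<xi>)) * ln H / real Q"
proof -
  let ?C = "conjugates \<xi>"
  define D where "D = card ?C"
  have H1: "H \<ge> 1" using a by linarith
  \<comment> \<open>A power of two suits Graeffe's iteration. It exceeds
    \<open>\<bar>k i0\<bar> * Q\<close>, so that rounding \<open>N\<close> costs no more in the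
    exponents than the approximation error \<open>q / Q\<close>.\<close>
  obtain s :: nat where s: "real_of_int \<bar>k i0\<bar> * real Q < 2 ^ s" using real_arch_pow[of 2] by auto
  define q :: nat where "q = 2 ^ s"
  define N where "N = round (real q * real_of_int (l i0) / real_of_int (k i0))"
  define e where "e = (\<lambda>i. l i * int q - k i * N)"
  have q0: "real q > 0" by (simp add: q_def)
  have e_le: "\<bar>real_of_int (e i)\<bar> \<le> 2 * real q / real Q" if i: "i \<in> {1..n}" for i
  proof -
    define x where "x = real_of_int (l i0) * (real_of_int (k i) / real_of_int (k i0)) - real_of_int (l i)"
    define y where "y = real q * real_of_int (l i0) / real_of_int (k i0) - real_of_int N"
    have "real_of_int (e i) = real_of_int (k i) * y - real q * x"
      using i0 by (simp add: e_def x_def y_def field_simps)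
    hence "\<bar>real_of_int (e i)\<bar> \<le> \<bar>real_of_int (k i)\<bar> * \<bar>y\<bar> + real q * \<bar>x\<bar>"
      using abs_triangle_ineq4[of "real_of_int (k i) * y" "real q * x"] by (simp add: abs_mult)
    also have "\<dots> \<le> real_of_int \<bar>k i0\<bar> * 1 + real q * (1 / real Q)"
    proof (intro add_mono mult_mono)
      show "\<bar>real_of_int (k i)\<bar> \<le> real_of_int \<bar>k i0\<bar>" using kmax[OF i] by linarith
      show "\<bar>y\<bar> \<le> 1" unfolding y_def N_def
        using of_int_round_abs_le[of "real q * real_of_int (l i0) / real_of_int (k i0)"] by linarith
      show "\<bar>x\<bar> \<le> 1 / real Q" unfolding x_def by (rule approx[OF i])
    qed auto
    also have "real_of_int \<bar>k i0\<bar> \<le> real q / real Q" using s Q by (simp add: q_def field_simps)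
    finally show ?thesis by simp
  qed
  define g where "g = (\<lambda>i. of_nat a * z i)"
  \<comment> \<open>Numerator and denominator of \<open>\<beta> ^ q\<close>: negative exponents move
    to the denominator, and each \<open>z i\<close> is made integral by a factor \<open>a\<close>,
    compensated on the other side.\<close>
  define u where "u = (\<Prod>i\<in>{1..n}. if e i \<ge> 0 then g i ^ nat (e i) else of_nat a ^ nat (- e i))"
  define w where "w = (\<Prod>i\<in>{1..n}. if e i \<ge> 0 then of_nat a ^ nat (e i) else g i ^ nat (- e i))"
  have a0: "(of_nat a :: complex) \<noteq> 0" using a by simp
  have gq: "g i \<in> qext \<xi>" if "i \<in> {1..n}" for i
    using z(1)[OF that] by (simp add: g_def qext_mult qext_of_nat)
  have uq: "u \<in> qext \<xi>" and wq: "w \<in> qext \<xi>"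
    unfolding u_def w_def by (intro qext_prod; simp add: qext_power qext_of_nat gq)+
  have ui: "algebraic_int u" and wi: "algebraic_int w"
    unfolding u_def w_def using z(3)
    by (intro algebraic_int_prod; simp add: algebraic_int_power g_def)+
  have w0: "w \<noteq> 0" unfolding w_def using z(2) a0 by (auto simp: g_def)
  have \<beta>q: "\<beta> \<in> qext \<xi>" unfolding \<beta> by (intro qext_prod qext_powi[OF \<xi>] z)
  have pow: "\<beta> ^ q = (\<Prod>i\<in>{1..n}. z i powi e i)"
  proof -
    have "(\<Prod>i\<in>{1..n}. z i powi e i) = (\<Prod>i\<in>{1..n}. (z i powi l i) ^ q / (z i powi k i) powi N)"
      using z(2) by (intro prod.cong refl) (simp add: e_def power_int_diff power_int_mult)
    also have "\<dots> = \<beta> ^ q / (\<Prod>i\<in>{1..n}. z i powi k i) powi N"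
      by (simp add: prod_dividef \<beta> prod_power_distrib prod_powi)
    finally show ?thesis unfolding rel by simp
  qed
  have "\<beta> ^ q * w = u"
    unfolding pow w_def u_def prod.distrib[symmetric]
  proof (intro prod.cong refl)
    fix i assume i: "i \<in> {1..n}"
    show "z i powi e i * (if 0 \<le> e i then of_nat a ^ nat (e i) else g i ^ nat (- e i))
        = (if 0 \<le> e i then g i ^ nat (e i) else of_nat a ^ nat (- e i))"
      using z(2)[OF i] a0 by (auto simp: g_def power_int_def power_mult_distrib field_simps)
  qed
  hence rel': "\<beta> ^ (2 ^ s) * w = u" by (simp add: q_def)
  define m where "m = (\<Sum>i\<in>{1..n}. nat \<bar>e i\<bar>)"
  define B where "B = H ^ m"
  have bound: "norm (emb \<xi> \<eta> u) \<le> B" "norm (emb \<xi> \<eta> w) \<le> B" if \<eta>: "\<eta> \<in> ?C" for \<eta>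
  proof -
    have "emb \<xi> \<eta> u = (\<Prod>i\<in>{1..n}. if e i \<ge> 0 then emb \<xi> \<eta> (g i) ^ nat (e i) else of_nat a ^ nat (- e i))"
      unfolding u_def
      by (subst emb_prod[OF \<xi> \<eta>])
        (auto simp: qext_power qext_of_nat gq emb_power[OF \<xi> \<eta>] emb_of_nat[OF \<xi> \<eta>] intro!: prod.cong)
    hence "norm (emb \<xi> \<eta> u) = (\<Prod>i\<in>{1..n}. norm (if e i \<ge> 0 then emb \<xi> \<eta> (g i) ^ nat (e i) else of_nat a ^ nat (- e i)))"
      by (simp add: prod_norm)
    also have "\<dots> \<le> (\<Prod>i\<in>{1..n}. H ^ nat \<bar>e i\<bar>)"
      using H[OF _ \<eta>] a(2) by (intro prod_mono) (auto simp: norm_power g_def intro!: power_mono)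
    finally show "norm (emb \<xi> \<eta> u) \<le> B" by (simp add: B_def m_def power_sum)
    have "emb \<xi> \<eta> w = (\<Prod>i\<in>{1..n}. if e i \<ge> 0 then of_nat a ^ nat (e i) else emb \<xi> \<eta> (g i) ^ nat (- e i))"
      unfolding w_def
      by (subst emb_prod[OF \<xi> \<eta>])
        (auto simp: qext_power qext_of_nat gq emb_power[OF \<xi> \<eta>] emb_of_nat[OF \<xi> \<eta>] intro!: prod.cong)
    hence "norm (emb \<xi> \<eta> w) = (\<Prod>i\<in>{1..n}. norm (if e i \<ge> 0 then of_nat a ^ nat (e i) else emb \<xi> \<eta> (g i) ^ nat (- e i)))"
      by (simp add: prod_norm)
    also have "\<dots> \<le> (\<Prod>i\<in>{1..n}. H ^ nat \<bar>e i\<bar>)"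
      using H[OF _ \<eta>] a(2) by (intro prod_mono) (auto simp: norm_power g_def intro!: power_mono)
    finally show "norm (emb \<xi> \<eta> w) \<le> B" by (simp add: B_def m_def power_sum)
  qed
  have m_le: "real m \<le> real n * (2 * real q / real Q)"
  proof -
    have "real m = (\<Sum>i\<in>{1..n}. \<bar>real_of_int (e i)\<bar>)" by (simp add: m_def)
    also have "\<dots> \<le> (\<Sum>i\<in>{1..n}. 2 * real q / real Q)" by (intro sum_mono e_le)
    finally show ?thesis by simp
  qed
  have lnB: "ln (B ^ D) = real D * real m * ln H" by (simp add: B_def ln_realpow)
  have lnH: "ln H \<ge> 0" using H1 by simp
  have BD: "ln (B ^ D) \<le> real q * (2 * real n * real D * ln H / real Q)"
  proof -
    have "real D * real m * ln H \<le> real D * (real n * (2 * real q / real Q)) * ln H"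
      using m_le lnH by (intro mult_right_mono mult_left_mono) auto
    thus ?thesis unfolding lnB by (simp add: mult_ac)
  qed
  have Bpos: "B ^ D > 0" using H1 by (simp add: B_def)
  have "ln (B ^ D) < real q * ln 2"
    using BD mult_strict_left_mono[OF small q0] by (simp add: D_def)
  hence "ln (B ^ D) < ln (2 ^ q)" by (simp add: ln_realpow)
  hence "B ^ D < 2 ^ q" using Bpos by (subst (asm) ln_less_cancel_iff) auto
  hence lt: "B ^ card ?C < 2 ^ (2 ^ s)" by (simp add: D_def q_def)
  show "algebraic_int \<beta>"
    by (rule mahler_bound_from_power(1)[OF \<xi> \<beta>q uq ui wq wi w0 rel' bound lt])
  define M where "M = (\<Prod>\<eta>\<in>?C. max 1 (norm (emb \<xi> \<eta> \<beta>)))"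
  have M1: "M \<ge> 1" unfolding M_def by (intro prod_ge_1) auto
  have "M ^ q \<le> B ^ D"
    unfolding M_def q_def D_def by (rule mahler_bound_from_power(2)[OF \<xi> \<beta>q uq ui wq wi w0 rel' bound lt])
  hence "ln (M ^ q) \<le> ln (B ^ D)" using M1 by (intro ln_mono) auto
  hence "real q * ln M \<le> real q * (2 * real n * real D * ln H / real Q)" using BD by (simp add: ln_realpow)
  hence lnM: "ln M \<le> 2 * real n * real D * ln H / real Q" using q0 by (subst (asm) mult_le_cancel_left_pos) auto
  have fin: "finite ?C" by (rule finite_conjugates[OF \<xi>])
  have "(\<Sum>b\<in>conjugates \<beta>. ln (max 1 (norm b))) \<le> (\<Sum>\<eta>\<in>?C. ln (max 1 (norm (emb \<xi> \<eta> \<beta>))))"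
    unfolding conjugates_qext[OF \<xi> \<beta>q] using sum_image_le[OF fin, of "\<lambda>b. ln (max 1 (norm b))" "\<lambda>\<eta>. emb \<xi> \<eta> \<beta>"]
    by (simp add: o_def)
  also have "\<dots> = ln M" unfolding M_def using fin by (subst ln_prod) (auto simp: less_max_iff_disj)
  finally show "(\<Sum>b\<in>conjugates \<beta>. ln (max 1 (norm b))) \<le> 2 * real n * real (card ?C) * ln H / real Q"
    using lnM by (simp add: D_def)
qed

text \<open>Both constants leave a gap. The modulus gives
  \<open>\<bar>L\<bar> * ln (norm \<tau>) < 6\<close>, impossible for nonzero \<open>L\<close> when
  the logarithm is at least 7. Then \<open>exp (w * Z) = 1\<close> with \<open>w * Z\<close> of
  modulus below 6, less than the period \<open>2 * pi\<close>, forces \<open>Z = 0\<close>.\<close>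

lemma log_relation_of_root_of_unity:
  fixes a :: "nat \<Rightarrow> complex" and l :: "nat \<Rightarrow> int" and \<tau> :: complex
  assumes fin: "finite I" and A: "\<And>i. i \<in> I \<Longrightarrow> norm (a i) \<le> A" "A \<ge> 0"
    and \<Lambda>: "\<And>i. i \<in> I \<Longrightarrow> \<bar>real_of_int (l i)\<bar> \<le> \<Lambda>"
    and T: "2 * A \<le> norm \<tau>" "ln (norm \<tau>) \<ge> 7" "norm \<tau> > 0"
    and w: "w > 0" "(\<Prod>i\<in>I. (a i + \<tau>) powi l i) ^ w = 1"
    and small: "real w * (real (card I) * \<Lambda> * (2 * A / norm \<tau>)) < 6"
  shows "(\<Sum>i\<in>I. l i) = 0" "(\<Sum>i\<in>I. of_int (l i) * Ln (1 + a i / \<tau>)) = 0"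
proof -
  define Z where "Z = (\<Sum>i\<in>I. of_int (l i) * Ln (1 + a i / \<tau>))"
  define L where "L = (\<Sum>i\<in>I. l i)"
  have \<tau>0: "\<tau> \<noteq> 0" using T(3) by auto
  have le: "norm (a i / \<tau>) \<le> A / norm \<tau>" if "i \<in> I" for i
    using A(1)[OF that] by (simp add: norm_divide divide_right_mono)
  have half: "A / norm \<tau> \<le> 1 / 2" using T by (simp add: field_simps)
  have nz: "1 + a i / \<tau> \<noteq> 0" if "i \<in> I" for i
  proof
    assume "1 + a i / \<tau> = 0"
    hence "a i / \<tau> = -1" by (simp add: eq_neg_iff_add_eq_0 add.commute)
    hence "norm (a i / \<tau>) = 1" by simp
    thus False using le[OF that] half by simp
  qed
  have Zle: "norm Z \<le> real (card I) * \<Lambda> * (2 * A / norm \<tau>)"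
  proof -
    have "norm Z \<le> (\<Sum>i\<in>I. \<Lambda> * (2 * (A / norm \<tau>)))" unfolding Z_def
    proof (rule order_trans[OF norm_sum sum_mono])
      fix i assume i: "i \<in> I"
      have "norm (Ln (1 + a i / \<tau>)) \<le> 2 * norm (a i / \<tau>)"
        by (rule norm_Ln_le[OF order_trans[OF le[OF i] half]])
      also have "\<dots> \<le> 2 * (A / norm \<tau>)" using le[OF i] by simp
      finally show "norm (of_int (l i) * Ln (1 + a i / \<tau>)) \<le> \<Lambda> * (2 * (A / norm \<tau>))"
        unfolding norm_mult norm_of_int using \<Lambda>[OF i] by (intro mult_mono) auto
    qed
    thus ?thesis by simp
  qed
  have wZ: "real w * norm Z < 6"
    using mult_left_mono[OF Zle, of "real w"] small by simp
  have "norm Z \<le> real w * norm Z" using w(1) mult_right_mono[of 1 "real w" "norm Z"] by simp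
  hence Z6: "norm Z < 6" using wZ by simp
  have prod_eq: "(\<Prod>i\<in>I. (a i + \<tau>) powi l i) = \<tau> powi L * exp Z"
  proof -
    have "(\<Prod>i\<in>I. (a i + \<tau>) powi l i) = (\<Prod>i\<in>I. \<tau> powi l i * exp (of_int (l i) * Ln (1 + a i / \<tau>)))"
    proof (intro prod.cong refl)
      fix i assume i: "i \<in> I"
      have "a i + \<tau> = \<tau> * (1 + a i / \<tau>)" using \<tau>0 by (simp add: field_simps)
      also have "\<dots> powi l i = \<tau> powi l i * (1 + a i / \<tau>) powi l i" by (rule power_int_mult_distrib)
      also have "(1 + a i / \<tau>) powi l i = exp (of_int (l i) * Ln (1 + a i / \<tau>))"
        using exp_power_int[of "Ln (1 + a i / \<tau>)" "l i"] nz[OF i] by simp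
      finally show "(a i + \<tau>) powi l i = \<tau> powi l i * exp (of_int (l i) * Ln (1 + a i / \<tau>))" .
    qed
    also have "\<dots> = (\<Prod>i\<in>I. \<tau> powi l i) * exp Z"
      unfolding prod.distrib Z_def using fin by (simp add: exp_sum)
    also have "(\<Prod>i\<in>I. \<tau> powi l i) = \<tau> powi L"
      unfolding L_def using fin \<tau>0 by (induction I rule: finite_induct) (auto simp: power_int_add)
    finally show ?thesis .
  qed
  have "norm (\<tau> powi L * exp Z) ^ w = 1" using arg_cong[OF w(2), of norm] unfolding prod_eq by (simp add: norm_power)
  hence "norm (\<tau> powi L * exp Z) = 1"
    using w(1) power_eq_imp_eq_base[of "norm (\<tau> powi L * exp Z)" w 1] by simp
  hence "norm \<tau> powi L * exp (Re Z) = 1" by (simp add: norm_mult norm_power_int)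
  moreover have "norm \<tau> powi L = exp (of_int L * ln (norm \<tau>))"
    using exp_power_int[of "ln (norm \<tau>)" L] T(3) by simp
  ultimately have "exp (of_int L * ln (norm \<tau>) + Re Z) = 1" by (simp add: exp_add)
  hence "of_int L * ln (norm \<tau>) = - Re Z" by (simp add: eq_neg_iff_add_eq_0)
  hence "\<bar>of_int L * ln (norm \<tau>)\<bar> = \<bar>Re Z\<bar>" by simp
  hence "\<bar>of_int L\<bar> * ln (norm \<tau>) = \<bar>Re Z\<bar>" using T(2) by (simp add: abs_mult)
  also have "\<dots> < 6" using abs_Re_le_cmod[of Z] Z6 by linarith
  finally have lt: "\<bar>real_of_int L\<bar> * ln (norm \<tau>) < 6" .
  have L0: "L = 0"
  proof (rule ccontr)
    assume "L \<noteq> 0"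
    hence "1 \<le> \<bar>real_of_int L\<bar>" by linarith
    hence "1 * 7 \<le> \<bar>real_of_int L\<bar> * ln (norm \<tau>)" using T(2) by (intro mult_mono) auto
    thus False using lt by simp
  qed
  thus "(\<Sum>i\<in>I. l i) = 0" by (simp add: L_def)
  have "exp (of_nat w * Z) = 1" using w(2) unfolding prod_eq L0 by (simp add: exp_of_nat_mult)
  then obtain j :: int where "Re (of_nat w * Z) = 0" "Im (of_nat w * Z) = of_int (2 * j) * pi"
    unfolding exp_eq_1 by blast
  hence j: "of_nat w * Z = complex_of_real (of_int (2 * j) * pi) * \<i>" by (simp add: complex_eq_iff)
  have "norm (of_nat w * Z) = \<bar>real_of_int (2 * j) * pi\<bar>" unfolding j by (simp add: norm_mult abs_mult)
  hence jpi: "2 * \<bar>real_of_int j\<bar> * pi < 6" using wZ by (simp add: norm_mult abs_mult)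
  have "j = 0"
  proof (rule ccontr)
    assume "j \<noteq> 0"
    hence "1 \<le> \<bar>real_of_int j\<bar>" by linarith
    hence "2 * 1 * 3 \<le> 2 * \<bar>real_of_int j\<bar> * pi" using pi_gt3 by (intro mult_mono) auto
    thus False using jpi by simp
  qed
  hence "Z = 0" using j w(1) by simp
  thus "(\<Sum>i\<in>I. of_int (l i) * Ln (1 + a i / \<tau>)) = 0" by (simp add: Z_def)
qed

section \<open>Multiplicative independence of translates\<close>

text \<open>The Vandermonde argument in dual form: a polynomial vanishing at all other points
  isolates one coefficient, and its degree stays below \<open>card I\<close>.\<close>

lemma coefficients_zero_if_power_sums_zero:
  fixes a l :: "'i \<Rightarrow> complex"
  assumes fin: "finite I" and inj: "inj_on a I"
    and zero: "\<And>j. j < card I \<Longrightarrow> (\<Sum>i\<in>I. l i * a i ^ j) = 0" and i: "i \<in> I"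
  shows "l i = 0"
proof -
  define p where "p = (\<Prod>i'\<in>I - {i}. [:- a i', 1:])"
  have "degree p = card (I - {i})" unfolding p_def by (subst degree_prod_eq_sum_degree) auto
  hence deg: "degree p < card I" using fin i by (metis card_Diff1_less)
  have "(\<Sum>i'\<in>I. l i' * poly p (a i')) = (\<Sum>i'\<in>I. \<Sum>j\<le>degree p. coeff p j * (l i' * a i' ^ j))"
    unfolding poly_altdef sum_distrib_left by (intro sum.cong refl) (simp add: mult_ac)
  also have "\<dots> = (\<Sum>j\<le>degree p. coeff p j * (\<Sum>i'\<in>I. l i' * a i' ^ j))"
    unfolding sum_distrib_left by (rule sum.swap)
  also have "\<dots> = 0" using deg by (intro sum.neutral) (simp add: zero)
  finally have "(\<Sum>i'\<in>I. l i' * poly p (a i')) = 0" .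
  moreover have "(\<Sum>i'\<in>I. l i' * poly p (a i')) = (\<Sum>i'\<in>{i}. l i' * poly p (a i'))"
    using fin i by (intro sum.mono_neutral_right) (auto simp: p_def poly_prod)
  moreover have "poly p (a i) \<noteq> 0"
    using fin i inj by (auto simp: p_def poly_prod dest: inj_onD)
  ultimately show ?thesis by simp
qed

lemma norm_house_le:
  assumes "algebraic t" "w \<in> conjugates t"
  shows "norm w \<le> house t"
  unfolding house_def using finite_conjugates[OF assms(1)] assms(2) by (intro Max_ge) auto

lemma house_attained:
  assumes "algebraic t"
  obtains w where "w \<in> conjugates t" "norm w = house t"
proof -
  have "house t \<in> norm ` conjugates t"
    unfolding house_def using finite_conjugates[OF assms] self_in_conjugates[OF assms] by (intro Max_in) auto
  thus ?thesis using that by auto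
qed

lemma emb_power_sum:
  assumes \<xi>: "algebraic \<xi>" and \<eta>: "\<eta> \<in> conjugates \<xi>" and \<alpha>: "\<And>i. i \<in> I \<Longrightarrow> \<alpha> i \<in> qext \<xi>"
  shows "emb \<xi> \<eta> (\<Sum>i\<in>I. of_int (l i) * \<alpha> i ^ j) = (\<Sum>i\<in>I. of_int (l i) * emb \<xi> \<eta> (\<alpha> i) ^ j)"
proof -
  have "emb \<xi> \<eta> (\<Sum>i\<in>I. of_int (l i) * \<alpha> i ^ j) = (\<Sum>i\<in>I. emb \<xi> \<eta> (of_int (l i) * \<alpha> i ^ j))"
    by (rule emb_sum[OF \<xi> \<eta>]) (intro qext_mult qext_of_int qext_power \<alpha>)
  also have "\<dots> = (\<Sum>i\<in>I. of_int (l i) * emb \<xi> \<eta> (\<alpha> i) ^ j)"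
    by (intro sum.cong refl) (simp add: emb_mult[OF \<xi> \<eta>] emb_of_int[OF \<xi> \<eta>] emb_power[OF \<xi> \<eta>]
        qext_of_int qext_power \<alpha>)
  finally show ?thesis .
qed

text \<open>One factor of the norm is at most \<open>\<epsilon>\<close> and the others at most
  \<open>n \<Lambda> A^n\<close>. Because the power sum does not contain \<open>t\<close>, the norm
  is taken from \<open>\<rat>(\<theta>)\<close>, and the exponent \<open>d - 1\<close> is
  independent of the degree of \<open>t\<close>.\<close>

lemma power_sum_zero_if_small_conjugate:
  fixes \<alpha> :: "nat \<Rightarrow> complex" and l :: "nat \<Rightarrow> int"
  assumes \<theta>: "algebraic \<theta>" and \<alpha>: "\<And>i. i \<in> {1..n} \<Longrightarrow> \<alpha> i \<in> qext \<theta>"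
    and a: "a \<ge> 1" "\<And>i. i \<in> {1..n} \<Longrightarrow> algebraic_int (of_nat a * \<alpha> i)"
    and A: "A \<ge> 1" "\<And>\<theta>' i. \<theta>' \<in> conjugates \<theta> \<Longrightarrow> i \<in> {1..n} \<Longrightarrow> norm (emb \<theta> \<theta>' (\<alpha> i)) \<le> A"
    and \<Lambda>: "\<Lambda> \<ge> 1" "\<And>i. i \<in> {1..n} \<Longrightarrow> \<bar>real_of_int (l i)\<bar> \<le> \<Lambda>"
    and n: "n \<ge> 1" and j: "j \<le> n" and d: "card (conjugates \<theta>) \<le> d"
    and \<theta>0: "\<theta>0 \<in> conjugates \<theta>"
    and small: "norm (\<Sum>i\<in>{1..n}. of_int (l i) * emb \<theta> \<theta>0 (\<alpha> i) ^ j) \<le> \<epsilon>"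
    and \<epsilon>: "real a ^ (n * d) * (real n * \<Lambda> * A ^ n) ^ (d - 1) * \<epsilon> < 1"
  shows "(\<Sum>i\<in>{1..n}. of_int (l i) * \<alpha> i ^ j) = 0"
proof (rule ccontr)
  let ?C = "conjugates \<theta>"
  define S where "S = (\<Sum>i\<in>{1..n}. of_int (l i) * \<alpha> i ^ j)"
  assume "(\<Sum>i\<in>{1..n}. of_int (l i) * \<alpha> i ^ j) \<noteq> 0"
  hence S0: "S \<noteq> 0" by (simp add: S_def)
  define Y where "Y = real n * \<Lambda> * A ^ n"
  have Y1: "Y \<ge> 1"
  proof -
    have "1 * 1 * 1 \<le> real n * \<Lambda> * A ^ n" using n \<Lambda>(1) A(1) by (intro mult_mono one_le_power) auto
    thus ?thesis by (simp add: Y_def)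
  qed
  have Sq: "S \<in> qext \<theta>" unfolding S_def by (intro qext_sum qext_mult qext_of_int qext_power \<alpha>)
  have embS: "emb \<theta> \<theta>' S = (\<Sum>i\<in>{1..n}. of_int (l i) * emb \<theta> \<theta>' (\<alpha> i) ^ j)" if "\<theta>' \<in> ?C" for \<theta>'
    unfolding S_def by (rule emb_power_sum[OF \<theta> that \<alpha>])
  have le: "norm (emb \<theta> \<theta>' S) \<le> Y" if \<theta>': "\<theta>' \<in> ?C" for \<theta>'
  proof -
    have "norm (emb \<theta> \<theta>' S) \<le> (\<Sum>i\<in>{1..n}. \<Lambda> * A ^ n)" unfolding embS[OF \<theta>']
    proof (rule order_trans[OF norm_sum sum_mono])
      fix i assume i: "i \<in> {1..n}"
      have "norm (emb \<theta> \<theta>' (\<alpha> i)) ^ j \<le> A ^ j" using A(2)[OF \<theta>' i] by (intro power_mono) auto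
      also have "\<dots> \<le> A ^ n" using A(1) j by (intro power_increasing) auto
      finally show "norm (of_int (l i) * emb \<theta> \<theta>' (\<alpha> i) ^ j) \<le> \<Lambda> * A ^ n"
        unfolding norm_mult norm_power norm_of_int using \<Lambda>(2)[OF i] \<Lambda>(1) by (intro mult_mono) auto
    qed
    thus ?thesis by (simp add: Y_def)
  qed
  define S' where "S' = of_nat a ^ j * S"
  have S'_eq: "S' = (\<Sum>i\<in>{1..n}. of_int (l i) * (of_nat a * \<alpha> i) ^ j)"
    unfolding S'_def S_def sum_distrib_left by (intro sum.cong refl) (simp add: power_mult_distrib mult_ac)
  have S'i: "algebraic_int S'"
    unfolding S'_eq
    by (rule algebraic_int_sum) (rule algebraic_int_mult[OF algebraic_int_of_int algebraic_int_power[OF a(2)]])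
  have S'q: "S' \<in> qext \<theta>" unfolding S'_def by (intro qext_mult qext_power qext_of_nat Sq)
  have S'0: "S' \<noteq> 0" using S0 a(1) by (simp add: S'_def)
  have fin: "finite ?C" by (rule finite_conjugates[OF \<theta>])
  have "1 \<le> (\<Prod>\<theta>'\<in>?C. norm (emb \<theta> \<theta>' S'))" by (rule prod_emb_ge_1[OF \<theta> S'q S'i S'0])
  also have "\<dots> = (\<Prod>\<theta>'\<in>?C. real a ^ j * norm (emb \<theta> \<theta>' S))"
    by (intro prod.cong refl) (simp add: S'_def emb_mult[OF \<theta>] emb_power[OF \<theta>] emb_of_nat[OF \<theta>]
        qext_power qext_of_nat Sq norm_mult norm_power)
  also have "\<dots> = (real a ^ j) ^ card ?C * (\<Prod>\<theta>'\<in>?C. norm (emb \<theta> \<theta>' S))"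
    by (simp add: prod.distrib)
  also have "(\<Prod>\<theta>'\<in>?C. norm (emb \<theta> \<theta>' S)) = norm (emb \<theta> \<theta>0 S) * (\<Prod>\<theta>'\<in>?C - {\<theta>0}. norm (emb \<theta> \<theta>' S))"
    by (rule prod.remove[OF fin \<theta>0])
  also have "(real a ^ j) ^ card ?C * (norm (emb \<theta> \<theta>0 S) * (\<Prod>\<theta>'\<in>?C - {\<theta>0}. norm (emb \<theta> \<theta>' S)))
      \<le> real a ^ (n * d) * (\<epsilon> * Y ^ (d - 1))"
  proof (intro mult_mono)
    have "(real a ^ j) ^ card ?C = real a ^ (j * card ?C)" by (simp add: power_mult)
    also have "\<dots> \<le> real a ^ (n * d)" using a(1) j d by (intro power_increasing mult_le_mono) auto
    finally show "(real a ^ j) ^ card ?C \<le> real a ^ (n * d)" .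
    show "norm (emb \<theta> \<theta>0 S) \<le> \<epsilon>" using small embS[OF \<theta>0] by simp
    have "(\<Prod>\<theta>'\<in>?C - {\<theta>0}. norm (emb \<theta> \<theta>' S)) \<le> (\<Prod>\<theta>'\<in>?C - {\<theta>0}. Y)"
      using le by (intro prod_mono) auto
    also have "\<dots> = Y ^ (card ?C - 1)" using \<theta>0 fin by simp
    also have "\<dots> \<le> Y ^ (d - 1)" using Y1 d by (intro power_increasing) auto
    finally show "(\<Prod>\<theta>'\<in>?C - {\<theta>0}. norm (emb \<theta> \<theta>' S)) \<le> Y ^ (d - 1)" .
    show "0 \<le> \<epsilon>" using order_trans[OF norm_ge_zero small] .
  qed (use Y1 in \<open>auto intro!: prod_nonneg mult_nonneg_nonneg\<close>)
  also have "\<dots> < 1" using \<epsilon> by (simp add: Y_def mult_ac)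
  finally show False by simp
qed

text \<open>The arithmetic is separated from the numerics: \<open>small1\<close> makes
  \<open>\<beta>\<close> integral and contradicts Dobrowolski's bound \<open>\<delta>\<close> unless
  it is a root of unity, \<open>small2\<close> keeps its logarithm inside one period, and
  \<open>small3\<close> is Liouville's inequality.\<close>

lemma translates_independent:
  fixes \<alpha> :: "nat \<Rightarrow> complex" and n a d D Q :: nat
  assumes n: "n \<ge> 1" and inj: "inj_on \<alpha> {1..n}"
    and \<theta>: "algebraic \<theta>" "\<And>i. i \<in> {1..n} \<Longrightarrow> \<alpha> i \<in> qext \<theta>" "card (conjugates \<theta>) \<le> d"
    and a: "a \<ge> 1" "\<And>i. i \<in> {1..n} \<Longrightarrow> algebraic_int (of_nat a * \<alpha> i)"
    and A: "A \<ge> 1" "\<And>\<theta>' i. \<theta>' \<in> conjugates \<theta> \<Longrightarrow> i \<in> {1..n} \<Longrightarrow> norm (emb \<theta> \<theta>' (\<alpha> i)) \<le> A"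
    and t: "algebraic_int t" "T = house t"
    and \<xi>: "algebraic \<xi>" "\<theta> \<in> qext \<xi>" "t \<in> qext \<xi>" "card (conjugates \<xi>) \<le> D"
    and dob: "\<And>\<beta>. algebraic_int \<beta> \<Longrightarrow> \<beta> \<noteq> 0 \<Longrightarrow> (\<And>m. m > 0 \<Longrightarrow> \<beta> ^ m \<noteq> 1) \<Longrightarrow> card (conjugates \<beta>) \<le> D \<Longrightarrow>
        \<delta> \<le> (\<Sum>b\<in>conjugates \<beta>. ln (max 1 (norm b)))"
    and Q: "Q \<ge> 1" and \<Lambda>: "\<Lambda> = 2 * real Q ^ (n - 1)"
    and T: "2 * A \<le> T" "ln T \<ge> 7"
    and small1: "2 * real n * real D * ln (real a * (T + A)) / real Q < ln 2"
      "2 * real n * real D * ln (real a * (T + A)) / real Q < \<delta>"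
    and small2: "9 * real D ^ 3 * (real n * \<Lambda> * (2 * A / T)) ^ 2 < 6 ^ 2"
    and small3: "real a ^ (n * d) * (real n * \<Lambda> * A ^ n) ^ (d - 1) * (2 * real n * real n * \<Lambda> * A ^ Suc n / T) < 1"
  shows "mult_independent n (\<lambda>i. \<alpha> i + t)"
proof -
  have algt: "algebraic t" using t(1) by auto
  have Tpos: "T > 0" using T(1) A(1) by linarith
  have \<Lambda>1: "\<Lambda> \<ge> 1" 
  proof -
    have "1 \<le> real Q ^ (n - 1)" using Q by (intro one_le_power) auto
    thus ?thesis unfolding \<Lambda> by linarith
  qed
  \<comment> \<open>At an embedding where \<open>t\<close> has its largest modulus the expansion in
    \<open>1 / \<tau>\<close> is most accurate; all conjugates of \<open>t\<close> are bounded by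
    the same \<open>T\<close>.\<close>
  obtain \<tau> where \<tau>: "\<tau> \<in> conjugates t" "norm \<tau> = T" using house_attained[OF algt] t(2) by blast
  then obtain \<eta> where \<eta>: "\<eta> \<in> conjugates \<xi>" "\<tau> = emb \<xi> \<eta> t" using conjugates_qext[OF \<xi>(1,3)] by auto
  define z where "z = (\<lambda>i. \<alpha> i + t)"
  define a' where "a' = (\<lambda>i. emb \<xi> \<eta> (\<alpha> i))"
  define \<theta>0 where "\<theta>0 = emb \<xi> \<eta> \<theta>"
  have \<alpha>\<xi>: "\<alpha> i \<in> qext \<xi>" if "i \<in> {1..n}" for i using qext_trans[OF \<theta>(2)[OF that] \<xi>(2)] .
  have zq: "z i \<in> qext \<xi>" if "i \<in> {1..n}" for i
    unfolding z_def by (intro qext_add \<alpha>\<xi>[OF that] \<xi>(3))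
  have \<theta>0: "\<theta>0 \<in> conjugates \<theta>" unfolding \<theta>0_def by (rule emb_tower(1)[OF \<xi>(1,2) \<eta>(1)])
  have a'_eq: "a' i = emb \<theta> \<theta>0 (\<alpha> i)" if "i \<in> {1..n}" for i
    unfolding a'_def \<theta>0_def by (rule emb_tower(2)[OF \<xi>(1,2) \<eta>(1) \<theta>(2)[OF that]])
  have emb\<alpha>: "norm (emb \<xi> \<eta>' (\<alpha> i)) \<le> A" if "i \<in> {1..n}" "\<eta>' \<in> conjugates \<xi>" for i \<eta>'
    using emb_tower[OF \<xi>(1,2) that(2)] A(2)[OF _ that(1)] \<theta>(2)[OF that(1)] by simp
  have a'A: "norm (a' i) \<le> A" if "i \<in> {1..n}" for i unfolding a'_def by (rule emb\<alpha>[OF that \<eta>(1)])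
  have embz: "emb \<xi> \<eta> (z i) = a' i + \<tau>" if "i \<in> {1..n}" for i
    unfolding z_def a'_def \<eta>(2) by (rule emb_add[OF \<xi>(1) \<eta>(1) \<alpha>\<xi>[OF that] \<xi>(3)])
  have z0: "z i \<noteq> 0" if i: "i \<in> {1..n}" for i
  proof
    assume "z i = 0"
    hence "a' i + \<tau> = 0" using embz[OF i] emb_0[OF \<xi>(1) \<eta>(1)] by simp
    hence "\<tau> = - a' i" by (simp add: eq_neg_iff_add_eq_0 add.commute)
    hence "T \<le> A" using a'A[OF i] \<tau>(2) by simp
    thus False using T(1) A(1) by linarith
  qed
  have "\<not> mult_dependent n z"
  proof
    assume "mult_dependent n z"
    then obtain k i1 where k: "i1 \<in> {1..n}" "k i1 \<noteq> 0" "(\<Prod>i\<in>{1..n}. z i powi k i) = 1"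
      unfolding mult_dependent_def by blast
    let ?K = "(\<lambda>i. \<bar>k i\<bar>) ` {1..n}"
    have "Max ?K \<in> ?K" using k(1) by (intro Max_in) auto
    then obtain i0 where i0_max: "i0 \<in> {1..n}" "Max ?K = \<bar>k i0\<bar>" by auto
    have i0: "i0 \<in> {1..n}" "\<And>i. i \<in> {1..n} \<Longrightarrow> \<bar>k i\<bar> \<le> \<bar>k i0\<bar>"
      unfolding i0_max(2)[symmetric] by (rule i0_max(1)) (rule Max_ge, auto)
    have ki0: "k i0 \<noteq> 0" using i0(2)[OF k(1)] k(2) by auto
    obtain l :: "nat \<Rightarrow> int" where l: "l i0 \<ge> 1"
      "\<And>i. i \<in> {1..n} \<Longrightarrow> \<bar>real_of_int (l i)\<bar> \<le> 2 * real Q ^ (n - 1)"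
      "\<And>i. i \<in> {1..n} \<Longrightarrow> \<bar>real_of_int (l i0) * (real_of_int (k i) / real_of_int (k i0)) - real_of_int (l i)\<bar> \<le> 1 / real Q"
      using approximate_integer_direction[of i0 n k Q] i0 ki0 Q by blast
    have l\<Lambda>: "\<bar>real_of_int (l i)\<bar> \<le> \<Lambda>" if "i \<in> {1..n}" for i using l(2)[OF that] by (simp add: \<Lambda>)
    define \<beta> where "\<beta> = (\<Prod>i\<in>{1..n}. z i powi l i)"
    define H where "H = real a * (T + A)"
    have TA: "T + A \<ge> 1" using A(1) Tpos by simp
    have aH: "real a \<le> H" unfolding H_def using TA mult_left_mono[of 1 "T + A" "real a"] by simp
    have H1: "H \<ge> 1" using aH a(1) by linarith
    have gH: "norm (emb \<xi> \<eta>' (of_nat a * z i)) \<le> H" if i: "i \<in> {1..n}" and \<eta>': "\<eta>' \<in> conjugates \<xi>" for i \<eta>'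
    proof -
      have "emb \<xi> \<eta>' t \<in> conjugates t" using conjugates_qext[OF \<xi>(1,3)] \<eta>' by auto
      hence "norm (emb \<xi> \<eta>' t) \<le> T" using norm_house_le[OF algt] t(2) by simp
      hence "norm (emb \<xi> \<eta>' (\<alpha> i) + emb \<xi> \<eta>' t) \<le> T + A"
        using norm_triangle_ineq[of "emb \<xi> \<eta>' (\<alpha> i)" "emb \<xi> \<eta>' t"] emb\<alpha>[OF i \<eta>'] by linarith
      moreover have "emb \<xi> \<eta>' (of_nat a * z i) = of_nat a * (emb \<xi> \<eta>' (\<alpha> i) + emb \<xi> \<eta>' t)"
        using emb_mult[OF \<xi>(1) \<eta>' qext_of_nat zq[OF i]] emb_of_nat[OF \<xi>(1) \<eta>'] emb_add[OF \<xi>(1) \<eta>' \<alpha>\<xi>[OF i] \<xi>(3)]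
        by (simp add: z_def)
      ultimately show ?thesis by (simp add: H_def norm_mult mult_left_mono)
    qed
    have ai: "algebraic_int (of_nat a * z i)" if "i \<in> {1..n}" for i
      unfolding z_def distrib_left
      by (rule algebraic_int_add[OF a(2)[OF that] algebraic_int_mult[OF algebraic_int_of_nat t(1)]])
    have cardD: "2 * real n * real (card (conjugates \<xi>)) * ln H / real Q \<le> 2 * real n * real D * ln H / real Q"
      using \<xi>(4) H1 by (intro divide_right_mono mult_right_mono mult_left_mono) auto
    have sm: "2 * real n * real (card (conjugates \<xi>)) * ln H / real Q < ln 2"
      using cardD small1(1) by (simp add: H_def)
    note height = small_height_of_approximate_relation[OF \<xi>(1) zq z0 ai a(1) aH gH k(3) ki0 i0(2) Q l(3) sm \<beta>_def]
    have \<beta>i: "algebraic_int \<beta>" by (rule height(1))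
    have \<beta>L: "(\<Sum>b\<in>conjugates \<beta>. ln (max 1 (norm b))) < \<delta>"
      using height(2) cardD small1(2) unfolding H_def by linarith
    have \<beta>0: "\<beta> \<noteq> 0" using z0 by (auto simp: \<beta>_def power_int_eq_0_iff)
    have \<beta>q: "\<beta> \<in> qext \<xi>" unfolding \<beta>_def by (intro qext_prod qext_powi[OF \<xi>(1)] zq)
    have \<beta>D: "card (conjugates \<beta>) \<le> D"
      unfolding conjugates_qext[OF \<xi>(1) \<beta>q]
      using card_image_le[OF finite_conjugates[OF \<xi>(1)]] \<xi>(4) by (meson order_trans)
    have "\<exists>m>0. \<beta> ^ m = 1"
    proof (rule ccontr)
      assume "\<not> (\<exists>m>0. \<beta> ^ m = 1)"
      hence "\<delta> \<le> (\<Sum>b\<in>conjugates \<beta>. ln (max 1 (norm b)))" using \<beta>i \<beta>0 \<beta>D by (intro dob) blast+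
      thus False using \<beta>L by simp
    qed
    then obtain w where w: "w > 0" "\<beta> ^ w = 1" "real w ^ 2 \<le> 9 * real D ^ 3"
      using root_of_unity_order_bound[OF _ _ algebraic_qext[OF \<xi>(1) \<beta>q] \<beta>D] by blast
    have "emb \<xi> \<eta> \<beta> = (\<Prod>i\<in>{1..n}. (a' i + \<tau>) powi l i)"
      unfolding \<beta>_def
      by (subst emb_prod[OF \<xi>(1) \<eta>(1)])
        (auto simp: qext_powi[OF \<xi>(1)] zq emb_powi[OF \<xi>(1) \<eta>(1)] embz intro!: prod.cong)
    hence w1: "(\<Prod>i\<in>{1..n}. (a' i + \<tau>) powi l i) ^ w = 1"
      using w(2) emb_power[OF \<xi>(1) \<eta>(1) \<beta>q, of w] emb_1[OF \<xi>(1) \<eta>(1)] by simp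
    define X where "X = real n * \<Lambda> * (2 * A / T)"
    \<comment> \<open>The order of \<open>\<beta>\<close> is bounded through its square, so the
      smallness condition is stated for squares and avoids the exponent 3/2.\<close>
    have "(real w * X) ^ 2 \<le> 9 * real D ^ 3 * X ^ 2"
      unfolding power_mult_distrib using w(3) by (intro mult_right_mono) auto
    also have "\<dots> < 6 ^ 2" using small2 by (simp add: X_def)
    finally have "real w * X < 6" by (rule power_less_imp_less_base) simp
    hence wX: "real w * (real (card {1..n}) * \<Lambda> * (2 * A / norm \<tau>)) < 6" by (simp add: X_def \<tau>(2))
    have T': "2 * A \<le> norm \<tau>" "ln (norm \<tau>) \<ge> 7" "norm \<tau> > 0" using T Tpos \<tau>(2) by auto
    have A0: "A \<ge> 0" using A(1) by simp
    note logrel = log_relation_of_root_of_unity[OF finite_atLeastAtMost a'A A0 l\<Lambda> T' w(1) w1 wX]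
    \<comment> \<open>Exponent 0 comes from the vanishing sum of \<open>l\<close> and exponents 1 to
      \<open>n - 1\<close> from the logarithmic relation: just the \<open>n\<close> power sums that
      the Vandermonde argument requires.\<close>
    have sum0: "(\<Sum>i\<in>{1..n}. of_int (l i) * \<alpha> i ^ j) = 0" if "j < n" for j
      using that
    proof (induction j rule: less_induct)
      case (less j)
      show ?case
      proof (cases "j = 0")
        case True
        have "(\<Sum>i\<in>{1..n}. of_int (l i)) = (0 :: complex)"
          using arg_cong[OF logrel(1), of "of_int :: int \<Rightarrow> complex"] by simp
        thus ?thesis using True by simp
      next
        case False
        have zero: "(\<Sum>i\<in>{1..n}. of_int (l i) * a' i ^ h) = 0" if h: "1 \<le> h" "h < j" for h
        proof -
          have "emb \<xi> \<eta> (\<Sum>i\<in>{1..n}. of_int (l i) * \<alpha> i ^ h) = (\<Sum>i\<in>{1..n}. of_int (l i) * a' i ^ h)"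
            unfolding a'_def by (rule emb_power_sum[OF \<xi>(1) \<eta>(1) \<alpha>\<xi>])
          thus ?thesis using less.IH[of h] less.prems h emb_0[OF \<xi>(1) \<eta>(1)] by simp
        qed
        have j1: "j \<ge> 1" using False by simp
        have "norm (\<Sum>i\<in>{1..n}. of_int (l i) * a' i ^ j) \<le> 2 * real j * real (card {1..n}) * \<Lambda> * A ^ Suc j / norm \<tau>"
          by (rule power_sum_bound_from_log_relation[OF finite_atLeastAtMost logrel(2) a'A A0 l\<Lambda> T'(1,3) j1 zero])
        also have "\<dots> \<le> 2 * real n * real n * \<Lambda> * A ^ Suc n / T"
          using less.prems A(1) \<Lambda>1 Tpos unfolding \<tau>(2)
          by (intro divide_right_mono mult_mono power_increasing) auto
        finally have "norm (\<Sum>i\<in>{1..n}. of_int (l i) * emb \<theta> \<theta>0 (\<alpha> i) ^ j) \<le> 2 * real n * real n * \<Lambda> * A ^ Suc n / T"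
          by (simp add: a'_eq)
        thus ?thesis using less.prems
          by (intro power_sum_zero_if_small_conjugate[OF \<theta>(1,2) a A \<Lambda>1 l\<Lambda> n _ \<theta>(3) \<theta>0 _ small3]) auto
      qed
    qed
    have "of_int (l i0) = (0 :: complex)"
      by (rule coefficients_zero_if_power_sums_zero[OF finite_atLeastAtMost inj _ i0(1)]) (rule sum0, simp)
    thus False using l(1) by simp
  qed
  thus ?thesis using z0 unfolding mult_independent_def z_def by simp
qed

section \<open>Choice of the numerical parameters\<close>

lemma power_ratio_le:
  fixes y :: real
  assumes "y \<ge> 1" "p + 1 \<le> q" "K \<ge> 0"
  shows "K * y ^ p / y ^ q \<le> K / y"
proof -
  have "y ^ p * y \<le> y ^ q" using power_increasing[OF assms(2,1)] by (simp add: mult.commute)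
  hence "K * (y ^ p * y) \<le> K * y ^ q" using assms(3) by (rule mult_left_mono)
  thus ?thesis using assms(1) by (simp add: field_simps)
qed

text \<open>The parameters are powers of \<open>y = T^(1/(8n(nd+1)))\<close>: the degree is at most \<open>d y^(8n)\<close>,
  the approximation quality is \<open>Q \<approx> y^(8n+2)\<close>.\<close>

lemma parameter_choice:
  fixes n d a :: nat and A c :: real
  assumes n: "n \<ge> 1" and d: "d \<ge> 1" and a: "a \<ge> 1" and A: "A \<ge> 1" and c: "c > 0"
  shows "\<exists>Y\<ge>1. \<forall>y\<ge>Y. \<forall>T Q \<Lambda> D. T = y ^ (8 * n * (n * d + 1)) \<longrightarrow> Q = nat \<lceil>y ^ (8 * n + 2)\<rceil> \<longrightarrow>
    \<Lambda> = 2 * real Q ^ (n - 1) \<longrightarrow> real D \<le> real d * y ^ (8 * n) \<longrightarrow>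
      2 * A \<le> T \<and> 7 \<le> ln T \<and> Q \<ge> 1 \<and>
      2 * real n * real D * ln (real a * (T + A)) / real Q < ln 2 \<and>
      2 * real n * real D * ln (real a * (T + A)) / real Q < c / (2 * y) \<and>
      9 * real D ^ 3 * (real n * \<Lambda> * (2 * A / T)) ^ 2 < 6 ^ 2 \<and>
      real a ^ (n * d) * (real n * \<Lambda> * A ^ n) ^ (d - 1) * (2 * real n * real n * \<Lambda> * A ^ Suc n / T) < 1"
proof -
  define M where "M = 8 * n * (n * d + 1)"
  \<comment> \<open>The exponent of \<open>y\<close> in \<open>\<Lambda>\<close>, equal to
    \<open>8 n^2 - 6 n - 2\<close>; it is compared with the exponent \<open>M\<close> of
    \<open>T\<close>, equal to \<open>8 n^2 d + 8 n\<close>.\<close>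
  define e where "e = (8 * n + 2) * (n - 1)"
  define c1 where "c1 = 2 * real n * real d * ln (2 * real a)"
  define c2 where "c2 = 2 * real n * real d * real M"
  define K1 where "K1 = 9 * real d ^ 3 * (real n * 2 ^ n * (2 * A)) ^ 2"
  define K2 where "K2 = real a ^ (n * d) * (real n * 2 ^ n * A ^ n) ^ (d - 1) * (2 * real n * real n * 2 ^ n * A ^ Suc n)"
  have M1: "M \<ge> 1" using n by (simp add: M_def)
  have "eventually (\<lambda>y::real. (c1 + c2 * ln y) / y ^ 2 < ln 2) at_top" by real_asymp
  moreover have "eventually (\<lambda>y::real. c1 + c2 * ln y < (c / 2) * y) at_top" using c by real_asymp
  moreover have "eventually (\<lambda>y::real. y \<ge> Max {1, 2 * A, exp 7, K1, K2 + 1}) at_top" by (rule eventually_ge_at_top)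
  ultimately have "eventually (\<lambda>y::real. (c1 + c2 * ln y) / y ^ 2 < ln 2 \<and> c1 + c2 * ln y < (c / 2) * y \<and>
      y \<ge> Max {1, 2 * A, exp 7, K1, K2 + 1}) at_top"
    by eventually_elim auto
  then obtain Y where Y: "\<And>y. y \<ge> Y \<Longrightarrow> (c1 + c2 * ln y) / y ^ 2 < ln 2 \<and> c1 + c2 * ln y < (c / 2) * y \<and>
      y \<ge> Max {1, 2 * A, exp 7, K1, K2 + 1}"
    unfolding eventually_at_top_linorder by blast
  have main: "2 * A \<le> T \<and> 7 \<le> ln T \<and> Q \<ge> 1 \<and>
      2 * real n * real D * ln (real a * (T + A)) / real Q < ln 2 \<and>
      2 * real n * real D * ln (real a * (T + A)) / real Q < c / (2 * y) \<and>
      9 * real D ^ 3 * (real n * \<Lambda> * (2 * A / T)) ^ 2 < 6 ^ 2 \<and>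
      real a ^ (n * d) * (real n * \<Lambda> * A ^ n) ^ (d - 1) * (2 * real n * real n * \<Lambda> * A ^ Suc n / T) < 1"
    if y: "y \<ge> Y" and T: "T = y ^ M" and Q: "Q = nat \<lceil>y ^ (8 * n + 2)\<rceil>"
      and \<Lambda>: "\<Lambda> = 2 * real Q ^ (n - 1)" and D: "real D \<le> real d * y ^ (8 * n)" for y T Q \<Lambda> D
  proof -
    have y1: "y \<ge> 1" and yA: "y \<ge> 2 * A" and ye: "y \<ge> exp 7" and yK1: "y \<ge> K1" and yK2: "y \<ge> K2 + 1"
      and E1: "(c1 + c2 * ln y) / y ^ 2 < ln 2" and E2: "c1 + c2 * ln y < (c / 2) * y"
      using Y[OF y] by auto
    have yT: "y \<le> T" unfolding T using power_increasing[OF M1 y1] by simp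
    have Tpos: "T > 0" using yT y1 by linarith
    have AT: "2 * A \<le> T" using yA yT by linarith
    have lnT: "ln T = real M * ln y" unfolding T by (rule ln_realpow)
    have "exp 7 \<le> T" using ye yT by linarith
    hence T7: "7 \<le> ln T" using Tpos by (simp add: ln_ge_iff)
    have yp: "y ^ (8 * n + 2) \<ge> 1" using y1 by (rule one_le_power)
    have Qge: "real Q \<ge> y ^ (8 * n + 2)" unfolding Q by (rule real_nat_ceiling_ge)
    have Qle: "real Q \<le> 2 * y ^ (8 * n + 2)" unfolding Q using yp by linarith
    have Q1: "Q \<ge> 1" using Qge yp by (metis of_nat_1 of_nat_le_iff order_trans)
    have \<Lambda>le: "\<Lambda> \<le> 2 ^ n * y ^ e"
    proof -
      have "real Q ^ (n - 1) \<le> (2 * y ^ (8 * n + 2)) ^ (n - 1)" using Qle by (intro power_mono) auto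
      also have "\<dots> = 2 ^ (n - 1) * y ^ e" unfolding e_def power_mult_distrib power_mult by simp
      finally have "\<Lambda> \<le> 2 * 2 ^ (n - 1) * y ^ e" by (simp add: \<Lambda>)
      also have "(2::real) * 2 ^ (n - 1) = 2 ^ n" using n by (cases n) auto
      finally show ?thesis .
    qed
    have \<Lambda>0: "\<Lambda> \<ge> 0" by (simp add: \<Lambda>)
    define X where "X = ln (real a * (T + A))"
    have Xle: "X \<le> ln (2 * real a) + real M * ln y"
    proof -
      have "real a * (T + A) \<le> (2 * real a) * T" using AT A a by (simp add: algebra_simps mult_left_mono)
      hence "X \<le> ln ((2 * real a) * T)" unfolding X_def using a Tpos A by (intro ln_mono mult_pos_pos) auto
      also have "\<dots> = ln (2 * real a) + ln T" using a Tpos by (intro ln_mult_pos) auto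
      finally show ?thesis unfolding lnT .
    qed
    have "1 * 1 \<le> real a * (T + A)" using a A Tpos by (intro mult_mono) auto
    hence X0: "X \<ge> 0" unfolding X_def by simp
    \<comment> \<open>\<open>Q\<close> exceeds the degree by \<open>y ^ 2\<close> up to a constant:
      one power of \<open>y\<close> beats \<open>ln y\<close>, the other reaches the required
      \<open>c / (2 * y)\<close>.\<close>
    have key: "2 * real n * real D * X / real Q \<le> (c1 + c2 * ln y) / y ^ 2"
    proof -
      have "2 * real n * real D * X / real Q \<le> 2 * real n * (real d * y ^ (8 * n)) * X / y ^ (8 * n + 2)"
        using D X0 Qge y1 by (intro frac_le mult_right_mono mult_left_mono) auto
      also have "\<dots> = 2 * real n * real d * X / y ^ 2" using y1 by (simp add: power_add power2_eq_square)
      also have "\<dots> \<le> 2 * real n * real d * (ln (2 * real a) + real M * ln y) / y ^ 2"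
        using Xle by (intro divide_right_mono mult_left_mono) auto
      finally show ?thesis by (simp add: c1_def c2_def algebra_simps)
    qed
    have s1: "2 * real n * real D * X / real Q < ln 2" using key E1 by linarith
    have "(c1 + c2 * ln y) / y ^ 2 < ((c / 2) * y) / y ^ 2" using E2 y1 by (intro divide_strict_right_mono) auto
    also have "\<dots> = c / (2 * y)" using y1 by (simp add: power2_eq_square)
    finally have s2: "2 * real n * real D * X / real Q < c / (2 * y)" using key by linarith
    have s3: "9 * real D ^ 3 * (real n * \<Lambda> * (2 * A / T)) ^ 2 < 6 ^ 2"
    proof -
      have "9 * real D ^ 3 * (real n * \<Lambda> * (2 * A / T)) ^ 2
          \<le> 9 * (real d * y ^ (8 * n)) ^ 3 * (real n * (2 ^ n * y ^ e) * (2 * A / T)) ^ 2"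
        using D \<Lambda>le \<Lambda>0 A Tpos y1
        by (intro mult_mono power_mono mult_right_mono mult_left_mono) (auto intro!: mult_nonneg_nonneg)
      also have "\<dots> = K1 * ((y ^ (8 * n)) ^ 3 * (y ^ e) ^ 2) / T ^ 2"
        by (simp add: K1_def power_mult_distrib power_divide)
      also have "(y ^ (8 * n)) ^ 3 * (y ^ e) ^ 2 = y ^ (24 * n + 2 * e)"
        by (simp add: mult.commute add.commute flip: power_mult power_add)
      also have "T ^ 2 = y ^ (2 * M)" unfolding T by (simp add: mult.commute flip: power_mult)
      \<comment> \<open>The exponent \<open>16 n^2 + 12 n - 4\<close> must stay below
        \<open>16 n^2 d + 16 n\<close>. This is tight for \<open>d = 1\<close>: a fourth power of
        \<open>D\<close> would already break it.\<close>
      also have "K1 * y ^ (24 * n + 2 * e) / y ^ (2 * M) \<le> K1 / y"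
      proof (rule power_ratio_le[OF y1])
        have "n * n * 1 \<le> n * n * d" using d by (intro mult_le_mono) auto
        moreover have "M = 8 * (n * n * d) + 8 * n" by (simp add: M_def algebra_simps)
        moreover have "e + 6 * n + 2 = 8 * (n * n)" using n by (cases n) (auto simp: e_def algebra_simps)
        ultimately show "24 * n + 2 * e + 1 \<le> 2 * M" using n by linarith
      qed (simp add: K1_def)
      also have "\<dots> \<le> 1" using yK1 y1 by simp
      finally show ?thesis by simp
    qed
    have s4: "real a ^ (n * d) * (real n * \<Lambda> * A ^ n) ^ (d - 1) * (2 * real n * real n * \<Lambda> * A ^ Suc n / T) < 1"
    proof -
      have "real a ^ (n * d) * (real n * \<Lambda> * A ^ n) ^ (d - 1) * (2 * real n * real n * \<Lambda> * A ^ Suc n / T)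
          \<le> real a ^ (n * d) * (real n * (2 ^ n * y ^ e) * A ^ n) ^ (d - 1) * (2 * real n * real n * (2 ^ n * y ^ e) * A ^ Suc n / T)"
        using \<Lambda>le \<Lambda>0 A Tpos y1
        by (intro mult_mono power_mono divide_right_mono mult_right_mono mult_left_mono)
          (auto intro!: mult_nonneg_nonneg divide_nonneg_nonneg)
      also have "\<dots> = K2 * ((y ^ e) ^ (d - 1) * y ^ e) / T"
        by (simp add: K2_def power_mult_distrib)
      also have "(y ^ e) ^ (d - 1) * y ^ e = y ^ (e * d)"
        using d by (cases d) (simp_all add: power_mult[symmetric] power_add[symmetric] mult.commute)
      also have "K2 * y ^ (e * d) / T \<le> K2 / y" unfolding T
      proof (rule power_ratio_le[OF y1])
        have "e + 6 * n + 2 = 8 * (n * n)" using n by (cases n) (auto simp: e_def algebra_simps)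
        hence "e * d \<le> 8 * (n * n) * d" by (intro mult_le_mono) linarith+
        moreover have "M = 8 * (n * n) * d + 8 * n" by (simp add: M_def algebra_simps)
        ultimately show "e * d + 1 \<le> M" using n by linarith
      qed (use A in \<open>simp add: K2_def\<close>)
      also have "\<dots> < 1" using yK2 y1 by simp
      finally show ?thesis .
    qed
    show ?thesis using AT T7 Q1 s1 s2 s3 s4 unfolding X_def by blast
  qed
  have "max 1 Y \<ge> 1" by simp
  moreover have "\<forall>y\<ge>max 1 Y. y \<ge> Y" by simp
  ultimately show ?thesis using main unfolding M_def by (intro exI[of _ "max 1 Y"]) blast
qed

lemma common_denominator:
  assumes "finite I" "\<And>i. i \<in> I \<Longrightarrow> algebraic (\<alpha> i :: complex)"
  obtains a :: nat where "a \<ge> 1" "\<And>i. i \<in> I \<Longrightarrow> algebraic_int (of_nat a * \<alpha> i)"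
proof -
  have "\<forall>i\<in>I. \<exists>a::nat. a > 0 \<and> algebraic_int (of_nat a * \<alpha> i)"
    using assms(2) algebraic_int_denominator by blast
  then obtain b :: "_ \<Rightarrow> nat" where b: "\<And>i. i \<in> I \<Longrightarrow> b i > 0 \<and> algebraic_int (of_nat (b i) * \<alpha> i)" by metis
  show ?thesis
  proof (rule that[of "\<Prod>i\<in>I. b i"])
    have "(\<Prod>i\<in>I. b i) > 0" using b by (intro prod_pos) auto
    thus "(\<Prod>i\<in>I. b i) \<ge> 1" by simp
    fix i assume i: "i \<in> I"
    have "of_nat (\<Prod>i\<in>I. b i) * \<alpha> i = of_nat (\<Prod>i\<in>I - {i}. b i) * (of_nat (b i) * \<alpha> i)"
      using prod.remove[OF assms(1) i, of b] by (simp add: mult_ac)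
    thus "algebraic_int (of_nat (\<Prod>i\<in>I. b i) * \<alpha> i)"
      using b[OF i] algebraic_int_mult[OF algebraic_int_of_nat] by metis
  qed
qed

theorem theorem3p1:
  fixes n d :: nat and \<alpha> :: "nat \<Rightarrow> complex"
  assumes "n \<ge> 1"
    and "\<forall>i\<in>{1..n}. algebraic (\<alpha> i)"
    and "inj_on \<alpha> {1..n}"
    and "d = ext_degree (rat_adjoin (\<alpha> ` {1..n}))"
  shows "\<exists>C::real. C > 0 \<and>
    (\<forall>t::complex. algebraic_int t \<longrightarrow>
       real (deg_over_rat t) \<le> house t powr (1 / real (n * d + 1)) \<longrightarrow>
       house t \<ge> C \<longrightarrow>
       mult_independent n (\<lambda>i. \<alpha> i + t))"
proof -
  obtain \<theta> where \<theta>: "algebraic \<theta>" "\<alpha> ` {1..n} \<subseteq> qext \<theta>" "rat_adjoin (\<alpha> ` {1..n}) = qext \<theta>"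
    using rat_adjoin_primitive_element[of "\<alpha> ` {1..n}"] assms(2) by blast
  have \<theta>d: "card (conjugates \<theta>) \<le> d"
    using deg_over_rat_le_ext_degree[OF \<theta>(1)] card_conjugates[OF \<theta>(1)]
    unfolding assms(4) \<theta>(3) by simp
  have d1: "d \<ge> 1"
    using \<theta>d card_conjugates_pos[OF \<theta>(1)] by linarith
  have \<alpha>\<theta>: "\<alpha> i \<in> qext \<theta>" if "i \<in> {1..n}" for i using that \<theta>(2) by blast
  obtain a :: nat where a: "a \<ge> 1" "\<And>i. i \<in> {1..n} \<Longrightarrow> algebraic_int (of_nat a * \<alpha> i)"
    using common_denominator[of "{1..n}" \<alpha>] assms(2) by blast
  \<comment> \<open>A crude sum in place of a maximum; the added 1 gives
    \<open>A \<ge> 1\<close>.\<close>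
  define A where "A = 1 + (\<Sum>\<theta>'\<in>conjugates \<theta>. \<Sum>i\<in>{1..n}. norm (emb \<theta> \<theta>' (\<alpha> i)))"
  have A1: "A \<ge> 1" unfolding A_def by (simp add: sum_nonneg)
  have A: "norm (emb \<theta> \<theta>' (\<alpha> i)) \<le> A" if "\<theta>' \<in> conjugates \<theta>" "i \<in> {1..n}" for \<theta>' i
  proof -
    have "norm (emb \<theta> \<theta>' (\<alpha> i)) \<le> (\<Sum>i\<in>{1..n}. norm (emb \<theta> \<theta>' (\<alpha> i)))"
      using that by (intro member_le_sum) auto
    also have "\<dots> \<le> (\<Sum>\<theta>'\<in>conjugates \<theta>. \<Sum>i\<in>{1..n}. norm (emb \<theta> \<theta>' (\<alpha> i)))"
      using that finite_conjugates[OF \<theta>(1)]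
      by (intro member_le_sum[of \<theta>' _ "\<lambda>\<theta>'. \<Sum>i\<in>{1..n}. norm (emb \<theta> \<theta>' (\<alpha> i))"]) (auto intro: sum_nonneg)
    finally show ?thesis by (simp add: A_def)
  qed
  obtain c P0 where c: "c > 0" and dob: "\<And>P \<beta>. P \<ge> P0 \<Longrightarrow> algebraic_int \<beta> \<Longrightarrow> \<beta> \<noteq> 0 \<Longrightarrow> (\<forall>m>0. \<beta> ^ m \<noteq> 1) \<Longrightarrow>
      card (conjugates \<beta>) \<le> P ^ (8 * n + 1) \<Longrightarrow> c / real P \<le> (\<Sum>b\<in>conjugates \<beta>. ln (max 1 (norm b)))"
    using dobrowolski_weak[of "8 * n + 1"] by blast
  define M where "M = 8 * n * (n * d + 1)"
  obtain Y where Y1: "Y \<ge> 1" and Y: "\<And>y T Q \<Lambda> D. y \<ge> Y \<Longrightarrow> T = y ^ M \<Longrightarrow> Q = nat \<lceil>y ^ (8 * n + 2)\<rceil> \<Longrightarrow>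
    \<Lambda> = 2 * real Q ^ (n - 1) \<Longrightarrow> real D \<le> real d * y ^ (8 * n) \<Longrightarrow>
      2 * A \<le> T \<and> 7 \<le> ln T \<and> Q \<ge> 1 \<and>
      2 * real n * real D * ln (real a * (T + A)) / real Q < ln 2 \<and>
      2 * real n * real D * ln (real a * (T + A)) / real Q < c / (2 * y) \<and>
      9 * real D ^ 3 * (real n * \<Lambda> * (2 * A / T)) ^ 2 < 6 ^ 2 \<and>
      real a ^ (n * d) * (real n * \<Lambda> * A ^ n) ^ (d - 1) * (2 * real n * real n * \<Lambda> * A ^ Suc n / T) < 1"
    using parameter_choice[OF assms(1) d1 a(1) A1 c] unfolding M_def by blast
  \<comment> \<open>Besides reaching the thresholds, \<open>y \<ge> d\<close> gives
    \<open>d * y ^ (8 * n) \<le> y ^ (8 * n + 1)\<close>, which matches the exponent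
    \<open>J = 8 * n + 1\<close> chosen for Dobrowolski's bound.\<close>
  define Y' where "Y' = Y + real P0 + real d"
  have Y': "Y' \<ge> 1" "Y' \<ge> Y" "Y' \<ge> real P0" "Y' \<ge> real d" using Y1 by (auto simp: Y'_def)
  have M0: "M > 0" using assms(1) by (simp add: M_def)
  have "mult_independent n (\<lambda>i. \<alpha> i + t)"
    if t: "algebraic_int t" and deg: "real (deg_over_rat t) \<le> house t powr (1 / real (n * d + 1))"
      and large: "house t \<ge> Y' ^ M" for t
  proof -
    define T where "T = house t"
    define y where "y = T powr (1 / real M)"
    have algt: "algebraic t" using t by auto
    have YM: "Y' ^ M \<ge> 1" using Y'(1) by (rule one_le_power)
    have T1: "T \<ge> 1" using large YM by (simp add: T_def)
    have Ty: "T = y ^ M" unfolding y_def using T1 M0 by (simp add: powr_realpow[symmetric] powr_powr)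
    have yY: "y \<ge> Y'"
    proof (rule ccontr)
      assume "\<not> y \<ge> Y'"
      hence "y ^ M < Y' ^ M" using M0 by (intro power_strict_mono) (auto simp: y_def)
      thus False using large Ty by (simp add: T_def)
    qed
    have y1: "y \<ge> 1" using yY Y'(1) by linarith
    \<comment> \<open>By the choice of \<open>M\<close>, this power of \<open>y\<close> is exactly
      the degree permitted for \<open>t\<close>.\<close>
    have "y ^ (8 * n) = T powr (real (8 * n) / real M)"
      unfolding y_def using T1 by (simp add: powr_realpow[symmetric] powr_powr)
    also have "real (8 * n) / real M = 1 / real (n * d + 1)"
      unfolding M_def of_nat_mult[of "8 * n" "n * d + 1"]
      by (rule nonzero_divide_mult_cancel_left) (use assms(1) in simp)
    finally have yx: "T powr (1 / real (n * d + 1)) = y ^ (8 * n)" by simp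
    obtain k :: nat where k: "algebraic (\<theta> + of_nat k * t)" "\<theta> \<in> qext (\<theta> + of_nat k * t)"
      "t \<in> qext (\<theta> + of_nat k * t)" "deg_over_rat (\<theta> + of_nat k * t) \<le> deg_over_rat \<theta> * deg_over_rat t"
      using primitive_element[OF \<theta>(1) algt] by blast
    define D where "D = d * deg_over_rat t"
    have cardD: "card (conjugates (\<theta> + of_nat k * t)) \<le> D"
    proof -
      have "deg_over_rat \<theta> * deg_over_rat t \<le> D"
        unfolding D_def using \<theta>d card_conjugates[OF \<theta>(1)] by (intro mult_le_mono1) simp
      thus ?thesis using k(4) card_conjugates[OF k(1)] by linarith
    qed
    have Dy: "real D \<le> real d * y ^ (8 * n)"
      using deg yx by (simp add: D_def T_def mult_left_mono)
    define Q where "Q = nat \<lceil>y ^ (8 * n + 2)\<rceil>"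
    define \<Lambda> where "\<Lambda> = 2 * real Q ^ (n - 1)"
    have yY0: "y \<ge> Y" using yY Y'(2) by linarith
    note num = Y[OF yY0 Ty Q_def \<Lambda>_def Dy]
    \<comment> \<open>Dobrowolski's bound is stated for natural numbers; rounding up at most doubles
      \<open>y\<close>, which explains the 2 in \<open>c / (2 * y)\<close>.\<close>
    define P where "P = nat \<lceil>y\<rceil>"
    have Py: "y \<le> real P" "real P \<le> 2 * y" unfolding P_def using y1 by linarith+
    have "real P0 \<le> real P" using yY Y'(3) Py(1) by linarith
    hence PP: "P \<ge> P0" by simp
    have DP: "D \<le> P ^ (8 * n + 1)"
    proof -
      have "real d * y ^ (8 * n) \<le> y * y ^ (8 * n)" using yY Y'(4) y1 by (intro mult_right_mono) auto
      hence "real D \<le> y * y ^ (8 * n)" using Dy by linarith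
      also have "\<dots> = y ^ (8 * n + 1)" by simp
      also have "\<dots> \<le> real P ^ (8 * n + 1)" using Py(1) y1 by (intro power_mono) auto
      finally have "real D \<le> real (P ^ (8 * n + 1))" by simp
      thus ?thesis by (simp only: of_nat_le_iff)
    qed
    have delta: "c / (2 * y) \<le> c / real P" using c Py y1 by (intro divide_left_mono) auto
    show ?thesis
    proof (rule translates_independent[where \<theta> = \<theta> and \<xi> = "\<theta> + of_nat k * t" and D = D and a = a and A = A
          and d = d and T = T and Q = Q and \<Lambda> = \<Lambda> and \<delta> = "c / (2 * y)"])
      fix \<beta> assume \<beta>: "algebraic_int \<beta>" "\<beta> \<noteq> 0" "\<And>m. m > 0 \<Longrightarrow> \<beta> ^ m \<noteq> 1" "card (conjugates \<beta>) \<le> D"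
      have "c / real P \<le> (\<Sum>b\<in>conjugates \<beta>. ln (max 1 (norm b)))"
        using \<beta> DP by (intro dob[OF PP]) auto
      thus "c / (2 * y) \<le> (\<Sum>b\<in>conjugates \<beta>. ln (max 1 (norm b)))" using delta by linarith
    qed (use assms(1,3) \<theta>(1) \<alpha>\<theta> \<theta>d a A1 A t k cardD num in \<open>simp_all add: T_def \<Lambda>_def\<close>)
  qed
  moreover have "Y' ^ M > 0" using Y'(1) by simp
  ultimately show ?thesis by blast
qed

end
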